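(* There is an algorithm (the Puzzle Algorithm) which, on input $x>0$, computes the histogram $h(k)=\#\{n\le x : f(n)=k\}$ for all $k\ge 0$ using $O(x\log x)$ arithmetic operations and $O(x^{2/3})$ bits of space.
   Context: For a positive integer $n$, $f(n)$ denotes the number of ways to write $n$ as a sum of one or more consecutive primes (a single prime counts as such a sum); e.g. $f(6)=0$, $f(10)=1$ ($10=2+3+5$), $f(17)=2$ ($17=2+3+5+7=17$). Cost model: arithmetic operations on integers with $O(\log x)$ bits, including branching and array indexing, count as constant time, and space is measured in bits. The algorithm processes $[1,x]$ in consecutive segments of length $\Delta=x^{2/3}$, computing $f(n)$ for all $n$ in the current segment and accumulating the histogram. *)

theory Defs
  imports
    Complex_Main
    "HOL-Library.Landau_Symbols"
    "HOL-Library.Log_Nat"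
    "HOL-Computational_Algebra.Primes"
begin

section \<open>Sums of consecutive primes\<close>

text \<open>A run of consecutive primes is represented by the set of its members, so that ways of
  writing \<open>n\<close> correspond to such sets with sum \<open>n\<close>.\<close>

definition consecutive_primes :: "nat set \<Rightarrow> bool" where
  "consecutive_primes S \<longleftrightarrow> S \<noteq> {} \<and> (\<exists>a b. S = {p. prime p \<and> a \<le> p \<and> p \<le> b})"

definition consec_prime_reps :: "nat \<Rightarrow> nat" where
  "consec_prime_reps n = card {S. consecutive_primes S \<and> \<Sum>S = n}"

definition histogram :: "nat \<Rightarrow> nat \<Rightarrow> nat" where
  "histogram x k = card {n. 1 \<le> n \<and> n \<le> x \<and> consec_prime_reps n = k}"


section \<open>Random access machines\<close>

text \<open>A single memory of natural-number cells, addressed directly by the constants in the program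
  text and indirectly by \<open>Load\<close> and \<open>Store\<close>; there are no registers outside this memory, so all
  data of an algorithm is accounted for in the space measure. Every instruction costs one unit of
  time. Subtraction is truncated, and \<open>div\<close> and \<open>mod\<close> by zero follow the HOL conventions.\<close>

datatype arith = Plus | Minus | Times | Div | Mod

datatype instr =
    Const nat nat
  | Arith arith nat nat nat
  | Load nat nat
  | Store nat nat
  | Jump nat
  | JumpLess nat nat nat

type_synonym program = "instr list"
type_synonym mem = "nat \<Rightarrow> nat"
type_synonym config = "nat \<times> mem"

fun arith_fun :: "arith \<Rightarrow> nat \<Rightarrow> nat \<Rightarrow> nat" where
  "arith_fun Plus u v = u + v"
| "arith_fun Minus u v = u - v"
| "arith_fun Times u v = u * v"
| "arith_fun Div u v = u div v"
| "arith_fun Mod u v = u mod v"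

fun exec_instr :: "instr \<Rightarrow> config \<Rightarrow> config" where
  "exec_instr (Const d c) (pc, m) = (Suc pc, m(d := c))"
| "exec_instr (Arith f d a b) (pc, m) = (Suc pc, m(d := arith_fun f (m a) (m b)))"
| "exec_instr (Load d a) (pc, m) = (Suc pc, m(d := m (m a)))"
| "exec_instr (Store a b) (pc, m) = (Suc pc, m(m a := m b))"
| "exec_instr (Jump l) (pc, m) = (l, m)"
| "exec_instr (JumpLess a b l) (pc, m) = (if m a < m b then l else Suc pc, m)"

fun accessed :: "instr \<Rightarrow> mem \<Rightarrow> nat set" where
  "accessed (Const d c) m = {d}"
| "accessed (Arith f d a b) m = {d, a, b}"
| "accessed (Load d a) m = {d, a, m a}"
| "accessed (Store a b) m = {a, m a, b}"
| "accessed (Jump l) m = {}"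
| "accessed (JumpLess a b l) m = {a, b}"

text \<open>The machine halts by moving the program counter past the end of the program.\<close>

definition halted :: "program \<Rightarrow> config \<Rightarrow> bool" where
  "halted P c \<longleftrightarrow> length P \<le> fst c"

definition step :: "program \<Rightarrow> config \<Rightarrow> config" where
  "step P c = (if halted P c then c else exec_instr (P ! fst c) c)"

text \<open>The input is placed in cell 0; all other cells are initially 0.\<close>

definition run :: "program \<Rightarrow> nat \<Rightarrow> nat \<Rightarrow> config" where
  "run P x t = (step P ^^ t) (0, (\<lambda>_. 0)(0 := x))"

definition terminates :: "program \<Rightarrow> nat \<Rightarrow> bool" where
  "terminates P x \<longleftrightarrow> (\<exists>t. halted P (run P x t))"

text \<open>The quantities below are meaningful only if \<open>P\<close> terminates on \<open>x\<close>.\<close>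

definition run_time :: "program \<Rightarrow> nat \<Rightarrow> nat" where
  "run_time P x = (LEAST t. halted P (run P x t))"

definition final_mem :: "program \<Rightarrow> nat \<Rightarrow> mem" where
  "final_mem P x = snd (run P x (run_time P x))"

text \<open>The memory in use is the whole address range up to the largest address ever accessed
  (counting cells that are skipped over), so no information can be hidden in sparse addresses.\<close>

definition num_cells :: "program \<Rightarrow> nat \<Rightarrow> nat" where
  "num_cells P x =
     Suc (Max (insert 0 (\<Union>t<run_time P x. accessed (P ! fst (run P x t)) (snd (run P x t)))))"

text \<open>Logarithmic space measure of Aho, Hopcroft and Ullman: a cell is charged the binary length of
  the largest value it ever holds, but at least one bit.\<close>

definition cell_bits :: "program \<Rightarrow> nat \<Rightarrow> nat \<Rightarrow> nat" where
  "cell_bits P x a = (MAX t\<in>{..run_time P x}. max 1 (floorlog 2 (snd (run P x t) a)))"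

definition space_bits :: "program \<Rightarrow> nat \<Rightarrow> nat" where
  "space_bits P x = (\<Sum>a<num_cells P x. cell_bits P x a)"

definition word_bits :: "program \<Rightarrow> nat \<Rightarrow> nat" where
  "word_bits P x = (MAX a\<in>{..<num_cells P x}. cell_bits P x a)"

text \<open>Output of a finitely supported function: on halting, cell 0 holds the start address and cell 1
  the length of an array with the values; the function vanishes beyond the array.\<close>

definition outputs :: "mem \<Rightarrow> (nat \<Rightarrow> nat) \<Rightarrow> bool" where
  "outputs m h \<longleftrightarrow> (\<forall>k. h k = (if k < m 1 then m (m 0 + k) else 0))"

end

theory Submission
  imports Defs "HOL-Analysis.Harmonic_Numbers" "HOL-Real_Asymp.Real_Asymp"
begin

text \<open>For every length \<open>k\<close> a window of \<open>k\<close> consecutive primes slides upwards; each move adds or drops one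
  prime, and the windows of all lengths are advanced in lockstep through segments of \<open>R \<approx> sqrt (2 x)\<close>
  consecutive sums. By Chebyshev-type estimates the largest prime in a window of \<open>k\<close> primes is at most
  512 times their mean, so both ends of window \<open>k\<close> scan only \<open>O(x / k)\<close> integers, \<open>O(x log x)\<close> in total.

  Primes below \<open>T = O(x\<^sup>2\<^sup>/\<^sup>3)\<close> come from one shared bit table. Only windows with \<open>k < x\<^sup>1\<^sup>/\<^sup>3\<close> reach
  further; each of their two ends reads a private segmented sieve of \<open>O(sqrt (x / k))\<close> bits, which sums
  to \<open>O(x\<^sup>2\<^sup>/\<^sup>3)\<close> bits. A plain segmented sieve would cost \<open>O(log log x)\<close> per integer. Striking out only the
  multiples \<open>p * m\<close> with \<open>m\<close> free of factors up to \<open>w\<close>, where \<open>w! \<approx> x\<^sup>1\<^sup>/\<^sup>3\<close>, saves a factor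
  \<open>log w \<approx> log log x\<close>, so that the total work stays within \<open>O(x log x)\<close>.\<close>


section \<open>A structured language compiled to the machine\<close>

text \<open>The segment length balances three demands. A sum of \<open>k\<close> distinct naturals
  is at least k (k - 1) / 2, so only \<open>R\<close>, about sqrt (2 x), window lengths matter. With
  segments of \<open>R\<close> sums, visiting all windows in each of the x / R segments costs O(x)
  bookkeeping. And counters, residues and window records are whole words: O(sqrt x) of them fit
  easily, whereas x^(2/3) word counters would exceed the space bound. Everything else in memory must
  be a single bit, which is why the machine model is wrapped in a language that tracks value and
  address bounds. Both ends of a window only move upwards through all segments, so time is amortised
  by potentials in their positions. A private block of length about sqrt (x / k) is, up to
  constants, the shortest that pays for running through all sieving primes below sqrt (512 x / k).
  The size of \<open>w!\<close> is dictated by the ranges sieved: they end beyond the square of the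
  cube root of \<open>x\<close>, so the cofactors of a sieving prime \<open>p\<close> always cover a
  full period of the wheel, and a density estimate over whole periods applies.\<close>

datatype exp = Num nat | Var nat | Bin arith exp exp | Arr nat exp

datatype com =
    Skip
  | Assign nat exp  (infix \<open>::=\<close> 61)
  | AStore nat exp exp  (\<open>_\<langle>_\<rangle> ::= _\<close> [62, 0, 61] 61)
  | Seq com com  (infixr \<open>;;\<close> 60)
  | If exp exp com com  (\<open>IF _ < _ / THEN _ / ELSE _\<close> [62, 62, 61, 61] 61)
  | While exp exp com  (\<open>WHILE _ < _ / DO _\<close> [62, 62, 61] 61)

abbreviation plus_exp (infixl \<open>\<oplus>\<close> 65) where "a \<oplus> b \<equiv> Bin Plus a b"
abbreviation minus_exp (infixl \<open>\<ominus>\<close> 65) where "a \<ominus> b \<equiv> Bin Minus a b"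
abbreviation times_exp (infixl \<open>\<otimes>\<close> 70) where "a \<otimes> b \<equiv> Bin Times a b"
abbreviation div_exp (infixl \<open>\<oslash>\<close> 70) where "a \<oslash> b \<equiv> Bin Div a b"
abbreviation mod_exp (infixl \<open>\<odot>\<close> 70) where "a \<odot> b \<equiv> Bin Mod a b"

fun eval :: "exp \<Rightarrow> (nat \<Rightarrow> nat) \<Rightarrow> (nat \<Rightarrow> nat \<Rightarrow> nat) \<Rightarrow> nat" where
  "eval (Num c) v a = c"
| "eval (Var x) v a = v x"
| "eval (Bin f e1 e2) v a = arith_fun f (eval e1 v a) (eval e2 v a)"
| "eval (Arr A e) v a = a A (eval e v a)"

text \<open>Expressions compile to straight-line code, so this is both the code length and the exact
  running time.\<close>

fun ecost :: "exp \<Rightarrow> nat" where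
  "ecost (Num c) = 1"
| "ecost (Var x) = 2"
| "ecost (Bin f e1 e2) = ecost e1 + ecost e2 + 1"
| "ecost (Arr A e) = ecost e + 5"

fun edepth :: "exp \<Rightarrow> nat" where
  "edepth (Num c) = 1"
| "edepth (Var x) = 1"
| "edepth (Bin f e1 e2) = Suc (max (edepth e1) (edepth e2))"
| "edepth (Arr A e) = Suc (edepth e)"

fun elits :: "exp \<Rightarrow> nat set" where
  "elits (Num c) = {c}"
| "elits (Var x) = {}"
| "elits (Bin f e1 e2) = elits e1 \<union> elits e2"
| "elits (Arr A e) = elits e"

fun ewf :: "exp \<Rightarrow> bool" where
  "ewf (Num c) = True"
| "ewf (Var x) = (x < 64)"
| "ewf (Bin f e1 e2) = (ewf e1 \<and> ewf e2)"
| "ewf (Arr A e) = (A < 16 \<and> ewf e)"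

text \<open>Depth 8 serves twice: temporaries starting at cell 64 or 65 stay below cell 80, and
  values stay within \<open>U ^ (2 ^ 8)\<close>.\<close>

abbreviation edwf :: "exp \<Rightarrow> bool" where
  "edwf e \<equiv> ewf e \<and> edepth e \<le> 8"

fun lits :: "com \<Rightarrow> nat set" where
  "lits Skip = {}"
| "lits (x ::= e) = elits e"
| "lits (A\<langle>e1\<rangle> ::= e2) = elits e1 \<union> elits e2"
| "lits (c1 ;; c2) = lits c1 \<union> lits c2"
| "lits (IF e1 < e2 THEN c1 ELSE c2) = elits e1 \<union> elits e2 \<union> lits c1 \<union> lits c2"
| "lits (WHILE e1 < e2 DO c) = elits e1 \<union> elits e2 \<union> lits c"

fun wf :: "com \<Rightarrow> bool" where
  "wf Skip = True"
| "wf (x ::= e) = (x < 64 \<and> edwf e)"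
| "wf (A\<langle>e1\<rangle> ::= e2) = (A < 16 \<and> edwf e1 \<and> edwf e2)"
| "wf (c1 ;; c2) = (wf c1 \<and> wf c2)"
| "wf (IF e1 < e2 THEN c1 ELSE c2) = (edwf e1 \<and> edwf e2 \<and> wf c1 \<and> wf c2)"
| "wf (WHILE e1 < e2 DO c) = (edwf e1 \<and> edwf e2 \<and> wf c)"

text \<open>Variable \<open>x\<close> lives in cell \<open>x < 64\<close>, cells 64 to 79 hold intermediate results, and entry \<open>i\<close>
  of array \<open>A < 16\<close> lives in cell \<open>80 + 16 * i + A\<close>: interleaving the arrays makes them all
  unbounded without any address bookkeeping.\<close>

fun ecomp :: "nat \<Rightarrow> exp \<Rightarrow> instr list" where
  "ecomp d (Num c) = [Const d c]"
| "ecomp d (Var x) = [Const d 0, Arith Plus d d x]"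
| "ecomp d (Bin f e1 e2) = ecomp d e1 @ ecomp (Suc d) e2 @ [Arith f d d (Suc d)]"
| "ecomp d (Arr A e) = ecomp d e @
     [Const (Suc d) 16, Arith Times d d (Suc d), Const (Suc d) (80 + A), Arith Plus d d (Suc d), Load d d]"

fun clen :: "com \<Rightarrow> nat" where
  "clen Skip = 0"
| "clen (x ::= e) = ecost e + 2"
| "clen (A\<langle>e1\<rangle> ::= e2) = ecost e1 + 4 + ecost e2 + 1"
| "clen (c1 ;; c2) = clen c1 + clen c2"
| "clen (IF e1 < e2 THEN c1 ELSE c2) = ecost e1 + ecost e2 + 1 + clen c2 + 1 + clen c1"
| "clen (WHILE e1 < e2 DO c) = ecost e1 + ecost e2 + 2 + clen c + 1"

text \<open>The else branch comes first because \<open>JumpLess\<close> falls through when the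
  comparison fails; in a loop the fall-through is the exit jump. There is no move instruction, so an
  assignment copies by adding zero.\<close>

fun comp :: "nat \<Rightarrow> com \<Rightarrow> instr list" where
  "comp l Skip = []"
| "comp l (x ::= e) = ecomp 64 e @ [Const 65 0, Arith Plus x 64 65]"
| "comp l (A\<langle>e1\<rangle> ::= e2) = ecomp 64 e1 @
     [Const 65 16, Arith Times 64 64 65, Const 65 (80 + A), Arith Plus 64 64 65] @
     ecomp 65 e2 @ [Store 64 65]"
| "comp l (c1 ;; c2) = comp l c1 @ comp (l + clen c1) c2"
| "comp l (IF e1 < e2 THEN c1 ELSE c2) = ecomp 64 e1 @ ecomp 65 e2 @
     [JumpLess 64 65 (l + ecost e1 + ecost e2 + 1 + clen c2 + 1)] @
     comp (l + ecost e1 + ecost e2 + 1) c2 @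
     [Jump (l + ecost e1 + ecost e2 + 1 + clen c2 + 1 + clen c1)] @
     comp (l + ecost e1 + ecost e2 + 1 + clen c2 + 1) c1"
| "comp l (WHILE e1 < e2 DO c) = ecomp 64 e1 @ ecomp 65 e2 @
     [JumpLess 64 65 (l + ecost e1 + ecost e2 + 2),
      Jump (l + ecost e1 + ecost e2 + 2 + clen c + 1)] @
     comp (l + ecost e1 + ecost e2 + 2) c @ [Jump l]"

lemma length_ecomp [simp]: "length (ecomp d e) = ecost e"
  by (induction e arbitrary: d) auto

lemma length_comp [simp]: "length (comp l c) = clen c"
  by (induction c arbitrary: l) auto

fun code_at :: "program \<Rightarrow> nat \<Rightarrow> instr list \<Rightarrow> bool" where
  "code_at P l [] = True"
| "code_at P l (i # is) = (l < length P \<and> P ! l = i \<and> code_at P (Suc l) is)"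

lemma code_at_append [simp]:
  "code_at P l (is @ js) \<longleftrightarrow> code_at P l is \<and> code_at P (l + length is) js"
  by (induction "is" arbitrary: l) auto

lemma code_at_self: "code_at (xs @ ys) (length xs) ys"
proof (induction ys arbitrary: xs)
  case (Cons y ys)
  from Cons[of "xs @ [y]"] show ?case by simp
qed simp

lemma code_at_nth: "code_at P l is \<Longrightarrow> j < length is \<Longrightarrow> l + j < length P \<and> P ! (l + j) = is ! j"
proof (induction "is" arbitrary: l j)
  case (Cons i "is")
  then show ?case using Cons.IH[of "Suc l" "j - 1"] by (cases j) auto
qed simp

lemma Suc4: "Suc (Suc (Suc (Suc n))) = n + 4"
  by simp

lemma addr_eq_iff: "A < 16 \<Longrightarrow> A' < 16 \<Longrightarrow> 80 + 16 * i + A = 80 + 16 * j + A' \<longleftrightarrow> i = j \<and> A = (A' :: nat)"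
  by presburger

text \<open>\<open>U\<close> bounds variables and array entries, \<open>L\<close> the indices of array 0 and \<open>Lw\<close> those of all other
  arrays. Array 0 is restricted to bits, since a cell is charged for its largest value; this is
  what makes the sieve tables cheap.\<close>

locale ram =
  fixes U L Lw :: nat
  assumes U_ge2: "2 \<le> U" and U_addr: "96 + 16 * L \<le> U" and Lw_le: "Lw \<le> L"
begin

text \<open>Bounds all intermediate values of expressions, which can exceed \<open>U\<close>. A
  fixed power of \<open>U\<close> still has O(log \<open>U\<close>) bits.\<close>

definition wmax :: nat where
  "wmax = U ^ 512"

text \<open>The sixteen arrays are interleaved, so beyond index \<open>Lw\<close> all of them must
  be limited to a bit; there only array 0 is ever written.\<close>

definition cbound :: "nat \<Rightarrow> nat" where
  "cbound b = (if b < 80 + 16 * Lw then wmax else 1)"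

definition good :: "mem \<Rightarrow> bool" where
  "good m \<longleftrightarrow> (\<forall>b. m b \<le> cbound b)"

text \<open>Space is charged for the largest value ever held and the largest address ever touched,
  so both bounds are recorded at every intermediate configuration and not only at the
  endpoints.\<close>

inductive reach :: "program \<Rightarrow> config \<Rightarrow> nat \<Rightarrow> config \<Rightarrow> bool" for P where
  reach_refl: "good (snd c) \<Longrightarrow> reach P c 0 c"
| reach_step: "good (snd c) \<Longrightarrow> \<not> halted P c \<Longrightarrow>
    accessed (P ! fst c) (snd c) \<subseteq> {..<80 + 16 * L} \<Longrightarrow>
    reach P (exec_instr (P ! fst c) c) t c' \<Longrightarrow> reach P c (Suc t) c'"

lemma reach_trans: "reach P c t c' \<Longrightarrow> reach P c' t' c'' \<Longrightarrow> reach P c (t + t') c''"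
  by (induction rule: reach.induct) (auto intro: reach_step)

lemma reach_instr:
  assumes "good m" "l < length P" "P ! l = i" "accessed i m \<subseteq> {..<80 + 16 * L}"
    "exec_instr i (l, m) = c'" "good (snd c')"
  shows "reach P (l, m) 1 c'"
  using assms reach_step[of "(l, m)" P 0 c'] reach_refl[of c'] by (simp add: halted_def)

lemma reach_good: "reach P c t c' \<Longrightarrow> good (snd c')"
  by (induction rule: reach.induct) auto

lemma reach_funpow:
  assumes "reach P c t c'"
  shows "(step P ^^ t) c = c'"
    and "i < t \<Longrightarrow> \<not> halted P ((step P ^^ i) c)"
    and "i < t \<Longrightarrow> accessed (P ! fst ((step P ^^ i) c)) (snd ((step P ^^ i) c)) \<subseteq> {..<80 + 16 * L}"
    and "i \<le> t \<Longrightarrow> good (snd ((step P ^^ i) c))"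
  using assms
proof (induction arbitrary: i rule: reach.induct)
  case (reach_step c t c')
  have s: "(step P ^^ Suc j) c = (step P ^^ j) (exec_instr (P ! fst c) c)" for j
    using reach_step.hyps(2) by (simp add: funpow_Suc_right step_def del: funpow.simps)
  { case 1 show ?case using reach_step.IH(1) s by simp }
  { case 2 show ?case using reach_step.hyps(2) reach_step.IH(2) s 2 by (cases i) (auto simp del: funpow.simps(2)) }
  { case 3 show ?case using reach_step.hyps(3) reach_step.IH(3) s 3 by (cases i) (auto simp del: funpow.simps(2)) }
  { case 4 show ?case using reach_step.hyps(1) reach_step.IH(4) s 4 by (cases i) (auto simp del: funpow.simps(2)) }
qed auto

lemma good_upd: "good m \<Longrightarrow> w \<le> cbound b \<Longrightarrow> good (m(b := w))"
  by (auto simp: good_def)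

lemma U_le_pow: "n > 0 \<Longrightarrow> U \<le> U ^ n"
  using U_ge2 by (simp add: self_le_power)

lemma cbound_small: "b < 80 \<Longrightarrow> cbound b = wmax"
  by (simp add: cbound_def)

lemma const_le_pow: "c \<le> U \<Longrightarrow> c \<le> wmax"
  using U_le_pow[of 512] by (simp add: wmax_def)

lemma one_le_wmax: "1 \<le> wmax"
  using const_le_pow[of 1] U_ge2 by simp

definition bounded :: "(nat \<Rightarrow> nat) \<Rightarrow> (nat \<Rightarrow> nat \<Rightarrow> nat) \<Rightarrow> bool" where
  "bounded v a \<longleftrightarrow> (\<forall>x. v x \<le> U) \<and> (\<forall>A i. a A i \<le> U)"

definition rel :: "(nat \<Rightarrow> nat) \<Rightarrow> (nat \<Rightarrow> nat \<Rightarrow> nat) \<Rightarrow> mem \<Rightarrow> bool" where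
  "rel v a m \<longleftrightarrow> (\<forall>x<64. m x = v x) \<and> (\<forall>A<16. \<forall>i. m (80 + 16 * i + A) = a A i)"

text \<open>Reading a cell also touches its address, so array reads are restricted like writes.
  Arithmetic is total and never fails.\<close>

fun eok :: "exp \<Rightarrow> (nat \<Rightarrow> nat) \<Rightarrow> (nat \<Rightarrow> nat \<Rightarrow> nat) \<Rightarrow> bool" where
  "eok (Num c) v a = True"
| "eok (Var x) v a = True"
| "eok (Bin f e1 e2) v a = (eok e1 v a \<and> eok e2 v a)"
| "eok (Arr A e) v a = (eok e v a \<and> eval e v a < L)"

text \<open>Every operation at most squares a common bound \<open>M\<close> of its arguments:
  \<open>M + M \<le> M * M\<close> because \<open>2 \<le> M\<close>, and differences, quotients and
  remainders do not exceed the first argument.\<close>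

lemma eval_bound:
  assumes "bounded v a" "\<forall>c\<in>elits e. c \<le> U"
  shows "eval e v a \<le> U ^ (2 ^ edepth e)"
  using assms(2)
proof (induction e)
  case (Num c)
  then show ?case using U_le_pow[of "2 ^ 1"] by simp
next
  case (Var x)
  then show ?case using assms(1) U_le_pow[of "2 ^ 1"] by (auto simp: bounded_def intro: order_trans)
next
  case (Bin f e1 e2)
  define d where "d = max (edepth e1) (edepth e2)"
  let ?M = "U ^ (2 ^ d)"
  have mono: "U ^ (2 ^ k) \<le> ?M" if "k \<le> d" for k
    using that U_ge2 by (intro power_increasing) (auto intro: power_increasing)
  have 1: "eval e1 v a \<le> ?M" "eval e2 v a \<le> ?M"
    using Bin mono[of "edepth e1"] mono[of "edepth e2"] by (auto simp: d_def)
  have sq: "?M * ?M = U ^ (2 ^ Suc d)"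
    by (simp add: mult_2 power_add)
  have "2 \<le> ?M" using U_ge2 U_le_pow[of "2 ^ d"] by simp
  then have "?M + ?M \<le> ?M * ?M" by (metis mult_2 mult_le_mono1)
  moreover have "?M \<le> ?M * ?M" by simp
  moreover have "eval e1 v a * eval e2 v a \<le> ?M * ?M" using 1 by (intro mult_mono) auto
  moreover have "eval e1 v a div eval e2 v a \<le> ?M" "eval e1 v a mod eval e2 v a \<le> ?M"
    using 1 by (meson div_le_dividend mod_less_eq_dividend order_trans)+
  ultimately have "arith_fun f (eval e1 v a) (eval e2 v a) \<le> ?M * ?M"
    using 1 by (cases f) auto
  then show ?case using sq by (simp add: d_def)
next
  case (Arr A e)
  then show ?case using assms(1) U_le_pow[of "2 ^ (Suc (edepth e))"]
    by (auto simp: bounded_def intro: order_trans[of _ U])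
qed

lemma eval_le: 
  assumes "bounded v a" "\<forall>c\<in>elits e. c \<le> U" "edepth e \<le> 8"
  shows "eval e v a \<le> wmax"
proof -
  have "(2::nat) ^ edepth e \<le> 2 ^ 8" using assms(3) by (intro power_increasing) auto
  then have "U ^ (2 ^ edepth e) \<le> wmax" using U_ge2 unfolding wmax_def by (intro power_increasing) auto
  then show ?thesis using eval_bound[OF assms(1,2)] by linarith
qed

lemma rel_temp: "rel v a m \<Longrightarrow> 64 \<le> d \<Longrightarrow> d < 80 \<Longrightarrow> rel v a (m(d := w))"
  by (auto simp: rel_def)

lemma addr_code:
  assumes "code_at P l [Const (Suc d) 16, Arith Times d d (Suc d), Const (Suc d) (80 + A), Arith Plus d d (Suc d)]"
    and "good m" "64 \<le> d" "d < 79" "m d < L" "A < 16"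
  shows "reach P (l, m) 4 (l + 4, m(d := 80 + 16 * m d + A, Suc d := 80 + A))"
proof -
  let ?m1 = "m(Suc d := 16)"
  let ?m2 = "?m1(d := m d * 16)"
  let ?m3 = "?m2(Suc d := 80 + A)"
  let ?m4 = "?m3(d := m d * 16 + (80 + A))"
  have cb: "w \<le> cbound b" if "b < 80" "w \<le> U" for w b
    using that const_le_pow cbound_small by simp
  have g: "good ?m1" "good ?m2" "good ?m3" "good ?m4"
    using assms U_addr by (auto intro!: good_upd cb)
  have "reach P (l, m) 1 (l + 1, ?m1)"
    by (rule reach_instr) (use assms g in auto)
  moreover have "reach P (l + 1, ?m1) 1 (l + 2, ?m2)"
    by (rule reach_instr) (use assms g in auto)
  moreover have "reach P (l + 2, ?m2) 1 (l + 3, ?m3)"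
    by (rule reach_instr) (use assms g in \<open>auto simp: numeral_3_eq_3\<close>)
  moreover have "reach P (l + 3, ?m3) 1 (l + 4, ?m4)"
    by (rule reach_instr) (use assms g in \<open>auto simp: numeral_3_eq_3\<close>)
  moreover have "?m4 = m(d := 80 + 16 * m d + A, Suc d := 80 + A)"
    by (auto simp: fun_eq_iff)
  ultimately have "reach P (l, m) (1 + 1 + 1 + 1) (l + 4, ?m4)"
    using reach_trans by blast
  then show ?thesis using \<open>?m4 = _\<close> by (simp add: Suc4)
qed

text \<open>The clause about cells below \<open>d\<close> lets the value of a left operand survive
  the evaluation of the right one.\<close>

lemma ecomp_correct:
  assumes "code_at P l (ecomp d e)" "rel v a m" "good m" "bounded v a" "eok e v a" "ewf e"
    "\<forall>c\<in>elits e. c \<le> U" "edepth e \<le> 8" "64 \<le> d" "d + edepth e < 80"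
  shows "\<exists>m'. reach P (l, m) (ecost e) (l + ecost e, m') \<and> m' d = eval e v a \<and> rel v a m' \<and>
     (\<forall>b. 64 \<le> b \<and> b < d \<longrightarrow> m' b = m b)"
  using assms
proof (induction e arbitrary: l d m)
  case (Num c)
  have "reach P (l, m) (ecost (Num c)) (l + ecost (Num c), m(d := c))"
    unfolding ecost.simps by (rule reach_instr) (use Num in \<open>auto intro!: good_upd simp: const_le_pow cbound_small\<close>)
  moreover have "rel v a (m(d := c))" using Num by (intro rel_temp) auto
  ultimately show ?case by (metis (no_types, lifting) eval.simps(1) fun_upd_apply less_irrefl)
next
  case (Var x)
  let ?m1 = "m(d := 0)" and ?m2 = "m(d := v x)"
  have mx: "m x = v x" "x \<noteq> d" "x < 80" using Var by (auto simp: rel_def)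
  have vx: "v x \<le> wmax" using Var by (auto simp: bounded_def const_le_pow)
  have "reach P (l, m) 1 (l + 1, ?m1)"
    by (rule reach_instr) (use Var in \<open>auto intro!: good_upd simp: const_le_pow cbound_small\<close>)
  moreover have "reach P (l + 1, ?m1) 1 (l + 2, ?m2)"
    by (rule reach_instr) (use Var mx vx in \<open>auto intro!: good_upd simp: const_le_pow cbound_small\<close>)
  ultimately have "reach P (l, m) (ecost (Var x)) (l + ecost (Var x), ?m2)"
    using reach_trans[of P _ 1 _ 1] by (simp add: numeral_2_eq_2)
  moreover have "rel v a ?m2" using Var by (intro rel_temp) auto
  ultimately show ?case by (metis (no_types, lifting) eval.simps(2) fun_upd_apply less_irrefl)
next
  case (Bin f e1 e2)
  have dd: "d + edepth e1 < 80" "Suc d + edepth e2 < 80" using Bin.prems by auto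
  from dd Bin.IH(1)[of l d m] Bin.prems obtain m1 where
    m1: "reach P (l, m) (ecost e1) (l + ecost e1, m1)" "m1 d = eval e1 v a" "rel v a m1"
      "\<forall>b. 64 \<le> b \<and> b < d \<longrightarrow> m1 b = m b" by auto
  from dd(2) Bin.IH(2)[of "l + ecost e1" "Suc d" m1] Bin.prems m1 reach_good[OF m1(1)] obtain m2 where
    m2: "reach P (l + ecost e1, m1) (ecost e2) (l + ecost e1 + ecost e2, m2)"
      "m2 (Suc d) = eval e2 v a" "rel v a m2"
      "\<forall>b. 64 \<le> b \<and> b < Suc d \<longrightarrow> m2 b = m1 b" by auto
  have m2d: "m2 d = eval e1 v a" using m1 m2 Bin.prems by auto
  let ?w = "eval (Bin f e1 e2) v a"
  have w: "?w \<le> wmax"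
    using eval_le[of v a "Bin f e1 e2"] Bin.prems by auto
  have "reach P (l + ecost e1 + ecost e2, m2) 1 (l + ecost e1 + ecost e2 + 1, m2(d := ?w))"
    by (rule reach_instr)
      (use Bin.prems m2 m2d w reach_good[OF m2(1)] in \<open>auto intro!: good_upd simp: cbound_small add.assoc\<close>)
  from reach_trans[OF reach_trans[OF m1(1) m2(1)] this]
  have "reach P (l, m) (ecost (Bin f e1 e2)) (l + ecost (Bin f e1 e2), m2(d := ?w))"
    by (simp add: add.assoc)
  moreover have "rel v a (m2(d := ?w))" using Bin.prems m2 by (intro rel_temp) auto
  moreover have "\<forall>b. 64 \<le> b \<and> b < d \<longrightarrow> (m2(d := ?w)) b = m b" using m1 m2 by auto
  moreover have "(m2(d := ?w)) d = ?w" by simp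
  ultimately show ?case by blast
next
  case (Arr A e)
  from Arr.IH[of l d m] Arr.prems obtain m1 where
    m1: "reach P (l, m) (ecost e) (l + ecost e, m1)" "m1 d = eval e v a" "rel v a m1"
      "\<forall>b. 64 \<le> b \<and> b < d \<longrightarrow> m1 b = m b" by auto
  let ?i = "eval e v a"
  let ?m2 = "m1(d := 80 + 16 * ?i + A, Suc d := 80 + A)"
  have m2: "reach P (l + ecost e, m1) 4 (l + ecost e + 4, ?m2)"
    using addr_code[of P "l + ecost e" d A m1] Arr.prems m1 reach_good[OF m1(1)] by auto
  have r2: "rel v a ?m2" using Arr.prems m1 by (intro rel_temp) auto
  then have rd: "?m2 (80 + 16 * ?i + A) = a A ?i" using Arr.prems unfolding rel_def by auto
  let ?m3 = "?m2(d := a A ?i)"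
  have "a A ?i \<le> wmax" using Arr.prems by (auto simp: bounded_def const_le_pow)
  moreover have g2: "good ?m2" using reach_good[OF m2] by simp
  ultimately have g3: "good ?m3" using Arr.prems by (intro good_upd[OF g2]) (simp add: cbound_small)
  have "code_at P (l + ecost e + 4) [Load d d]" using Arr.prems by (simp add: Suc4 add_ac)
  then have "reach P (l + ecost e + 4, ?m2) 1 (l + ecost e + 4 + 1, ?m3)"
    using Arr.prems rd g2 g3 by (intro reach_instr[where i = "Load d d"]) auto
  from reach_trans[OF reach_trans[OF m1(1) m2] this]
  have "reach P (l, m) (ecost (Arr A e)) (l + ecost (Arr A e), ?m3)"
    by (simp add: add_ac)
  moreover have "rel v a ?m3" by (rule rel_temp[OF r2]) (use Arr.prems in auto)
  moreover have "\<forall>b. 64 \<le> b \<and> b < d \<longrightarrow> ?m3 b = m b" using m1 by auto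
  moreover have "?m3 d = eval (Arr A e) v a" by simp
  ultimately show ?case by blast
qed

section \<open>Timed big-step semantics and correctness of the compiler\<close>

definition wok :: "nat \<Rightarrow> nat \<Rightarrow> nat \<Rightarrow> bool" where
  "wok A i w \<longleftrightarrow> (if A = 0 then i < L \<and> w \<le> 1 else i < Lw \<and> w \<le> U)"

text \<open>A derivation exists only if the run ends and every write respects the bounds, so it
  certifies space as well as the exact number of compiled instructions.\<close>

inductive big :: "com \<Rightarrow> (nat \<Rightarrow> nat) \<Rightarrow> (nat \<Rightarrow> nat \<Rightarrow> nat) \<Rightarrow> nat \<Rightarrow>
    (nat \<Rightarrow> nat) \<Rightarrow> (nat \<Rightarrow> nat \<Rightarrow> nat) \<Rightarrow> bool" where
  "big Skip v a 0 v a"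
| "eok e v a \<Longrightarrow> eval e v a \<le> U \<Longrightarrow> big (x ::= e) v a (ecost e + 2) (v(x := eval e v a)) a"
| "eok e1 v a \<Longrightarrow> eok e2 v a \<Longrightarrow> wok A (eval e1 v a) (eval e2 v a) \<Longrightarrow>
    big (A\<langle>e1\<rangle> ::= e2) v a (ecost e1 + 4 + ecost e2 + 1)
      v (a(A := (a A)(eval e1 v a := eval e2 v a)))"
| "big c1 v a t1 v1 a1 \<Longrightarrow> big c2 v1 a1 t2 v2 a2 \<Longrightarrow> big (c1 ;; c2) v a (t1 + t2) v2 a2"
| "eok e1 v a \<Longrightarrow> eok e2 v a \<Longrightarrow> eval e1 v a < eval e2 v a \<Longrightarrow> big c1 v a t v' a' \<Longrightarrow>
    big (IF e1 < e2 THEN c1 ELSE c2) v a (ecost e1 + ecost e2 + 1 + t) v' a'"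
| "eok e1 v a \<Longrightarrow> eok e2 v a \<Longrightarrow> \<not> eval e1 v a < eval e2 v a \<Longrightarrow> big c2 v a t v' a' \<Longrightarrow>
    big (IF e1 < e2 THEN c1 ELSE c2) v a (ecost e1 + ecost e2 + 1 + t + 1) v' a'"
| "eok e1 v a \<Longrightarrow> eok e2 v a \<Longrightarrow> \<not> eval e1 v a < eval e2 v a \<Longrightarrow>
    big (WHILE e1 < e2 DO c) v a (ecost e1 + ecost e2 + 2) v a"
| "eok e1 v a \<Longrightarrow> eok e2 v a \<Longrightarrow> eval e1 v a < eval e2 v a \<Longrightarrow> big c v a t v1 a1 \<Longrightarrow>
    big (WHILE e1 < e2 DO c) v1 a1 t' v' a' \<Longrightarrow>
    big (WHILE e1 < e2 DO c) v a (ecost e1 + ecost e2 + 1 + t + 1 + t') v' a'"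

inductive_cases big_SkipE: "big Skip v a t v' a'"
inductive_cases big_AssignE: "big (x ::= e) v a t v' a'"
inductive_cases big_AStoreE: "big (A\<langle>e1\<rangle> ::= e2) v a t v' a'"
inductive_cases big_SeqE: "big (c1 ;; c2) v a t v' a'"
inductive_cases big_IfE: "big (IF e1 < e2 THEN c1 ELSE c2) v a t v' a'"

lemma big_bounded: "big c v a t v' a' \<Longrightarrow> bounded v a \<Longrightarrow> bounded v' a'"
  by (induction rule: big.induct) (use U_ge2 in \<open>auto simp: bounded_def wok_def split: if_splits\<close>)

lemma ecomp2_correct:
  assumes "code_at P l (ecomp 64 e1 @ ecomp 65 e2)" "rel v a m" "good m" "bounded v a"
    "eok e1 v a" "edwf e1" "eok e2 v a" "edwf e2" "\<forall>c\<in>elits e1 \<union> elits e2. c \<le> U"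
  shows "\<exists>m'. reach P (l, m) (ecost e1 + ecost e2) (l + ecost e1 + ecost e2, m') \<and>
     m' 64 = eval e1 v a \<and> m' 65 = eval e2 v a \<and> rel v a m'"
proof -
  from ecomp_correct[of P l 64 e1 v a m] assms obtain m1 where
    m1: "reach P (l, m) (ecost e1) (l + ecost e1, m1)" "m1 64 = eval e1 v a" "rel v a m1" by auto
  from ecomp_correct[of P "l + ecost e1" 65 e2 v a m1] assms m1 reach_good[OF m1(1)] obtain m2 where
    m2: "reach P (l + ecost e1, m1) (ecost e2) (l + ecost e1 + ecost e2, m2)"
      "m2 65 = eval e2 v a" "rel v a m2" "\<forall>b. 64 \<le> b \<and> b < 65 \<longrightarrow> m2 b = m1 b" by auto
  then show ?thesis using m1 reach_trans[OF m1(1) m2(1)] by auto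
qed

lemma jump_less_reach:
  assumes "code_at P l [JumpLess 64 65 l']" "good m"
  shows "reach P (l, m) 1 (if m 64 < m 65 then l' else l + 1, m)"
  by (rule reach_instr) (use assms in auto)

lemma jump_reach: "code_at P l [Jump l'] \<Longrightarrow> good m \<Longrightarrow> reach P (l, m) 1 (l', m)"
  by (rule reach_instr) auto

lemma comp_correct:
  assumes "big c v a t v' a'" "code_at P l (comp l c)" "rel v a m" "good m" "bounded v a" "wf c"
    "\<forall>k\<in>lits c. k \<le> U"
  shows "\<exists>m'. reach P (l, m) t (l + clen c, m') \<and> rel v' a' m'"
  using assms
proof (induction arbitrary: l m rule: big.induct)
  case (1 v a)
  then show ?case using reach_refl[of "(l, m)"] by auto
next
  case (2 e v a x)
  from ecomp_correct[of P l 64 e v a m] 2 obtain m1 where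
    m1: "reach P (l, m) (ecost e) (l + ecost e, m1)" "m1 64 = eval e v a" "rel v a m1" by auto
  let ?m2 = "m1(65 := 0)"
  let ?m3 = "?m2(x := eval e v a)"
  note g1 = reach_good[OF m1(1), simplified]
  have g2: "good ?m2" using g1 by (auto intro!: good_upd)
  have g3: "good ?m3" using g2 2 by (auto intro!: good_upd simp: cbound_small const_le_pow)
  have "reach P (l + ecost e, m1) 1 (l + ecost e + 1, ?m2)"
    by (rule reach_instr) (use 2 g1 g2 in auto)
  moreover have "reach P (l + ecost e + 1, ?m2) 1 (l + ecost e + 2, ?m3)"
    by (rule reach_instr) (use 2 g2 g3 m1 in auto)
  ultimately have "reach P (l, m) (ecost e + 2) (l + clen (x ::= e), ?m3)"
    using reach_trans[OF m1(1) reach_trans[of P _ 1 _ 1]] by (simp add: add.assoc)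
  moreover have "rel (v(x := eval e v a)) a ?m3"
    using m1(3) 2 by (auto simp: rel_def)
  ultimately show ?case by blast
next
  case (3 e1 v a e2 A)
  from ecomp_correct[of P l 64 e1 v a m] 3 obtain m1 where
    m1: "reach P (l, m) (ecost e1) (l + ecost e1, m1)" "m1 64 = eval e1 v a" "rel v a m1" by auto
  let ?i = "eval e1 v a" and ?w = "eval e2 v a"
  have iL: "?i < L" using 3 Lw_le by (auto simp: wok_def split: if_splits)
  let ?m2 = "m1(64 := 80 + 16 * ?i + A, 65 := 80 + A)"
  have m2: "reach P (l + ecost e1, m1) 4 (l + ecost e1 + 4, ?m2)"
    using addr_code[of P "l + ecost e1" 64 A m1] 3 m1 reach_good[OF m1(1)] iL by auto
  have r2: "rel v a ?m2" using m1 by (intro rel_temp) auto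
  have "code_at P (l + ecost e1 + 4) (ecomp 65 e2)" using 3 by (simp add: Suc4 add_ac)
  from ecomp_correct[OF this r2] 3 reach_good[OF m2] obtain m3 where
    m3: "reach P (l + ecost e1 + 4, ?m2) (ecost e2) (l + ecost e1 + 4 + ecost e2, m3)"
      "m3 65 = ?w" "rel v a m3" "\<forall>b. 64 \<le> b \<and> b < 65 \<longrightarrow> m3 b = ?m2 b" by auto
  have m3a: "m3 64 = 80 + 16 * ?i + A" using m3(4) by auto
  note g3 = reach_good[OF m3(1), simplified]
  let ?m4 = "m3(80 + 16 * ?i + A := ?w)"
  have g4: "good ?m4" using g3
  proof (rule good_upd)
    show "?w \<le> cbound (80 + 16 * ?i + A)"
    proof (cases "A = 0")
      case True
      then show ?thesis using 3 U_ge2 by (auto simp: wok_def cbound_def intro: order_trans[OF _ one_le_wmax])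
    next
      case False
      then show ?thesis using 3 by (auto simp: wok_def cbound_def const_le_pow)
    qed
  qed
  have "code_at P (l + ecost e1 + 4 + ecost e2) [Store 64 65]" using 3 by (simp add: Suc4 add_ac)
  then have "reach P (l + ecost e1 + 4 + ecost e2, m3) 1 (l + ecost e1 + 4 + ecost e2 + 1, ?m4)"
    by (intro reach_instr) (use 3 g3 g4 m3 m3a iL in auto)
  moreover have "l + clen (A\<langle>e1\<rangle> ::= e2) = l + ecost e1 + 4 + ecost e2 + 1" by simp
  ultimately have "reach P (l, m) (ecost e1 + 4 + ecost e2 + 1) (l + clen (A\<langle>e1\<rangle> ::= e2), ?m4)"
    using reach_trans[OF reach_trans[OF reach_trans[OF m1(1) m2] m3(1)]] by metis
  moreover have "rel v (a(A := (a A)(?i := ?w))) ?m4"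
    unfolding rel_def
  proof (intro conjI allI impI)
    fix A' i assume "A' < (16::nat)"
    have "80 + 16 * i + A' = 80 + 16 * ?i + A \<longleftrightarrow> i = ?i \<and> A' = A"
      using \<open>A' < 16\<close> 3 by (intro addr_eq_iff) auto
    then show "?m4 (80 + 16 * i + A') = (a(A := (a A)(?i := ?w))) A' i"
      using m3(3) \<open>A' < 16\<close> by (auto simp: rel_def)
  qed (use m3(3) in \<open>auto simp: rel_def\<close>)
  ultimately show ?case by blast
next
  case (4 c1 v a t1 v1 a1 c2 t2 v2 a2)
  from 4 obtain m1 where m1: "reach P (l, m) t1 (l + clen c1, m1)" "rel v1 a1 m1" by fastforce
  have "\<exists>m'. reach P (l + clen c1, m1) t2 (l + clen c1 + clen c2, m') \<and> rel v2 a2 m'"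
    using 4 m1 reach_good[OF m1(1)] big_bounded[OF 4(1)] by (intro 4) auto
  then show ?case using reach_trans[OF m1(1)] by (auto simp: add.assoc)
next
  case (5 e1 v a e2 c1 t v' a' c2)
  from ecomp2_correct[of P l e1 e2 v a m] 5 obtain m1 where
    m1: "reach P (l, m) (ecost e1 + ecost e2) (l + ecost e1 + ecost e2, m1)"
     "m1 64 = eval e1 v a" "m1 65 = eval e2 v a" "rel v a m1" by auto
  note g1 = reach_good[OF m1(1), simplified]
  let ?l = "l + ecost e1 + ecost e2 + 1 + clen c2 + 1"
  have r1: "reach P (l + ecost e1 + ecost e2, m1) 1 (?l, m1)"
    using jump_less_reach[of P "l + ecost e1 + ecost e2" ?l m1] 5 m1 g1 by (auto simp: add.assoc)
  have "\<exists>m'. reach P (?l, m1) t (?l + clen c1, m') \<and> rel v' a' m'"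
    using 5 m1 g1 by (intro 5) (auto simp: add.assoc)
  then obtain m' where m': "reach P (?l, m1) t (?l + clen c1, m')" "rel v' a' m'" by auto
  from reach_trans[OF reach_trans[OF m1(1) r1] m'(1)] m'(2)
  show ?case by (auto simp: add.assoc)
next
  case (6 e1 v a e2 c2 t v' a' c1)
  from ecomp2_correct[of P l e1 e2 v a m] 6 obtain m1 where
    m1: "reach P (l, m) (ecost e1 + ecost e2) (l + ecost e1 + ecost e2, m1)"
     "m1 64 = eval e1 v a" "m1 65 = eval e2 v a" "rel v a m1" by auto
  note g1 = reach_good[OF m1(1), simplified]
  let ?l = "l + ecost e1 + ecost e2 + 1"
  have r1: "reach P (l + ecost e1 + ecost e2, m1) 1 (?l, m1)"
    using jump_less_reach[of P "l + ecost e1 + ecost e2" "?l + clen c2 + 1" m1] 6 m1 g1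
    by (auto simp: add.assoc)
  have "\<exists>m'. reach P (?l, m1) t (?l + clen c2, m') \<and> rel v' a' m'"
    using 6 m1 g1 by (intro 6) (auto simp: add.assoc)
  then obtain m' where m': "reach P (?l, m1) t (?l + clen c2, m')" "rel v' a' m'" by auto
  have "reach P (?l + clen c2, m') 1 (?l + clen c2 + 1 + clen c1, m')"
    using 6 reach_good[OF m'(1)] by (intro jump_reach) (auto simp: add.assoc)
  from reach_trans[OF reach_trans[OF reach_trans[OF m1(1) r1] m'(1)] this] m'(2)
  show ?case by (auto simp: add.assoc)
next
  case (7 e1 v a e2 c)
  from ecomp2_correct[of P l e1 e2 v a m] 7 obtain m1 where
    m1: "reach P (l, m) (ecost e1 + ecost e2) (l + ecost e1 + ecost e2, m1)"
     "m1 64 = eval e1 v a" "m1 65 = eval e2 v a" "rel v a m1" by auto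
  note g1 = reach_good[OF m1(1), simplified]
  let ?l = "l + ecost e1 + ecost e2"
  have r1: "reach P (?l, m1) 1 (?l + 1, m1)"
    using jump_less_reach[of P ?l "?l + 2" m1] 7 m1 g1 by (auto simp: add.assoc)
  have "reach P (?l + 1, m1) 1 (?l + 2 + clen c + 1, m1)"
    using 7 g1 by (intro jump_reach) (auto simp: add.assoc)
  from reach_trans[OF reach_trans[OF m1(1) r1] this] m1(4)
  show ?case by (auto simp: add.assoc)
next
  case (8 e1 v a e2 c t v1 a1 t' v' a')
  from ecomp2_correct[of P l e1 e2 v a m] 8 obtain m1 where
    m1: "reach P (l, m) (ecost e1 + ecost e2) (l + ecost e1 + ecost e2, m1)"
     "m1 64 = eval e1 v a" "m1 65 = eval e2 v a" "rel v a m1" by auto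
  note g1 = reach_good[OF m1(1), simplified]
  let ?l = "l + ecost e1 + ecost e2"
  have r1: "reach P (?l, m1) 1 (?l + 2, m1)"
    using jump_less_reach[of P ?l "?l + 2" m1] 8 m1 g1 by (auto simp: add.assoc)
  have "\<exists>m'. reach P (?l + 2, m1) t (?l + 2 + clen c, m') \<and> rel v1 a1 m'"
    using 8 m1 g1 by (intro "8.IH"(1)) (auto simp: add.assoc)
  then obtain m2 where m2: "reach P (?l + 2, m1) t (?l + 2 + clen c, m2)" "rel v1 a1 m2" by auto
  have r3: "reach P (?l + 2 + clen c, m2) 1 (l, m2)"
    using 8 reach_good[OF m2(1)] by (intro jump_reach) (auto simp: add.assoc)
  have "\<exists>m'. reach P (l, m2) t' (l + clen (WHILE e1 < e2 DO c), m') \<and> rel v' a' m'"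
    using 8 m2 reach_good[OF m2(1)] big_bounded[OF 8(4)] by (intro "8.IH"(2)) auto
  then obtain m3 where m3: "reach P (l, m2) t' (l + clen (WHILE e1 < e2 DO c), m3)" "rel v' a' m3" by auto
  from reach_trans[OF reach_trans[OF reach_trans[OF reach_trans[OF m1(1) r1] m2(1)] r3] m3(1)] m3(2)
  show ?case by (auto simp: add.assoc)
qed

text \<open>The postcondition also receives the time elapsed so far, which started at \<open>n\<close>; this allows
  amortised bounds by potentials in loop invariants.\<close>

definition wp :: "com \<Rightarrow> ((nat \<Rightarrow> nat) \<Rightarrow> (nat \<Rightarrow> nat \<Rightarrow> nat) \<Rightarrow> nat \<Rightarrow> bool) \<Rightarrow>
    (nat \<Rightarrow> nat) \<Rightarrow> (nat \<Rightarrow> nat \<Rightarrow> nat) \<Rightarrow> nat \<Rightarrow> bool" where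
  "wp c Q v a n \<longleftrightarrow> (\<exists>t v' a'. big c v a t v' a' \<and> Q v' a' (n + t))"

lemma wp_Skip [simp]: "wp Skip Q v a n \<longleftrightarrow> Q v a n"
  by (auto simp: wp_def elim: big_SkipE intro: big.intros) (metis big.intros(1) add_0_right)

lemma wp_Assign [simp]:
  "wp (x ::= e) Q v a n \<longleftrightarrow>
    eok e v a \<and> eval e v a \<le> U \<and> Q (v(x := eval e v a)) a (n + ecost e + 2)"
  by (auto simp: wp_def add.assoc elim!: big_AssignE) (metis big.intros(2) add_Suc_right add_2_eq_Suc')

lemma wp_AStore [simp]:
  "wp (A\<langle>e1\<rangle> ::= e2) Q v a n \<longleftrightarrow>
    eok e1 v a \<and> eok e2 v a \<and> wok A (eval e1 v a) (eval e2 v a) \<and>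
    Q v (a(A := (a A)(eval e1 v a := eval e2 v a))) (n + ecost e1 + ecost e2 + 5)"
proof -
  have "n + (ecost e1 + 4 + ecost e2 + 1) = n + ecost e1 + ecost e2 + 5" by simp
  then show ?thesis unfolding wp_def by (metis big_AStoreE big.intros(3))
qed

lemma wp_Seq [simp]: "wp (c1 ;; c2) Q v a n \<longleftrightarrow> wp c1 (\<lambda>v a n. wp c2 Q v a n) v a n"
  unfolding wp_def by (metis (no_types, opaque_lifting) big_SeqE big.intros(4) add.assoc)

lemma wp_If [simp]:
  "wp (IF e1 < e2 THEN c1 ELSE c2) Q v a n \<longleftrightarrow> eok e1 v a \<and> eok e2 v a \<and>
    (if eval e1 v a < eval e2 v a then wp c1 Q v a (n + ecost e1 + ecost e2 + 1)
     else wp c2 (\<lambda>v a n. Q v a (Suc n)) v a (n + ecost e1 + ecost e2 + 1))" (is "?l \<longleftrightarrow> ?r")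
proof
  assume ?l
  then show ?r unfolding wp_def by (auto simp: add.assoc elim!: big_IfE) blast+
next
  assume r: ?r
  show ?l
  proof (cases "eval e1 v a < eval e2 v a")
    case True
    with r obtain t v' a' where "big c1 v a t v' a'" "Q v' a' (n + ecost e1 + ecost e2 + 1 + t)"
      unfolding wp_def by auto
    moreover from this r True have "big (IF e1 < e2 THEN c1 ELSE c2) v a (ecost e1 + ecost e2 + 1 + t) v' a'"
      by (intro big.intros) auto
    ultimately show ?thesis unfolding wp_def by (metis add.assoc)
  next
    case False
    with r obtain t v' a' where "big c2 v a t v' a'" "Q v' a' (Suc (n + ecost e1 + ecost e2 + 1 + t))"
      unfolding wp_def by auto
    moreover from this r False have "big (IF e1 < e2 THEN c1 ELSE c2) v a (ecost e1 + ecost e2 + 1 + t + 1) v' a'"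
      by (intro big.intros) auto
    ultimately show ?thesis unfolding wp_def by (metis add.assoc Suc_eq_plus1)
  qed
qed

section \<open>Frame and loop rules\<close>

lemma wp_mono:
  assumes "wp c Q v a n" "\<And>v' a' n'. Q v' a' n' \<Longrightarrow> Q' v' a' n'"
  shows "wp c Q' v a n"
  using assms unfolding wp_def by blast

fun mvars :: "com \<Rightarrow> nat set" where
  "mvars (x ::= e) = {x}"
| "mvars (c1 ;; c2) = mvars c1 \<union> mvars c2"
| "mvars (IF e1 < e2 THEN c1 ELSE c2) = mvars c1 \<union> mvars c2"
| "mvars (WHILE e1 < e2 DO c) = mvars c"
| "mvars _ = {}"

fun marrs :: "com \<Rightarrow> nat set" where
  "marrs (A\<langle>e1\<rangle> ::= e2) = {A}"
| "marrs (c1 ;; c2) = marrs c1 \<union> marrs c2"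
| "marrs (IF e1 < e2 THEN c1 ELSE c2) = marrs c1 \<union> marrs c2"
| "marrs (WHILE e1 < e2 DO c) = marrs c"
| "marrs _ = {}"

text \<open>What a command leaves unchanged is read off its syntax, so specifications and invariants
  need to speak only of what changes.\<close>

definition frame :: "com \<Rightarrow> (nat \<Rightarrow> nat) \<Rightarrow> (nat \<Rightarrow> nat \<Rightarrow> nat) \<Rightarrow> (nat \<Rightarrow> nat) \<Rightarrow> (nat \<Rightarrow> nat \<Rightarrow> nat) \<Rightarrow> bool"
  where "frame c v a v' a' \<longleftrightarrow> (\<forall>x. x \<notin> mvars c \<longrightarrow> v' x = v x) \<and> (\<forall>A. A \<notin> marrs c \<longrightarrow> a' A = a A)"

lemma big_frame: "big c v a t v' a' \<Longrightarrow> frame c v a v' a'"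
  by (induction rule: big.induct) (auto simp: frame_def)

lemma wp_frame:
  assumes "wp c Q v a n" "\<And>v' a' n'. frame c v a v' a' \<Longrightarrow> Q v' a' n' \<Longrightarrow> Q' v' a' n'"
  shows "wp c Q' v a n"
  using assms big_frame unfolding wp_def by blast

text \<open>Total correctness with the decreasing measure \<open>f\<close>. \<open>Suc n''\<close>
  pays for the jump back to the test, and the final \<open>+ 2\<close> for the failing comparison
  and the exit jump.\<close>

lemma wp_While:
  fixes f :: "(nat \<Rightarrow> nat) \<Rightarrow> (nat \<Rightarrow> nat \<Rightarrow> nat) \<Rightarrow> nat"
  assumes I: "I v a n"
    and ok: "\<And>v' a' n'. frame c v a v' a' \<Longrightarrow> I v' a' n' \<Longrightarrow> eok e1 v' a' \<and> eok e2 v' a'"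
    and body: "\<And>v' a' n'. frame c v a v' a' \<Longrightarrow> I v' a' n' \<Longrightarrow> eval e1 v' a' < eval e2 v' a' \<Longrightarrow>
      wp c (\<lambda>v'' a'' n''. I v'' a'' (Suc n'') \<and> f v'' a'' < f v' a') v' a' (n' + ecost e1 + ecost e2 + 1)"
    and post: "\<And>v' a' n'. frame c v a v' a' \<Longrightarrow> I v' a' n' \<Longrightarrow> \<not> eval e1 v' a' < eval e2 v' a' \<Longrightarrow>
      Q v' a' (n' + ecost e1 + ecost e2 + 2)"
  shows "wp (WHILE e1 < e2 DO c) Q v a n"
proof -
  have "frame c v a v' a' \<Longrightarrow> I v' a' n' \<Longrightarrow> wp (WHILE e1 < e2 DO c) Q v' a' n'" for v' a' n'
  proof (induction "f v' a'" arbitrary: v' a' n' rule: less_induct)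
    case less
    note ok' = ok[OF less.prems]
    show ?case
    proof (cases "eval e1 v' a' < eval e2 v' a'")
      case True
      from body[OF less.prems True] obtain t v1 a1 where
        1: "big c v' a' t v1 a1" "I v1 a1 (Suc (n' + ecost e1 + ecost e2 + 1 + t))" "f v1 a1 < f v' a'"
        unfolding wp_def by auto
      have "frame c v a v1 a1" using big_frame[OF 1(1)] less.prems(1) by (simp add: frame_def)
      from less.hyps[OF 1(3) this 1(2)] obtain t' v2 a2 where
        2: "big (WHILE e1 < e2 DO c) v1 a1 t' v2 a2" "Q v2 a2 (Suc (n' + ecost e1 + ecost e2 + 1 + t) + t')"
        unfolding wp_def by auto
      have "big (WHILE e1 < e2 DO c) v' a' (ecost e1 + ecost e2 + 1 + t + 1 + t') v2 a2"
        using big.intros(8)[OF _ _ True 1(1) 2(1)] ok' by blast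
      moreover have "Suc (n' + ecost e1 + ecost e2 + 1 + t) + t' = n' + (ecost e1 + ecost e2 + 1 + t + 1 + t')"
        by simp
      ultimately show ?thesis using 2(2) unfolding wp_def by metis
    next
      case False
      have "big (WHILE e1 < e2 DO c) v' a' (ecost e1 + ecost e2 + 2) v' a'"
        using big.intros(7)[OF _ _ False] ok' by blast
      then show ?thesis using post[OF less.prems False] unfolding wp_def by (metis add.assoc)
    qed
  qed
  then show ?thesis using I by (simp add: frame_def)
qed

end

text \<open>Compacts array 14 into consecutive cells from 80 on. Cell \<open>80 + i\<close> is overwritten only after all
  entries with index at most \<open>i\<close> have been read.\<close>

definition emit :: "nat \<Rightarrow> instr list" where
  "emit l = [Const 0 0, Const 2 16, Const 3 94, Const 4 80, Const 5 1,
     JumpLess 0 1 (l + 8), Const 0 80, Jump (l + 15),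
     Arith Times 6 0 2, Arith Plus 6 6 3, Load 6 6, Arith Plus 7 0 4, Store 7 6,
     Arith Plus 0 0 5, Jump (l + 5)]"

context ram
begin

text \<open>Entry \<open>k\<close> of array 14 lies in cell \<open>80 + 16 * k + 14\<close>, hence
  the 94. Each copied entry takes eight instructions; the last three are the failing test, the start
  address 80 and the exit.\<close>

lemma emit_loop:
  assumes code: "code_at P l (emit l)" and n: "n \<le> Lw"
  shows "good m \<Longrightarrow> m 0 = i \<Longrightarrow> i \<le> n \<Longrightarrow> m 1 = n \<Longrightarrow> m 2 = 16 \<Longrightarrow> m 3 = 94 \<Longrightarrow> m 4 = 80 \<Longrightarrow> m 5 = 1 \<Longrightarrow>
    (\<forall>k<i. m (80 + k) = h k) \<Longrightarrow> (\<forall>k. i \<le> k \<and> k < n \<longrightarrow> m (94 + 16 * k) = h k) \<Longrightarrow>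
    \<exists>m'. reach P (l + 5, m) (8 * (n - i) + 3) (l + 15, m') \<and> m' 0 = 80 \<and> m' 1 = n \<and>
      (\<forall>k<n. m' (80 + k) = h k)"
proof (induction "n - i" arbitrary: i m)
  case 0
  note e = code_at_nth[OF code]
  let ?m = "m(0 := 80)"
  have cb: "80 \<le> wmax" using U_addr by (intro const_le_pow) auto
  have g: "good ?m" using 0 cb by (auto intro!: good_upd simp: cbound_small)
  have "reach P (l + 5, m) 1 (l + 6, m)"
    by (rule reach_instr) (use 0 e[of 5] in \<open>auto simp: emit_def\<close>)
  moreover have "reach P (l + 6, m) 1 (l + 7, ?m)"
    by (rule reach_instr) (use 0 e[of 6] g in \<open>auto simp: emit_def\<close>)
  moreover have "reach P (l + 7, ?m) 1 (l + 15, ?m)"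
    by (rule reach_instr) (use 0 e[of 7] g in \<open>auto simp: emit_def\<close>)
  ultimately have "reach P (l + 5, m) (1 + 1 + 1) (l + 15, ?m)"
    using reach_trans by blast
  then have "reach P (l + 5, m) (8 * (n - i) + 3) (l + 15, ?m)"
    using 0 by (simp add: numeral_3_eq_3)
  moreover have "?m 0 = 80" "?m 1 = n" "\<forall>k<n. ?m (80 + k) = h k"
    using 0 by auto
  ultimately show ?case by blast
next
  case (Suc d)
  note e = code_at_nth[OF code]
  from Suc have i: "i < n" by simp
  have iL: "i < L" "i < Lw" using i n Lw_le by auto
  have cb: "80 \<le> wmax" using U_addr by (intro const_le_pow) auto
  have c6: "16 * i + 94 \<le> wmax" "80 + i \<le> wmax" "Suc i \<le> wmax"
    using U_addr iL by (auto intro!: const_le_pow)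
  have hi: "h i = m (94 + 16 * i)" using Suc i by auto
  then have hiw: "h i \<le> wmax"
    using \<open>good m\<close> iL by (auto simp: good_def cbound_def dest!: spec[of _ "94 + 16 * i"])
  let ?m1 = "m(6 := i * 16)"
  let ?m2 = "?m1(6 := i * 16 + 94)"
  let ?m3 = "?m2(6 := h i)"
  let ?m4 = "?m3(7 := i + 80)"
  let ?m5 = "?m4(80 + i := h i)"
  let ?m6 = "?m5(0 := i + 1)"
  have g1: "good ?m1" using Suc c6 by (intro good_upd) (auto simp: cbound_small)
  have g2: "good ?m2" by (rule good_upd[OF g1]) (use c6 in \<open>auto simp: cbound_small\<close>)
  have g3: "good ?m3" by (rule good_upd[OF g2]) (use hiw in \<open>auto simp: cbound_small\<close>)
  have g4: "good ?m4" by (rule good_upd[OF g3]) (use c6 in \<open>auto simp: cbound_small\<close>)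
  have g5: "good ?m5" by (rule good_upd[OF g4]) (use hiw iL in \<open>auto simp: cbound_def\<close>)
  have g6: "good ?m6" by (rule good_upd[OF g5]) (use c6 in \<open>auto simp: cbound_small\<close>)
  have s1: "reach P (l + 5, m) 1 (l + 8, m)"
    by (rule reach_instr) (use Suc.prems(1-8) e[of 5] i in \<open>auto simp: emit_def\<close>)
  have s2: "reach P (l + 8, m) 1 (l + 9, ?m1)"
    by (rule reach_instr) (use Suc.prems(1-8) e[of 8] g1 in \<open>auto simp: emit_def\<close>)
  have s3: "reach P (l + 9, ?m1) 1 (l + 10, ?m2)"
    by (rule reach_instr) (use Suc.prems(1-8) e[of 9] g1 g2 in \<open>auto simp: emit_def\<close>)
  have s4: "reach P (l + 10, ?m2) 1 (l + 11, ?m3)"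
    by (rule reach_instr) (use Suc.prems(1-8) e[of 10] g2 g3 hi iL in \<open>auto simp: emit_def add.commute mult.commute\<close>)
  have s5: "reach P (l + 11, ?m3) 1 (l + 12, ?m4)"
    by (rule reach_instr) (use Suc.prems(1-8) e[of 11] g3 g4 in \<open>auto simp: emit_def\<close>)
  have s6: "reach P (l + 12, ?m4) 1 (l + 13, ?m5)"
    by (rule reach_instr) (use Suc.prems(1-8) e[of 12] g4 g5 iL in \<open>auto simp: emit_def add.commute\<close>)
  have s7: "reach P (l + 13, ?m5) 1 (l + 14, ?m6)"
    by (rule reach_instr) (use Suc.prems(1-8) e[of 13] g5 g6 in \<open>auto simp: emit_def\<close>)
  have s8: "reach P (l + 14, ?m6) 1 (l + 5, ?m6)"
    by (rule reach_instr) (use Suc.prems(1-8) e[of 14] g6 in \<open>auto simp: emit_def\<close>)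
  note s = reach_trans[OF reach_trans[OF reach_trans[OF reach_trans[OF reach_trans[OF reach_trans[OF
    reach_trans[OF s1 s2] s3] s4] s5] s6] s7] s8]
  have "1+1+1+1+1+1+1+1 = (8::nat)" by simp
  with s have r8: "reach P (l + 5, m) 8 (l + 5, ?m6)" by metis
  have "\<exists>m'. reach P (l + 5, ?m6) (8 * (n - Suc i) + 3) (l + 15, m') \<and> m' 0 = 80 \<and> m' 1 = n \<and>
      (\<forall>k<n. m' (80 + k) = h k)"
  proof (rule Suc.hyps(1)[of "Suc i" ?m6])
    show "\<forall>k<Suc i. ?m6 (80 + k) = h k" using Suc.prems(9) by (auto simp: less_Suc_eq)
    show "\<forall>k. Suc i \<le> k \<and> k < n \<longrightarrow> ?m6 (94 + 16 * k) = h k" using Suc.prems(10) by auto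
  qed (use Suc.hyps(2) Suc.prems g6 i in auto)
  then obtain m' where m': "reach P (l + 5, ?m6) (8 * (n - Suc i) + 3) (l + 15, m')" "m' 0 = 80" "m' 1 = n"
      "\<forall>k<n. m' (80 + k) = h k" by blast
  have "8 + (8 * (n - Suc i) + 3) = 8 * (n - i) + 3" using i by simp
  with reach_trans[OF r8 m'(1)] m' show ?case by metis
qed

lemma emit_correct:
  assumes code: "code_at P l (emit l)" and n: "n \<le> Lw" and m: "good m" "rel v a m" "v 1 = n"
  shows "\<exists>m'. reach P (l, m) (8 * n + 8) (l + 15, m') \<and> m' 0 = 80 \<and> m' 1 = n \<and>
      (\<forall>k<n. m' (80 + k) = a 14 k)"
proof -
  note e = code_at_nth[OF code]
  have cb: "94 \<le> wmax" using U_addr by (intro const_le_pow) auto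
  let ?m1 = "m(0 := 0)"
  let ?m2 = "?m1(2 := 16)"
  let ?m3 = "?m2(3 := 94)"
  let ?m4 = "?m3(4 := 80)"
  let ?m5 = "?m4(5 := 1)"
  have g1: "good ?m1" using m cb by (intro good_upd) (auto simp: cbound_small)
  have g2: "good ?m2" by (rule good_upd[OF g1]) (use cb in \<open>auto simp: cbound_small\<close>)
  have g3: "good ?m3" by (rule good_upd[OF g2]) (use cb in \<open>auto simp: cbound_small\<close>)
  have g4: "good ?m4" by (rule good_upd[OF g3]) (use cb in \<open>auto simp: cbound_small\<close>)
  have g5: "good ?m5" by (rule good_upd[OF g4]) (use cb in \<open>auto simp: cbound_small\<close>)
  have "reach P (l, m) 1 (l + 1, ?m1)"
    by (rule reach_instr) (use m e[of 0] g1 in \<open>auto simp: emit_def\<close>)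
  moreover have "reach P (l + 1, ?m1) 1 (l + 2, ?m2)"
    by (rule reach_instr) (use e[of 1] g1 g2 in \<open>auto simp: emit_def\<close>)
  moreover have "reach P (l + 2, ?m2) 1 (l + 3, ?m3)"
    by (rule reach_instr) (use e[of 2] g2 g3 in \<open>auto simp: emit_def\<close>)
  moreover have "reach P (l + 3, ?m3) 1 (l + 4, ?m4)"
    by (rule reach_instr) (use e[of 3] g3 g4 in \<open>auto simp: emit_def\<close>)
  moreover have "reach P (l + 4, ?m4) 1 (l + 5, ?m5)"
    by (rule reach_instr) (use e[of 4] g4 g5 in \<open>auto simp: emit_def\<close>)
  ultimately have "reach P (l, m) (1+1+1+1+1) (l + 5, ?m5)"
    using reach_trans by blast
  moreover have "1+1+1+1+1 = (5::nat)" by simp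
  ultimately have r5: "reach P (l, m) 5 (l + 5, ?m5)" by metis
  have h: "m (94 + 16 * k) = a 14 k" for k
  proof -
    have "14 < (16::nat) \<longrightarrow> m (80 + 16 * k + 14) = a 14 k" using m(2) unfolding rel_def by blast
    moreover have "80 + 16 * k + 14 = 94 + 16 * k" by simp
    ultimately show ?thesis by simp
  qed
  have "m 1 = n" using m unfolding rel_def by auto
  then have "\<exists>m'. reach P (l + 5, ?m5) (8 * (n - 0) + 3) (l + 15, m') \<and> m' 0 = 80 \<and> m' 1 = n \<and>
      (\<forall>k<n. m' (80 + k) = a 14 k)"
    using g5 h by (intro emit_loop[OF code n]) auto
  then obtain m' where m': "reach P (l + 5, ?m5) (8 * (n - 0) + 3) (l + 15, m')" "m' 0 = 80" "m' 1 = n"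
      "\<forall>k<n. m' (80 + k) = a 14 k" by blast
  have "5 + (8 * (n - 0) + 3) = 8 * n + 8" by simp
  with reach_trans[OF r5 m'(1)] m' show ?thesis by metis
qed

text \<open>Transfers a \<open>wp\<close> statement about the structured program to the measures of
  the machine. The extra \<open>8 * Lw + 8\<close> steps compact the output array.\<close>

theorem program_spec:
  assumes wp: "wp c (\<lambda>v a n. v 1 \<le> Lw \<and> n \<le> t \<and> (\<forall>k. h k = (if k < v 1 then a 14 k else 0)))
      ((\<lambda>_. 0)(0 := x)) (\<lambda>_ _. 0) 0"
    and wf: "wf c" "\<forall>k\<in>lits c. k \<le> U" and x: "x \<le> U"
  defines "P \<equiv> comp 0 c @ emit (clen c)"
  shows "terminates P x" "outputs (final_mem P x) h" "run_time P x \<le> t + 8 * Lw + 8"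
    "word_bits P x \<le> floorlog 2 wmax"
    "space_bits P x \<le> (80 + 16 * Lw) * floorlog 2 wmax + (80 + 16 * L)"
proof -
  let ?m0 = "(\<lambda>_. 0)(0 := x) :: mem"
  from wp obtain t1 v a where
    1: "big c ?m0 (\<lambda>_ _. 0) t1 v a" "v 1 \<le> Lw" "t1 \<le> t" "\<forall>k. h k = (if k < v 1 then a 14 k else 0)"
    unfolding wp_def by auto
  have g0: "good ?m0" using x by (intro good_upd) (auto simp: good_def cbound_small const_le_pow)
  have "code_at P 0 (comp 0 c)" "code_at P (clen c) (emit (clen c))"
    using code_at_self[of "[]" P] by (simp_all add: P_def)
  moreover have "rel ?m0 (\<lambda>_ _. 0) ?m0" "bounded ?m0 (\<lambda>_ _. 0)" using x by (auto simp: rel_def bounded_def)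
  ultimately obtain m1 where m1: "reach P (0, ?m0) t1 (0 + clen c, m1)" "rel v a m1"
    using comp_correct[OF 1(1), of P 0 ?m0] g0 wf by blast
  from emit_correct[OF \<open>code_at P (clen c) _\<close> 1(2), of m1 v a] reach_good[OF m1(1)] m1(2) obtain m2 where
    m2: "reach P (clen c, m1) (8 * v 1 + 8) (clen c + 15, m2)" "m2 0 = 80" "m2 1 = v 1"
      "\<forall>k<v 1. m2 (80 + k) = a 14 k" by auto
  define T where "T = t1 + (8 * v 1 + 8)"
  have r: "reach P (0, ?m0) T (clen c + 15, m2)" using reach_trans[OF m1(1)] m2(1) by (simp add: T_def)
  have "length P = clen c + 15" by (simp add: P_def emit_def)
  then have hT: "halted P (run P x T)" using reach_funpow(1)[OF r] by (simp add: run_def halted_def)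
  then show "terminates P x" unfolding terminates_def by blast
  have rt: "run_time P x = T" unfolding run_time_def
    by (rule Least_equality) (use hT reach_funpow(2)[OF r] in \<open>auto simp: run_def not_le[symmetric]\<close>)
  then show "run_time P x \<le> t + 8 * Lw + 8" using 1(2,3) by (simp add: T_def)
  have "final_mem P x = m2" using reach_funpow(1)[OF r] rt by (simp add: final_mem_def run_def)
  then show "outputs (final_mem P x) h" using m2 1(4) by (simp add: outputs_def)
  have nc: "num_cells P x \<le> 80 + 16 * L"
  proof -
    have "accessed (P ! fst (run P x t)) (snd (run P x t)) \<subseteq> {..<80 + 16 * L}" if "t < T" for t
      using reach_funpow(3)[OF r that] by (simp add: run_def)
    then have sub: "insert 0 (\<Union>t<T. accessed (P ! fst (run P x t)) (snd (run P x t))) \<subseteq> {..<80 + 16 * L}"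
      by auto
    have "finite (insert 0 (\<Union>t<T. accessed (P ! fst (run P x t)) (snd (run P x t))))"
      by (rule finite_subset[OF sub]) simp
    then have "Max (insert 0 (\<Union>t<T. accessed (P ! fst (run P x t)) (snd (run P x t)))) \<in> {..<80 + 16 * L}"
      by (intro subsetD[OF sub] Max_in) auto
    then show ?thesis unfolding num_cells_def rt by auto
  qed
  have cb: "cell_bits P x b \<le> floorlog 2 (cbound b)" for b
    unfolding cell_bits_def
  proof (rule Max.boundedI)
    fix y assume "y \<in> (\<lambda>t. max 1 (floorlog 2 (snd (run P x t) b))) ` {..run_time P x}"
    then obtain t where t: "t \<le> T" "y = max 1 (floorlog 2 (snd (run P x t) b))" using rt by auto
    have "snd (run P x t) b \<le> cbound b" using reach_funpow(4)[OF r t(1)] by (simp add: run_def good_def)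
    moreover have "1 \<le> floorlog 2 (cbound b)"
      using floorlog_mono[of 1 "cbound b" 2] one_le_wmax by (simp add: cbound_def floorlog_def)
    ultimately show "y \<le> floorlog 2 (cbound b)" using t floorlog_mono by auto
  qed auto
  have fl1: "floorlog 2 1 = 1" by (simp add: floorlog_def)
  show "word_bits P x \<le> floorlog 2 wmax"
    unfolding word_bits_def
  proof (rule Max.boundedI)
    fix y assume "y \<in> cell_bits P x ` {..<num_cells P x}"
    then obtain b where "y = cell_bits P x b" by auto
    with cb[of b] floorlog_mono[OF one_le_wmax, of 2] show "y \<le> floorlog 2 wmax"
      by (auto simp: cbound_def split: if_splits)
  qed (auto simp: num_cells_def lessThan_empty_iff)
  have "space_bits P x \<le> (\<Sum>b<80 + 16 * L. floorlog 2 (cbound b))"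
    unfolding space_bits_def using nc by (intro order_trans[OF sum_mono2 sum_mono]) (auto intro: cb)
  \<comment> \<open>One bit is counted for every cell, and a full word in addition only for cells
    below index \<open>Lw\<close>.\<close>
  also have "\<dots> \<le> (\<Sum>b<80 + 16 * L. (if b < 80 + 16 * Lw then floorlog 2 wmax else 0) + 1)"
    by (intro sum_mono) (auto simp: cbound_def fl1[unfolded One_nat_def])
  also have "\<dots> = (\<Sum>b<80 + 16 * L. if b < 80 + 16 * Lw then floorlog 2 wmax else 0) + (80 + 16 * L)"
    by (subst sum.distrib) simp
  also have "(\<Sum>b<80 + 16 * L. if b < 80 + 16 * Lw then floorlog 2 wmax else 0) =
      (\<Sum>b<80 + 16 * Lw. floorlog 2 wmax)"
    using Lw_le by (intro sum.mono_neutral_cong_right) auto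
  finally show "space_bits P x \<le> (80 + 16 * Lw) * floorlog 2 wmax + (80 + 16 * L)" by simp
qed

end

section \<open>Chebyshev-type estimates\<close>

definition prime_pi :: "nat \<Rightarrow> nat" where
  "prime_pi n = card {p. prime p \<and> p \<le> n}"

lemma finite_primes_le [simp]: "finite {p::nat. prime p \<and> p \<le> n}"
  by (rule finite_subset[of _ "{..n}"]) auto

lemma prime_pi_mono: "m \<le> n \<Longrightarrow> prime_pi m \<le> prime_pi n"
  unfolding prime_pi_def by (intro card_mono) auto

lemma prime_pi_0 [simp]: "n \<le> 1 \<Longrightarrow> prime_pi n = 0"
  by (auto simp: prime_pi_def prime_nat_iff)

section \<open>Upper bounds of Chebyshev and Mertens type\<close>

lemma prod_primes_dvd:
  fixes A :: "nat set"
  assumes "finite A" "\<And>p. p \<in> A \<Longrightarrow> prime p \<and> p dvd n"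
  shows "\<Prod>A dvd n"
  using assms
proof (induction A rule: finite_induct)
  case (insert p A)
  have "coprime p (\<Prod>A)"
    using insert by (intro prod_coprime_right) (auto intro!: primes_coprime)
  then show ?case using insert by (auto intro: divides_mult)
qed simp

text \<open>Every prime in this range divides the central binomial coefficient, since it divides
  \<open>fact (2 * n)\<close> but not \<open>fact n\<close>; their product is thus at most
  \<open>4 ^ n\<close>.\<close>

lemma card_primes_between_power:
  "n ^ card {p. prime p \<and> n < p \<and> p \<le> 2 * n} \<le> 4 ^ n"
proof -
  let ?A = "{p. prime p \<and> n < p \<and> p \<le> 2 * n}"
  have fin: "finite ?A" by (rule finite_subset[of _ "{..2*n}"]) auto
  have "p dvd (2 * n choose n)" if p: "prime p" "n < p" "p \<le> 2 * n" for p
  proof -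
    have "fact (2 * n) = (fact n * fact n * (2 * n choose n) :: nat)"
      using binomial_fact_lemma[of n "2 * n"] by (simp add: mult_2)
    moreover have "p dvd fact (2 * n)" "\<not> p dvd fact n"
      using p by (auto simp: prime_dvd_fact_iff)
    ultimately show ?thesis using p by (metis prime_dvd_mult_iff)
  qed
  then have "\<Prod>?A dvd (2 * n choose n)" using fin by (intro prod_primes_dvd) auto
  then have "\<Prod>?A \<le> (2 * n choose n)" by (intro dvd_imp_le) auto
  moreover have "n ^ card ?A \<le> \<Prod>?A"
    using prod_mono[of ?A "\<lambda>_. n" "\<lambda>p. p"] by simp
  moreover have "(2 * n choose n) \<le> 2 ^ (2 * n)" by (rule binomial_le_pow2)
  ultimately show ?thesis by (simp add: power_mult)
qed

lemma card_primes_dyadic: "i * card {p::nat. prime p \<and> 2 ^ i < p \<and> p \<le> 2 ^ Suc i} \<le> 2 ^ Suc i"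
proof -
  let ?c = "card {p::nat. prime p \<and> 2 ^ i < p \<and> p \<le> 2 ^ Suc i}"
  have "(2::nat) ^ (i * ?c) \<le> 2 ^ (2 ^ Suc i)"
    using card_primes_between_power[of "2 ^ i"] by (simp add: power_mult)
  then show ?thesis by (rule power_le_imp_le_exp[rotated]) simp
qed

lemma prime_pi_dyadic:
  "prime_pi (2 ^ Suc i) = prime_pi (2 ^ i) + card {p::nat. prime p \<and> 2 ^ i < p \<and> p \<le> 2 ^ Suc i}"
proof -
  have "{p::nat. prime p \<and> p \<le> 2 ^ Suc i} =
      {p. prime p \<and> p \<le> 2 ^ i} \<union> {p. prime p \<and> 2 ^ i < p \<and> p \<le> 2 ^ Suc i}" by auto
  moreover have "finite {p::nat. prime p \<and> 2 ^ i < p \<and> p \<le> 2 ^ Suc i}"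
    by (rule finite_subset[of _ "{..2 ^ Suc i}"]) auto
  ultimately show ?thesis unfolding prime_pi_def
    by (simp only:) (subst card_Un_disjoint, auto)
qed

text \<open>The constant 6 is reproduced by the induction: 6 from the hypothesis and 2 from the
  dyadic block give 8, and (j + 1) / j is at most 3 / 2 for \<open>2 \<le> j\<close>, giving 12 = 6
  * 2.\<close>

lemma prime_pi_power2_le: "j * prime_pi (2 ^ j) \<le> 6 * 2 ^ j"
proof (cases "j \<le> 2")
  case True
  have "prime_pi (2 ^ j) \<le> card {1::nat..2 ^ j}"
    unfolding prime_pi_def by (intro card_mono) (auto simp: prime_nat_iff)
  then have "j * prime_pi (2 ^ j) \<le> 2 * 2 ^ j" using True by (intro mult_mono) auto
  then show ?thesis by simp
next
  case False
  then have "2 \<le> j" by simp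
  then show ?thesis
  proof (induction j rule: dec_induct)
    case base
    have "prime_pi 4 \<le> card {1::nat..4}"
      unfolding prime_pi_def by (intro card_mono) (auto simp: prime_nat_iff)
    then show ?case by simp
  next
    case (step j)
    let ?c = "card {p::nat. prime p \<and> 2 ^ j < p \<and> p \<le> 2 ^ Suc j}"
    have "j * (prime_pi (2 ^ j) + ?c) \<le> 8 * 2 ^ j"
      using step.IH card_primes_dyadic[of j] by (simp add: distrib_left)
    moreover have "(2 * Suc j) * (prime_pi (2 ^ j) + ?c) \<le> (3 * j) * (prime_pi (2 ^ j) + ?c)"
      using step.hyps by (intro mult_le_mono1) auto
    ultimately have "2 * (Suc j * (prime_pi (2 ^ j) + ?c)) \<le> 24 * 2 ^ j"
      unfolding mult.assoc by linarith
    then show ?case unfolding prime_pi_dyadic by simp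
  qed
qed

text \<open>The dyadic block above \<open>2 ^ i\<close> has at most \<open>2 ^ Suc i / i\<close>
  primes with reciprocals at most \<open>1 / 2 ^ i\<close>, so it contributes at most 2 / i. The
  bound is thus of order log log of the largest prime.\<close>

lemma sum_inverse_primes_le:
  "(\<Sum>p | prime p \<and> p \<le> 2 ^ Suc j. 1 / real p) \<le> 1 + 2 * harm j"
proof (induction j)
  case 0
  have "{p::nat. prime p \<and> p \<le> 2} = {2}" by (auto dest: prime_ge_2_nat)
  then show ?case by (simp add: harm_def)
next
  case (Suc j)
  let ?A = "{p::nat. prime p \<and> 2 ^ Suc j < p \<and> p \<le> 2 ^ Suc (Suc j)}"
  have fin: "finite ?A" by (rule finite_subset[of _ "{..2 ^ Suc (Suc j)}"]) auto
  have "{p::nat. prime p \<and> p \<le> 2 ^ Suc (Suc j)} = {p. prime p \<and> p \<le> 2 ^ Suc j} \<union> ?A"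
    by auto
  then have "(\<Sum>p | prime p \<and> p \<le> 2 ^ Suc (Suc j). 1 / real p) =
      (\<Sum>p | prime p \<and> p \<le> 2 ^ Suc j. 1 / real p) + (\<Sum>p\<in>?A. 1 / real p)"
    using fin by (subst sum.union_disjoint[symmetric]) auto
  also have "(\<Sum>p\<in>?A. 1 / real p) \<le> (\<Sum>p\<in>?A. 1 / 2 ^ Suc j)"
  proof (intro sum_mono)
    fix p assume "p \<in> ?A"
    then have "real (2 ^ Suc j) \<le> real p" by (intro of_nat_mono) auto
    moreover have "real p > 0" using \<open>p \<in> ?A\<close> by (auto simp: prime_gt_0_nat)
    ultimately show "1 / real p \<le> 1 / 2 ^ Suc j" by (intro divide_left_mono) auto
  qed
  also have "\<dots> = real (card ?A) / 2 ^ Suc j" by simp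
  also have "\<dots> \<le> 2 / real (Suc j)"
  proof -
    have "real (Suc j * card ?A) \<le> real (2 ^ Suc (Suc j))"
      using card_primes_dyadic[of "Suc j"] by (intro of_nat_mono)
    then have "real (Suc j) * real (card ?A) \<le> 2 * 2 ^ Suc j"
      by (simp only: of_nat_mult of_nat_power power_Suc of_nat_numeral)
    then show ?thesis by (simp add: pos_divide_le_eq pos_le_divide_eq mult.commute del: of_nat_Suc)
  qed
  also have "(\<Sum>p | prime p \<and> p \<le> 2 ^ Suc j. 1 / real p) + 2 / real (Suc j) \<le> 1 + 2 * harm (Suc j)"
    using Suc.IH unfolding harm_Suc by (simp add: inverse_eq_divide del: of_nat_Suc)
  finally show ?case by simp
qed

section \<open>Chebyshev's lower bound\<close>

lemma multiplicity_eq_card: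
  fixes p x :: nat
  assumes "prime p" "x > 0" "x \<le> m"
  shows "multiplicity p x = card {i\<in>{1..m}. p ^ i dvd x}"
proof -
  have iff: "p ^ i dvd x \<longleftrightarrow> i \<le> multiplicity p x" for i
    using assms by (intro power_dvd_iff_le_multiplicity) (auto simp: prime_nat_iff)
  have "multiplicity p x < 2 ^ multiplicity p x" by simp
  also have "\<dots> \<le> p ^ multiplicity p x" using assms by (intro power_mono) (auto simp: prime_ge_2_nat)
  also have "\<dots> \<le> x" using assms by (intro dvd_imp_le multiplicity_dvd) auto
  finally have "{i\<in>{1..m}. p ^ i dvd x} = {1..multiplicity p x}" using assms by (auto simp: iff)
  then show ?thesis by simp
qed

text \<open>Legendre's formula, cut off at an arbitrary \<open>m \<ge> n\<close> so that the same
  range serves \<open>n\<close> and \<open>2 * n\<close>.\<close>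

lemma multiplicity_fact:
  fixes p :: nat
  assumes "prime p" "n \<le> m"
  shows "multiplicity p (fact n :: nat) = (\<Sum>i\<in>{1..m}. n div p ^ i)"
  using assms(2)
proof (induction n)
  case 0
  then show ?case by simp
next
  case (Suc n)
  have "multiplicity p (fact (Suc n) :: nat) = multiplicity p (Suc n) + multiplicity p (fact n :: nat)"
    unfolding fact_Suc of_nat_id using assms(1)
    by (intro prime_elem_multiplicity_mult_distrib) auto
  also have "multiplicity p (Suc n) = (\<Sum>i\<in>{1..m}. if p ^ i dvd Suc n then 1 else 0)"
    using Suc.prems assms(1) multiplicity_eq_card[of p "Suc n" m] by (simp add: sum.If_cases Int_def)
  also have "multiplicity p (fact n :: nat) = (\<Sum>i\<in>{1..m}. n div p ^ i)"
    using Suc by simp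
  also have "(\<Sum>i\<in>{1..m}. if p ^ i dvd Suc n then 1 else 0) + (\<Sum>i\<in>{1..m}. n div p ^ i) =
    (\<Sum>i\<in>{1..m}. Suc n div p ^ i)"
    unfolding sum.distrib[symmetric]
    by (intro sum.cong refl) (auto simp: div_Suc dvd_eq_mod_eq_0)
  finally show ?case .
qed

text \<open>By Legendre's formula the multiplicity is a sum of differences
  \<open>2 * n div p ^ i - 2 * (n div p ^ i)\<close>. Each is 0 or 1, and 0 as soon as
  \<open>p ^ i\<close> exceeds \<open>2 * n\<close>.\<close>

lemma prime_power_multiplicity_binomial_le:
  fixes p :: nat
  assumes "prime p" "n > 0"
  shows "p ^ multiplicity p (2 * n choose n) \<le> 2 * n"
proof -
  let ?v = "multiplicity p (2 * n choose n)"
  have "fact (2 * n) = (fact n * fact n * (2 * n choose n) :: nat)"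
    using binomial_fact_lemma[of n "2 * n"] by (simp add: mult_2)
  then have "multiplicity p (fact (2 * n) :: nat) = multiplicity p (fact n :: nat) + multiplicity p (fact n :: nat) + ?v"
    using assms(1) by (auto simp: prime_elem_multiplicity_mult_distrib)
  then have eq: "(\<Sum>i\<in>{1..2*n}. 2 * n div p ^ i) = (\<Sum>i\<in>{1..2*n}. 2 * (n div p ^ i)) + ?v"
    using assms(1) by (simp add: multiplicity_fact[where m = "2 * n"] sum_distrib_left[symmetric])
  have "(\<Sum>i\<in>{1..2*n}. 2 * n div p ^ i) \<le> (\<Sum>i\<in>{1..2*n}. 2 * (n div p ^ i) + (if p ^ i \<le> 2 * n then 1 else 0))"
  proof (intro sum_mono)
    fix i
    have pos: "p ^ i > 0" using assms(1) by (simp add: prime_gt_0_nat)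
    have "2 * n < p ^ i * (2 * (n div p ^ i) + 2)"
    proof -
      have "n = p ^ i * (n div p ^ i) + n mod p ^ i" "n mod p ^ i < p ^ i" using pos by auto
      then have "2 * n < 2 * (p ^ i * (n div p ^ i)) + 2 * p ^ i" by linarith
      then show ?thesis by (simp add: algebra_simps)
    qed
    then have "2 * n div p ^ i < 2 * (n div p ^ i) + 2"
      using pos by (simp add: less_mult_imp_div_less mult.commute)
    then show "2 * n div p ^ i \<le> 2 * (n div p ^ i) + (if p ^ i \<le> 2 * n then 1 else 0)"
      by (auto simp: not_le)
  qed
  also have "\<dots> = (\<Sum>i\<in>{1..2*n}. 2 * (n div p ^ i)) + card {i\<in>{1..2*n}. p ^ i \<le> 2 * n}"
    by (simp add: sum.distrib sum.If_cases Int_def)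
  finally have v: "?v \<le> card {i\<in>{1..2*n}. p ^ i \<le> 2 * n}" using eq by simp
  show ?thesis
  proof (rule ccontr)
    assume "\<not> ?thesis"
    then have big: "p ^ ?v > 2 * n" by simp
    then have "?v > 0" using assms by (cases ?v) auto
    have "{i\<in>{1..2*n}. p ^ i \<le> 2 * n} \<subseteq> {1..<?v}"
    proof
      fix i assume i: "i \<in> {i\<in>{1..2*n}. p ^ i \<le> 2 * n}"
      have "i < ?v"
      proof (rule ccontr)
        assume "\<not> i < ?v"
        then have "p ^ ?v \<le> p ^ i" using assms(1) by (intro power_increasing) (auto dest: prime_ge_1_nat)
        then show False using i big by auto
      qed
      then show "i \<in> {1..<?v}" using i by auto
    qed
    then have "card {i\<in>{1..2*n}. p ^ i \<le> 2 * n} \<le> card {1..<?v}" by (intro card_mono) auto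
    then show False using v \<open>?v > 0\<close> by simp
  qed
qed

text \<open>The coefficient is a product of at most \<open>prime_pi (2 * n)\<close> prime powers,
  none of which exceeds \<open>2 * n\<close>.\<close>

lemma binomial_le_power_prime_pi: "n > 0 \<Longrightarrow> (2 * n choose n) \<le> (2 * n) ^ prime_pi (2 * n)"
proof -
  assume n: "n > 0"
  let ?B = "2 * n choose n"
  have B: "?B > 0" by simp
  have sub: "prime_factors ?B \<subseteq> {p. prime p \<and> p \<le> 2 * n}"
  proof
    fix p assume p: "p \<in> prime_factors ?B"
    then have "prime p" "p dvd ?B" by auto
    moreover have "?B dvd fact (2 * n)"
      using binomial_fact_lemma[of n "2 * n"] by (metis dvd_triv_right le_add2 mult_2)
    ultimately show "p \<in> {p. prime p \<and> p \<le> 2 * n}"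
      using prime_dvd_fact_iff[of p "2 * n"] by (auto intro: dvd_trans)
  qed
  have "?B = (\<Prod>p\<in>prime_factors ?B. p ^ multiplicity p ?B)" using B by (rule prime_factorization_nat)
  also have "\<dots> \<le> (\<Prod>p\<in>prime_factors ?B. 2 * n)"
    using n by (intro prod_mono) (auto intro: prime_power_multiplicity_binomial_le)
  also have "\<dots> = (2 * n) ^ card (prime_factors ?B)" by simp
  also have "\<dots> \<le> (2 * n) ^ prime_pi (2 * n)"
    unfolding prime_pi_def using n sub by (intro power_increasing card_mono) auto
  finally show ?thesis .
qed

text \<open>Compares the two bounds \<open>4 ^ n / (2 * n)\<close> and
  \<open>(2 * n) ^ prime_pi (2 * n)\<close> for the central binomial coefficient at
  \<open>2 * n = 2 ^ j\<close>; the \<open>+ 1\<close> absorbs the denominator.\<close>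

lemma prime_pi_power2_ge: "2 ^ j \<le> j * (prime_pi (2 ^ j) + 1)" if "j > 0"
proof -
  define n :: nat where "n = 2 ^ (j - 1)"
  have n: "n > 0" "2 * n = 2 ^ j" using that by (cases j; simp add: n_def)+
  have "4 ^ n / (2 * real n) \<le> real (2 * n choose n)" using n by (intro central_binomial_lower_bound)
  also have "\<dots> \<le> real ((2 * n) ^ prime_pi (2 * n))"
    using binomial_le_power_prime_pi[OF n(1)] by (intro of_nat_mono)
  finally have "4 ^ n \<le> real ((2 * n) ^ prime_pi (2 * n)) * (2 * real n)"
    using n(1) by (simp add: pos_divide_le_eq)
  also have "\<dots> = real ((2 * n) ^ (prime_pi (2 * n) + 1))" by simp
  finally have "real (4 ^ n) \<le> real ((2 * n) ^ (prime_pi (2 * n) + 1))" by simp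
  then have "(4::nat) ^ n \<le> (2 ^ j) ^ (prime_pi (2 ^ j) + 1)" unfolding n(2) by (rule of_nat_le_iff[THEN iffD1])
  moreover have "(2::nat) ^ (2 ^ j) = (2 ^ 2) ^ n" unfolding n(2)[symmetric] by (rule power_mult)
  ultimately have "(2::nat) ^ (2 ^ j) \<le> 2 ^ (j * (prime_pi (2 ^ j) + 1))"
    unfolding power_mult[of 2 j] by simp
  then show ?thesis by (rule power_le_imp_le_exp[rotated]) simp
qed

text \<open>At least half of the primes up to \<open>n\<close> exceed n / 256. The ratio 256 is
  large enough for the gap between the constants of the upper and the lower Chebyshev bound.\<close>

lemma prime_pi_div_256_le: "2 * prime_pi (n div 256) \<le> prime_pi n"
proof (cases "n div 256 \<le> 1")
  case False
  define j where "j = floorlog 2 n - 1"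
  have n: "n \<ge> 512" using False by auto
  have fl: "floorlog 2 n > 0" using n by (simp add: floorlog_def)
  have b: "2 ^ j \<le> n" "n < 2 ^ Suc j"
    using floorlog_bounds[of n 2] n fl by (auto simp: j_def)
  have "(2::nat) ^ 9 < 2 ^ Suc j" using n b(2) by simp
  then have j: "9 \<le> j" using power_less_imp_less_exp[of "2::nat" 9 "Suc j"] by simp
  \<comment> \<open>From \<open>n < 2 ^ Suc j\<close> and 256 = 2^8, the quotient
    \<open>n div 256\<close> is at most \<open>2 ^ (j - 7)\<close>.\<close>
  define s where "s = j - 7"
  have s: "s \<ge> 2" "j = s + 7" using j by (auto simp: s_def)
  have "n div 256 \<le> 2 ^ s" using b(2) s by (simp add: power_add)
  then have 1: "s * prime_pi (n div 256) \<le> 6 * 2 ^ s"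
    using prime_pi_power2_le[of s] prime_pi_mono[of "n div 256" "2 ^ s"]
    by (meson le_trans mult_le_mono2)
  have 2: "2 ^ j \<le> j * (prime_pi n + 1)"
    using prime_pi_power2_ge[of j] s prime_pi_mono[OF b(1)]
    by (meson add_le_mono1 le_trans mult_le_mono2 add_gr_0 zero_less_numeral)
  have "2 * (s + 7) \<le> 9 * s" using s by simp
  \<comment> \<open>Both sides are multiplied by \<open>s\<close> and \<open>j = s + 7\<close> to
    avoid division. In the end 13 * 9 = 117 is compared with 2 * 2^7 = 256.\<close>
  have "2 * (2 * prime_pi (n div 256) + 1) * (s * (s + 7)) \<le> 2 * (prime_pi n + 1) * (s * (s + 7))"
  proof -
    have "2 * (2 * prime_pi (n div 256) + 1) * (s * (s + 7)) =
        4 * (s * prime_pi (n div 256)) * (s + 7) + 2 * s * (s + 7)" by (simp add: algebra_simps)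
    also have "\<dots> \<le> 4 * (6 * 2 ^ s) * (s + 7) + 2 * 2 ^ s * (s + 7)"
      using 1 less_imp_le[OF less_exp[of s]] by (intro add_le_mono mult_le_mono1 mult_le_mono2) auto
    also have "\<dots> = 13 * 2 ^ s * (2 * (s + 7))" by simp
    also have "\<dots> \<le> 13 * 2 ^ s * (9 * s)" using \<open>2 * (s + 7) \<le> 9 * s\<close> by (intro mult_le_mono2)
    also have "\<dots> \<le> 2 * s * (2 ^ j)" using s by (simp add: power_add)
    also have "\<dots> \<le> 2 * s * (j * (prime_pi n + 1))" using 2 by (intro mult_le_mono2)
    also have "\<dots> = 2 * (prime_pi n + 1) * (s * (s + 7))" using s by (simp add: algebra_simps)
    finally show ?thesis .
  qed
  then show ?thesis using s by simp
qed simp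

text \<open>Half of the members exceed \<open>Max S div 256\<close>: either all do, or
  \<open>S\<close> contains every prime between that number and \<open>Max S\<close>, which is half
  of all primes up to \<open>Max S\<close>. Each such member is at least \<open>Max S\<close> / 256,
  whence 512 = 2 * 256.\<close>

theorem consecutive_primes_card_Max_le:
  assumes "consecutive_primes S"
  shows "card S * Max S \<le> 512 * \<Sum>S"
proof -
  from assms obtain a b where S: "S = {p. prime p \<and> a \<le> p \<and> p \<le> b}" "S \<noteq> {}"
    unfolding consecutive_primes_def by auto
  have fin: "finite S" unfolding S by (rule finite_subset[of _ "{..b}"]) auto
  define M where "M = Max S"
  have M: "M \<in> S" "\<And>p. p \<in> S \<Longrightarrow> p \<le> M" using fin S(2) by (auto simp: M_def)
  let ?T = "{p\<in>S. M div 256 < p}"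
  have finT: "finite ?T" using fin by auto
  have "card S \<le> 2 * card ?T"
  proof (cases "\<forall>p\<in>S. M div 256 < p")
    case True
    then have "?T = S" by auto
    then show ?thesis by simp
  next
    case False
    then obtain q where q: "q \<in> S" "q \<le> M div 256" by force
    have T: "?T = {p. prime p \<and> p \<le> M} - {p. prime p \<and> p \<le> M div 256}"
    proof (intro equalityI subsetI)
      fix p assume p: "p \<in> {p. prime p \<and> p \<le> M} - {p. prime p \<and> p \<le> M div 256}"
      then have "q \<le> p" "p \<le> M" using q by auto
      then show "p \<in> ?T" using q p M(1) by (auto simp: S)
    qed (use M in \<open>auto simp: S\<close>)
    have "card ?T = prime_pi M - prime_pi (M div 256)"
      unfolding T prime_pi_def by (intro card_Diff_subset) (auto intro: order_trans)
    moreover have "card S \<le> prime_pi M"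
      unfolding prime_pi_def using M by (intro card_mono) (auto simp: S)
    ultimately show ?thesis using prime_pi_div_256_le[of M] by linarith
  qed
  then have "card S * M \<le> 2 * (card ?T * M)" by simp
  also have "card ?T * M = (\<Sum>p\<in>?T. M)" by simp
  also have "\<dots> \<le> (\<Sum>p\<in>?T. 256 * p)"
  proof (intro sum_mono)
    fix p assume "p \<in> ?T"
    then show "M \<le> 256 * p" by auto
  qed
  also have "\<dots> = 256 * \<Sum>?T" by (simp add: sum_distrib_left)
  also have "\<Sum>?T \<le> \<Sum>S" using fin by (intro sum_mono2) auto
  finally show ?thesis by (simp add: M_def)
qed

section \<open>Rough numbers\<close>

text \<open>Equivalent to coprimality with \<open>fact w\<close>, hence periodic modulo
  \<open>fact w\<close>.\<close>

definition rough :: "nat \<Rightarrow> nat \<Rightarrow> bool" where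
  "rough w m \<longleftrightarrow> (\<forall>d\<in>{2..w}. \<not> d dvd m)"

lemma rough_add_mult_fact: "rough w (m + t * fact w) \<longleftrightarrow> rough w m"
proof -
  have "d dvd m + t * fact w \<longleftrightarrow> d dvd m" if "d \<in> {2..w}" for d
    using that by (intro dvd_add_left_iff dvd_mult dvd_fact) auto
  then show ?thesis by (auto simp: rough_def)
qed

lemma rough_mod_fact: "rough w (m mod fact w) \<longleftrightarrow> rough w m"
  using rough_add_mult_fact[of w "m mod fact w" "m div fact w"] by simp

lemma card_rough_periodic: "card {m. m < t * fact w \<and> rough w m} = t * card {m. m < fact w \<and> rough w m}"
proof (induction t)
  case (Suc t)
  let ?B = "{m. m < fact w \<and> rough w m}"
  have "{m. m < Suc t * fact w \<and> rough w m} = {m. m < t * fact w \<and> rough w m} \<union> (\<lambda>m. m + t * fact w) ` ?B"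
  proof (intro equalityI subsetI)
    fix m assume m: "m \<in> {m. m < Suc t * fact w \<and> rough w m}"
    show "m \<in> {m. m < t * fact w \<and> rough w m} \<union> (\<lambda>m. m + t * fact w) ` ?B"
    proof (cases "m < t * fact w")
      case False
      then have "m = (m - t * fact w) + t * fact w" by simp
      moreover have "m - t * fact w \<in> ?B"
        using m False rough_add_mult_fact[of w "m - t * fact w" t] by auto
      ultimately show ?thesis by blast
    qed (use m in auto)
  qed (auto simp: rough_add_mult_fact)
  moreover have "card ((\<lambda>m. m + t * fact w) ` ?B) = card ?B" by (intro card_image) (auto simp: inj_on_def)
  ultimately show ?case using Suc by (simp only:) (subst card_Un_disjoint, auto)
qed simp

lemma rough_coprime: "rough w m \<Longrightarrow> 0 < j \<Longrightarrow> j \<le> w \<Longrightarrow> coprime j m"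
proof (rule ccontr)
  assume a: "rough w m" "0 < j" "j \<le> w" "\<not> coprime j m"
  have "gcd j m \<noteq> 1" using a(4) coprime_iff_gcd_eq_1 by blast
  moreover have "gcd j m > 0" using a by simp
  moreover have "gcd j m \<le> w" using a gcd_le1_nat[of j m] by linarith
  ultimately have "gcd j m \<in> {2..w}" unfolding atLeastAtMost_iff by linarith
  then show False using a(1) by (auto simp: rough_def)
qed

text \<open>For \<open>j \<le> w\<close> the multiples \<open>j * m\<close> of rough \<open>m\<close> are disjoint, because \<open>j\<close> is determined as the
  \<open>w\<close>-smooth part; comparing densities gives the bound without Euler products.\<close>

lemma card_rough_harm_le: "real (card {m. m < fact w \<and> rough w m}) * harm w \<le> fact w"
proof (cases "w \<le> 1")
  case True
  then have "w = 0 \<or> w = 1" by auto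
  then show ?thesis by (auto simp: harm_def rough_def)
next
  case False
  let ?W = "fact w :: nat"
  let ?f = "card {m. m < ?W \<and> rough w m}"
  \<comment> \<open>Cutting off at \<open>?W * ?W\<close> gives every \<open>j\<close> exactly
    \<open>?W div j\<close> full periods, so the densities are compared without rounding
    errors.\<close>
  let ?A = "\<lambda>j. (\<lambda>m. j * m) ` {m. m < (?W div j) * ?W \<and> rough w m}"
  have 0: "\<not> rough w 0" using False by (auto simp: rough_def intro!: bexI[of _ 2])
  have jdvd: "j dvd ?W" if "j \<in> {1..w}" for j using that by (auto intro: dvd_fact)
  have card: "card (?A j) = (?W div j) * ?f" if "j \<in> {1..w}" for j
    using that by (subst card_image) (auto simp: inj_on_def card_rough_periodic)
  have disj: "?A i \<inter> ?A j = {}" if ij: "i \<in> {1..w}" "j \<in> {1..w}" "i \<noteq> j" for i j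
  proof (rule ccontr)
    assume "?A i \<inter> ?A j \<noteq> {}"
    then obtain m n where mn: "i * m = j * n" "rough w m" "rough w n" by auto
    have "i dvd j * n" "j dvd i * m" using mn(1) by (metis dvd_triv_left)+
    moreover have "coprime i n" "coprime j m" using mn ij by (auto intro: rough_coprime)
    ultimately have "i dvd j" "j dvd i" by (auto simp: coprime_dvd_mult_left_iff)
    then show False using ij(3) dvd_antisym by blast
  qed
  have sub: "(\<Union>j\<in>{1..w}. ?A j) \<subseteq> {..<?W * ?W}"
  proof
    fix y assume "y \<in> (\<Union>j\<in>{1..w}. ?A j)"
    then obtain j m where jm: "j \<in> {1..w}" "y = j * m" "m < (?W div j) * ?W" by auto
    then have "y < j * ((?W div j) * ?W)" by auto
    also have "\<dots> = ?W * ?W" using jdvd[OF jm(1)] by (simp add: mult.assoc[symmetric])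
    finally show "y \<in> {..<?W * ?W}" by simp
  qed
  have "(\<Sum>j\<in>{1..w}. (?W div j) * ?f) = (\<Sum>j\<in>{1..w}. card (?A j))"
    using card by (intro sum.cong) auto
  also have "\<dots> = card (\<Union>j\<in>{1..w}. ?A j)"
    using disj by (subst card_UN_disjoint) auto
  also have "\<dots> \<le> card {..<?W * ?W}" using sub by (intro card_mono) auto
  finally have le: "(\<Sum>j\<in>{1..w}. (?W div j) * ?f) \<le> ?W * ?W" by simp
  have "real ?W * (real ?f * harm w) = (\<Sum>j\<in>{1..w}. real (?W div j) * real ?f)"
    unfolding harm_def sum_distrib_left using jdvd
    by (intro sum.cong) (auto simp: real_of_nat_div inverse_eq_divide)
  also have "\<dots> = real (\<Sum>j\<in>{1..w}. (?W div j) * ?f)" by simp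
  also have "\<dots> \<le> real (?W * ?W)" using le by (rule of_nat_mono)
  finally show ?thesis by (simp add: mult_le_cancel_left)
qed

text \<open>Rounding \<open>Y\<close> up to whole periods at most doubles it, because one period
  already fits.\<close>

lemma card_rough_le:
  assumes "fact w \<le> Y"
  shows "real (card {m. m < Y \<and> rough w m}) * harm w \<le> 2 * real Y"
proof -
  let ?W = "fact w :: nat"
  let ?t = "Y div ?W + 1"
  have "Y mod ?W < ?W" by simp
  then have "Y \<le> Y div ?W * ?W + ?W" using div_mult_mod_eq[of Y ?W] by linarith
  then have "Y \<le> ?t * ?W" by simp
  then have "card {m. m < Y \<and> rough w m} \<le> card {m. m < ?t * ?W \<and> rough w m}"
    by (intro card_mono) auto
  then have "real (card {m. m < Y \<and> rough w m}) \<le> real (?t * card {m. m < ?W \<and> rough w m})"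
    unfolding card_rough_periodic by (rule of_nat_mono)
  then have "real (card {m. m < Y \<and> rough w m}) * harm w \<le> real (?t * card {m. m < ?W \<and> rough w m}) * harm w"
    by (intro mult_right_mono harm_nonneg)
  also have "\<dots> = real ?t * (real (card {m. m < ?W \<and> rough w m}) * harm w)"
    by (simp only: of_nat_mult mult.assoc)
  also have "\<dots> \<le> real ?t * real ?W" using card_rough_harm_le[of w] by (intro mult_left_mono) auto
  also have "\<dots> = real (Y div ?W * ?W + ?W)" by (simp add: algebra_simps)
  also have "\<dots> \<le> real (2 * Y)"
  proof (rule of_nat_mono)
    have "Y div ?W * ?W \<le> Y" by simp
    then show "Y div ?W * ?W + ?W \<le> 2 * Y" using assms by linarith
  qed
  finally show ?thesis by simp
qed

lemma harm_le_ln: "n > 0 \<Longrightarrow> harm n \<le> 1 + ln (real n)"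
  using euler_mascheroni_sequence_decreasing[of 1 n] by (simp add: harm_def)

text \<open>For each prime \<open>p\<close> the rough cofactors number at most about 4 X / (p *
  \<open>harm w\<close>). The sum of 1 / p is O(log log X), and log X is O(w^2) because
  \<open>X\<close> is at most a constant times \<open>c ^ 3\<close> with
  \<open>c < fact (w + 1)\<close>. So log log X is O(log w), which cancels against
  \<open>harm w\<close>.\<close>

lemma card_sieve_strikes_le:
  assumes w: "w \<ge> 1" "fact w \<le> c" "c < fact (w + 1)" and X: "c ^ 2 \<le> X" "X \<le> 2 ^ b * c ^ 3"
  shows "real (card {(p, m). prime p \<and> p * p < X \<and> rough w m \<and> p * m < X}) \<le>
    4 * (7 + 2 * ln (real (b + 3))) * real X"
proof -
  let ?P = "{p::nat. prime p \<and> p * p < X}"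
  have leX: "p \<le> X" if "p * p < X" for p :: nat using that le_square[of p] by linarith
  \<comment> \<open>The quotient X / p rounded up, which counts the \<open>m\<close> with
    \<open>p * m < X\<close>.\<close>
  define Y where "Y = (\<lambda>p. (X + p - 1) div p)"
  have finP: "finite ?P"
  proof (rule finite_subset[of _ "{..X}"])
    show "?P \<subseteq> {..X}" using leX by auto
  qed simp
  have c: "c \<ge> 1" using w(2) by (meson fact_ge_1 le_trans)
  have mY: "p * m < X \<longleftrightarrow> m < Y p" if "p \<in> ?P" for p m
  proof -
    have p: "p > 0" using that by (auto simp: prime_gt_0_nat)
    have "m < Y p \<longleftrightarrow> Suc m \<le> (X + p - 1) div p" by (simp add: Y_def Suc_le_eq)
    also have "\<dots> \<longleftrightarrow> Suc m * p \<le> X + p - 1" using p by (rule less_eq_div_iff_mult_less_eq)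
    also have "\<dots> \<longleftrightarrow> p * m < X" using p by (auto simp: algebra_simps)
    finally show ?thesis by simp
  qed
  \<comment> \<open>A full period fits since X / p > sqrt X for \<open>p * p < X\<close>, and sqrt X
    is at least \<open>c\<close>, hence at least \<open>fact w\<close>.\<close>
  have YW: "fact w \<le> Y p" if p: "p \<in> ?P" for p
  proof (rule ccontr)
    assume "\<not> fact w \<le> Y p"
    then have "Y p < c" using w(2) by simp
    have "X \<le> p * Y p" using mY[OF p, of "Y p"] by simp
    also have "\<dots> \<le> p * c" using \<open>Y p < c\<close> by simp
    finally have Xpc: "X \<le> p * c" .
    have "p * p < X" using p by simp
    also note Xpc
    finally have "p < c" by simp
    then have "p * c < c * c" using c by simp
    then show False using Xpc X(1) unfolding power2_eq_square by linarith
  qed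
  have Yle: "real (Y p) \<le> 2 * (real X / real p)" if p: "p \<in> ?P" for p
  proof -
    have p0: "p > 0" using p by (auto simp: prime_gt_0_nat)
    have "p \<le> X" using p leX by auto
    have "Y p * p \<le> X + p - 1" by (simp add: Y_def)
    also have "\<dots> \<le> 2 * X" using \<open>p \<le> X\<close> by simp
    finally have "real (Y p * p) \<le> real (2 * X)" by (rule of_nat_mono)
    then show ?thesis using p0 by (simp add: field_simps)
  qed
  have hw: "harm w \<ge> (1::real)" using harm_mono[of 1 w] w(1) by (simp add: harm_def)
  have "{(p, m). prime p \<and> p * p < X \<and> rough w m \<and> p * m < X} = Sigma ?P (\<lambda>p. {m. m < Y p \<and> rough w m})"
    using mY by auto
  then have "real (card {(p, m). prime p \<and> p * p < X \<and> rough w m \<and> p * m < X}) * harm w =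
      (\<Sum>p\<in>?P. real (card {m. m < Y p \<and> rough w m}) * harm w)"
    using finP by (simp add: sum_distrib_right)
  also have "\<dots> \<le> (\<Sum>p\<in>?P. 4 * (real X / real p))"
  proof (intro sum_mono)
    fix p assume p: "p \<in> ?P"
    show "real (card {m. m < Y p \<and> rough w m}) * harm w \<le> 4 * (real X / real p)"
      using card_rough_le[OF YW[OF p]] Yle[OF p] by linarith
  qed
  also have "\<dots> = 4 * real X * (\<Sum>p\<in>?P. 1 / real p)" by (simp add: sum_distrib_left)
  also have "\<dots> \<le> 4 * real X * ((7 + 2 * ln (real (b + 3))) * harm w)"
  proof (rule mult_left_mono)
    define v where "v = (w + 1) ^ 2"
    \<comment> \<open>Chosen so that \<open>X \<le> 2 ^ Suc j\<close>. As \<open>v\<close> is the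
      square of \<open>w + 1\<close>, \<open>ln j\<close> is at most \<open>2 * ln (w + 1)\<close>
      plus a constant, and \<open>ln (w + 1) \<le> harm w\<close>.\<close>
    define j where "j = (b + 3) * v - 1"
    have v: "v \<ge> 1" by (simp add: v_def)
    have "(b + 3) * v \<ge> 3 * 1" using v by (intro mult_mono) auto
    then have j: "Suc j = (b + 3) * v" "j > 0" by (auto simp: j_def)
    have "(fact (w + 1) :: nat) \<le> (w + 1) ^ (w + 1)" 
      using fact_le_power[of "w + 1", where 'a = nat] by (simp only: of_nat_id)
    also have "\<dots> \<le> (2 ^ (w + 1)) ^ (w + 1)" by (intro power_mono less_imp_le[OF less_exp]) auto
    also have "\<dots> = 2 ^ v" unfolding v_def power_mult[symmetric] by (simp add: power2_eq_square)
    finally have "c \<le> 2 ^ v" using w(3) by simp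
    then have "c ^ 3 \<le> (2 ^ v) ^ 3" by (intro power_mono) auto
    then have "X \<le> 2 ^ b * (2 ^ v) ^ 3" using X(2) by (meson le_trans mult_le_mono2)
    also have "\<dots> = 2 ^ (b + 3 * v)" by (simp add: power_add power_mult mult.commute)
    also have "\<dots> \<le> 2 ^ Suc j" unfolding j(1) using v by (intro power_increasing) (auto simp: algebra_simps)
    finally have Xj: "X \<le> 2 ^ Suc j" .
    have "(\<Sum>p\<in>?P. 1 / real p) \<le> (\<Sum>p | prime p \<and> p \<le> 2 ^ Suc j. 1 / real p)"
    proof (intro sum_mono2)
      show "?P \<subseteq> {p. prime p \<and> p \<le> 2 ^ Suc j}"
        using Xj leX by (auto intro: order_trans)
    qed auto
    also have "\<dots> \<le> 1 + 2 * harm j" by (rule sum_inverse_primes_le)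
    also have "harm j \<le> 1 + ln (real ((b + 3) * v))"
    proof -
      have "harm j \<le> 1 + ln (real j)" using j by (intro harm_le_ln)
      also have "ln (real j) \<le> ln (real ((b + 3) * v))" 
        unfolding j(1)[symmetric] using j(2) by (subst ln_le_cancel_iff) auto
      finally show ?thesis by simp
    qed
    also have "ln (real ((b + 3) * v)) = ln (real (b + 3)) + 2 * ln (real w + 1)"
      using v by (simp add: ln_mult v_def ln_realpow add.commute)
    also have "ln (real w + 1) \<le> harm w" by (rule harm_ge_ln)
    finally have "(\<Sum>p\<in>?P. 1 / real p) \<le> 3 + 2 * ln (real (b + 3)) + 4 * harm w" by simp
    moreover have "0 \<le> ln (real (b + 3))" by (intro ln_ge_zero) auto
    then have "(3 + 2 * ln (real (b + 3))) * 1 \<le> (3 + 2 * ln (real (b + 3))) * harm w"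
      using hw by (intro mult_left_mono) auto
    ultimately show "(\<Sum>p\<in>?P. 1 / real p) \<le> (7 + 2 * ln (real (b + 3))) * harm w"
      by (simp add: distrib_right)
  qed simp
  finally have "real (card {(p, m). prime p \<and> p * p < X \<and> rough w m \<and> p * m < X}) * harm w \<le>
      (4 * (7 + 2 * ln (real (b + 3))) * real X) * harm w" by (simp add: algebra_simps)
  then show ?thesis using hw w(1) by (simp add: mult_le_cancel_right)
qed

section \<open>The segmented wheel sieve\<close>

text \<open>Variables of the program:
  0 input \<open>x\<close>; 1 length of the output; 2 \<open>c0\<close>; 3 \<open>R\<close>; 4 \<open>T\<close>; 5 \<open>w\<close>; 6 \<open>W = w!\<close>;
  7 and 8 start and end of the current segment of sums; 9 window length \<open>k\<close>; 10 \<open>lim k\<close>;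
  11 and 12 lower and upper end of the window, 13 its sum, 14 its number of primes;
  15 and 16 stream descriptor of the lower end, 17 and 18 of the upper end;
  19 and 20 length and address of the private buffers; 21 and 22 first number and address of the
  buffer to be refilled; 23 to 28 loop counters and scratch.

  Arrays: 0 bits (1 means not prime); 1 residues modulo \<open>W\<close> that are not rough; 2 distance from a
  residue to the next rough one; 3 to 12 the values of variables 11 to 20 for each \<open>k\<close>;
  13 counts for the current segment; 14 histogram.

  The bit for \<open>q\<close> in a stream with descriptor \<open>(e, t)\<close> is entry \<open>t - (e - q)\<close> of array 0.\<close>

definition fill_com :: com where
  "fill_com = (23 ::= Num 0 ;;
    WHILE Var 23 < Var 19 DO
      (0\<langle>Var 22 \<oplus> Var 23\<rangle> ::= Arr 1 ((Var 21 \<oplus> Var 23) \<odot> Var 6) ;;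
       23 ::= Var 23 \<oplus> Num 1))"

text \<open>The first cofactor is the rounded-up quotient, but at least \<open>p\<close>: composites
  with a cofactor below \<open>p\<close> are left to a smaller prime. Array 2 leads to the next
  rough number strictly above, so the lookup starts one below.\<close>

definition strike_init_com :: com where
  "strike_init_com =
    (26 ::= (Var 21 \<oplus> Var 25 \<ominus> Num 1) \<oslash> Var 25 ;;
     IF Var 26 < Var 25 THEN 26 ::= Var 25 ELSE Skip ;;
     26 ::= Var 26 \<ominus> Num 1 ;;
     26 ::= Var 26 \<oplus> Arr 2 (Var 26 \<odot> Var 6))"

definition strike_com :: com where
  "strike_com = (strike_init_com ;;
     WHILE Var 25 \<otimes> Var 26 < Var 21 \<oplus> Var 19 DO
       (0\<langle>Var 22 \<oplus> (Var 25 \<otimes> Var 26 \<ominus> Var 21)\<rangle> ::= Num 1 ;;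
        26 ::= Var 26 \<oplus> Arr 2 (Var 26 \<odot> Var 6)))"

text \<open>Sieving primes are recognised in the shared table, so no list of primes is
  stored.\<close>

definition refill_com :: com where
  "refill_com =
    (fill_com ;;
     25 ::= Var 5 \<oplus> Num 1 ;;
     WHILE Var 25 \<otimes> Var 25 < Var 21 \<oplus> Var 19 DO
       (IF Arr 0 (Var 25) < Num 1 THEN strike_com ELSE Skip ;;
        25 ::= Var 25 \<oplus> Num 1))"

section \<open>Parameters of the algorithm\<close>

locale puzzle =
  fixes x :: nat
  assumes x0: "x > 0"
begin

text \<open>The cube root rounded up. Roots are defined as least integers to match the linear
  searches of the program.\<close>

definition c0 :: nat where "c0 = (LEAST c. x \<le> c * c * c)"
text \<open>Bounds the number of terms in any representation of a number up to
  \<open>x\<close>.\<close>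

definition R :: nat where "R = (LEAST r. 2 * x \<le> r * r)"
text \<open>Large enough that \<open>lim k \<le> T\<close> for all \<open>k \<ge> c0\<close>:
  windows that long never leave the shared table.\<close>

definition T :: nat where "T = 512 * c0 * c0 + 1"
definition w :: nat where "w = (LEAST w. c0 < fact (Suc w))"
definition W :: nat where "W = fact w"
text \<open>The square root of x / k rounded up, hence of the order of the square root of
  \<open>lim k\<close>.\<close>

definition ell :: "nat \<Rightarrow> nat" where "ell k = (LEAST l. x \<le> l * l * k)"
text \<open>Each length owns two consecutive buffers, one for each end of its window.\<close>

definition bas :: "nat \<Rightarrow> nat" where "bas k = T + 2 * (\<Sum>j=1..<k. ell j)"
text \<open>By the Chebyshev estimate, a run of \<open>k\<close> primes with sum at most
  \<open>x\<close> lies strictly below \<open>lim k\<close>.\<close>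

definition lim :: "nat \<Rightarrow> nat" where "lim k = 512 * x div k + 1"
definition L :: nat where "L = bas c0 + R + c0 + 5"
definition Lw :: nat where "Lw = R + c0 + 5"
text \<open>The multiple of \<open>x\<close> leaves room for window sums, positions and cofactors;
  the rest makes every address fit.\<close>

definition U :: nat where "U = 96 + 16 * L + 10000 * (x + 1)"

sublocale ram U L Lw
  by unfold_locales (auto simp: U_def L_def Lw_def)

lemma x_le_c0: "x \<le> c0 * c0 * c0"
  unfolding c0_def by (rule LeastI[of _ x]) (use x0 in \<open>simp add: mult.assoc\<close>)

lemma c0_least: "d < c0 \<Longrightarrow> d * d * d < x"
  unfolding c0_def using not_less_Least by (metis not_le)

lemma c0_ge1: "c0 \<ge> 1"
  using x_le_c0 x0 by (cases c0) auto

lemma c0_le: "c0 \<le> x"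
  unfolding c0_def by (rule Least_le) (use x0 in \<open>simp add: mult.assoc\<close>)

lemma R_ge: "2 * x \<le> R * R"
  unfolding R_def by (rule LeastI[of _ "2 * x"]) (use x0 in auto)

lemma R_least: "d < R \<Longrightarrow> d * d < 2 * x"
  unfolding R_def using not_less_Least by (metis not_le)

lemma R_le: "R \<le> 2 * x"
  unfolding R_def by (rule Least_le) (use x0 in auto)

lemma R_ge2: "R \<ge> 2"
proof (rule ccontr)
  assume "\<not> R \<ge> 2"
  then have "R = 0 \<or> R = 1" by auto
  then show False using R_ge x0 by auto
qed

lemma c0_less_fact: "c0 < fact (Suc w)"
proof -
  have "c0 < fact (Suc c0)" using fact_ge_self[of "Suc c0"] by linarith
  then show ?thesis unfolding w_def by (rule LeastI)
qed

lemma w_ge1: "w \<ge> 1"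
  using c0_less_fact c0_ge1 by (cases w) auto

lemma W_le: "W \<le> c0"
proof -
  have "\<not> c0 < fact (Suc (w - 1))"
    using not_less_Least[of "w - 1" "\<lambda>w. c0 < fact (Suc w)"] w_ge1 unfolding w_def[symmetric] by auto
  then show ?thesis using w_ge1 by (simp add: W_def)
qed

lemma w_le: "w \<le> W"
  unfolding W_def by (rule fact_ge_self)

lemma W_pos: "W > 0"
  by (simp add: W_def)

lemma ell_ge: "k \<ge> 1 \<Longrightarrow> x \<le> ell k * ell k * k"
  unfolding ell_def
proof (rule LeastI[of _ x])
  assume "k \<ge> 1"
  then have "x * 1 \<le> (x * x) * k" using x0 by (intro mult_le_mono) auto
  then show "x \<le> x * x * k" by simp
qed

lemma ell_least: "d < ell k \<Longrightarrow> d * d * k < x"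
  unfolding ell_def using not_less_Least by (metis not_le)

lemma ell_ge1: "k \<ge> 1 \<Longrightarrow> ell k \<ge> 1"
  using ell_ge[of k] x0 by (cases "ell k") auto

lemma ell_le: "k \<ge> 1 \<Longrightarrow> ell k \<le> x"
  unfolding ell_def
proof (rule Least_le)
  assume "k \<ge> 1"
  then have "x * 1 \<le> (x * x) * k" using x0 by (intro mult_le_mono) auto
  then show "x \<le> x * x * k" by simp
qed

lemma T_gt: "T > c0"
proof -
  have "c0 * 1 \<le> c0 * c0" using c0_ge1 by (intro mult_le_mono) auto
  then show ?thesis unfolding T_def by linarith
qed

lemma U_ge: "L \<le> U" "10000 * x + 10000 \<le> U"
  by (auto simp: U_def)

definition gapok :: "(nat \<Rightarrow> nat) \<Rightarrow> bool" where
  "gapok g \<longleftrightarrow> (\<forall>m. 0 < g (m mod W) \<and> g (m mod W) \<le> W \<and> rough w (m + g (m mod W)) \<and>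
     (\<forall>d. 0 < d \<and> d < g (m mod W) \<longrightarrow> \<not> rough w (m + d)))"

definition sieve_env :: "(nat \<Rightarrow> nat) \<Rightarrow> (nat \<Rightarrow> nat \<Rightarrow> nat) \<Rightarrow> bool" where
  "sieve_env v a \<longleftrightarrow> v 5 = w \<and> v 6 = W \<and> (\<forall>r<W. a 1 r = of_bool (\<not> rough w r)) \<and> gapok (a 2)"

lemma fill_spec:
  assumes env: "sieve_env v a" and b: "v 22 + v 19 \<le> L" "v 21 + v 19 \<le> 514 * x + 1"
    and Q: "\<And>v' a' n'. frame fill_com v a v' a' \<Longrightarrow>
      (\<forall>i<v 19. a' 0 (v 22 + i) = of_bool (\<not> rough w (v 21 + i))) \<Longrightarrow>
      (\<forall>q. q < v 22 \<or> v 22 + v 19 \<le> q \<longrightarrow> a' 0 q = a 0 q) \<Longrightarrow>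
      n' \<le> n + 40 * v 19 + 40 \<Longrightarrow> Q v' a' n'"
  shows "wp fill_com Q v a n"
proof (rule wp_frame)
  let ?I = "\<lambda>v' a' n'. v' 23 \<le> v 19 \<and>
      (\<forall>i<v' 23. a' 0 (v 22 + i) = of_bool (\<not> rough w (v 21 + i))) \<and>
      (\<forall>q. q < v 22 \<or> v 22 + v 19 \<le> q \<longrightarrow> a' 0 q = a 0 q) \<and> n' \<le> n + 10 + 40 * v' 23"
  have W0: "W > 0" by (rule W_pos)
  have WL: "r < W \<Longrightarrow> r < L" for r using W_le unfolding L_def by linarith
  show "wp fill_com (\<lambda>v' a' n'. (\<forall>i<v 19. a' 0 (v 22 + i) = of_bool (\<not> rough w (v 21 + i))) \<and>
      (\<forall>q. q < v 22 \<or> v 22 + v 19 \<le> q \<longrightarrow> a' 0 q = a 0 q) \<and> n' \<le> n + 40 * v 19 + 40) v a n"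
    unfolding fill_com_def
    apply simp
  proof (rule wp_While[where I = ?I and f = "\<lambda>v' a'. v 19 - v' 23"], goal_cases)
    case 1
    then show ?case by simp
  next
    case (2 v' a' n')
    then show ?case by simp
  next
    case (3 v' a' n')
    have fr: "\<forall>y. y \<noteq> 23 \<longrightarrow> v' y = v y" "\<forall>A. A \<noteq> 0 \<longrightarrow> a' A = a A"
      using 3(1) by (auto simp: frame_def)
    have i: "v' 23 < v 19" using 3 fr by simp
    have rm: "a 1 ((v 21 + v' 23) mod W) = of_bool (\<not> rough w (v 21 + v' 23))"
      using env W0 rough_mod_fact[of w "v 21 + v' 23"] by (simp add: sieve_env_def W_def)
    show ?case using 3(2) i fr rm env b U_ge WL W0
      by (auto simp: wok_def sieve_env_def less_Suc_eq)
  next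
    case (4 v' a' n')
    have fr: "\<forall>y. y \<noteq> 23 \<longrightarrow> v' y = v y" "\<forall>A. A \<noteq> 0 \<longrightarrow> a' A = a A"
      using 4(1) by (auto simp: frame_def)
    have "v' 23 = v 19" using 4 fr by simp
    then show ?case using 4 by auto
  qed
qed (use Q in blast)

text \<open>The pairs before \<open>(p, m)\<close> in the order in which the sieve proceeds; their
  number is the potential that pays for the inner loop. Pairs that the sieve never visits are
  included, as only an upper bound is wanted.\<close>

definition strikes :: "nat \<Rightarrow> nat \<Rightarrow> nat \<Rightarrow> nat \<Rightarrow> (nat \<times> nat) set" where
  "strikes u e p m = {(p', m'). prime p' \<and> p' * p' < e \<and> rough w m' \<and> u \<le> p' * m' \<and> p' * m' < e \<and>
     (p' < p \<or> (p' = p \<and> m' < m))}"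

lemma finite_strikes [simp]: "finite (strikes u e p m)"
proof (rule finite_subset)
  show "strikes u e p m \<subseteq> {..e} \<times> {..e}"
  proof (clarsimp simp: strikes_def)
    fix p' m' assume a: "prime p'" "p' * p' < e" "p' * m' < e"
    have "p' \<le> p' * p'" "m' \<le> p' * m'" using prime_ge_1_nat[OF a(1)] by auto
    then show "p' \<le> e \<and> m' \<le> e" using a by linarith
  qed
qed simp

lemma strikes_mono: "p < p2 \<or> (p = p2 \<and> m \<le> m2) \<Longrightarrow> card (strikes u e p m) \<le> card (strikes u e p2 m2)"
  by (intro card_mono finite_strikes) (auto simp: strikes_def)

lemma strikes_insert:
  assumes "prime p" "p * p < e" "rough w m" "u \<le> p * m" "p * m < e" "m < m2"
  shows "Suc (card (strikes u e p m)) \<le> card (strikes u e p m2)"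
proof -
  have "(p, m) \<notin> strikes u e p m" by (auto simp: strikes_def)
  then have "Suc (card (strikes u e p m)) = card (insert (p, m) (strikes u e p m))" by simp
  also have "\<dots> \<le> card (strikes u e p m2)"
    using assms by (intro card_mono finite_strikes) (auto simp: strikes_def)
  finally show ?thesis .
qed

text \<open>The numbers marked when the sieve is about to strike out \<open>p * m\<close>.\<close>

definition struck :: "nat \<Rightarrow> nat \<Rightarrow> nat \<Rightarrow> bool" where
  "struck p m q \<longleftrightarrow> \<not> rough w q \<or>
    (\<exists>p' m'. prime p' \<and> w < p' \<and> p' \<le> m' \<and> rough w m' \<and> q = p' * m' \<and> (p' < p \<or> (p' = p \<and> m' < m)))"

text \<open>No number strictly between \<open>m\<close> and \<open>m + g\<close> is rough, so
  \<open>m\<close> is the only new cofactor.\<close>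

lemma struck_step:
  assumes "prime p" "w < p" "p \<le> m" "rough w m" "0 < g" "\<forall>d. 0 < d \<and> d < g \<longrightarrow> \<not> rough w (m + d)"
  shows "struck p (m + g) q \<longleftrightarrow> struck p m q \<or> q = p * m"
proof
  assume "struck p (m + g) q"
  then consider "\<not> rough w q" | p' m' where "prime p'" "w < p'" "p' \<le> m'" "rough w m'" "q = p' * m'"
      "p' < p \<or> (p' = p \<and> m' < m + g)"
    unfolding struck_def by blast
  then show "struck p m q \<or> q = p * m"
  proof cases
    case 2
    show ?thesis
    proof (cases "p' < p \<or> m' < m")
      case True
      then show ?thesis using 2 unfolding struck_def by blast
    next
      case False
      then have "p' = p" "m \<le> m'" "m' < m + g" using 2 by auto
      moreover have "m' = m"
      proof (rule ccontr)
        assume "m' \<noteq> m"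
        then have "0 < m' - m" "m' - m < g" using \<open>m \<le> m'\<close> \<open>m' < m + g\<close> by auto
        then have "\<not> rough w (m + (m' - m))" using assms(6) by blast
        then show False using 2 \<open>m \<le> m'\<close> by simp
      qed
      ultimately show ?thesis using 2 by simp
    qed
  qed (auto simp: struck_def)
next
  assume "struck p m q \<or> q = p * m"
  then show "struck p (m + g) q"
  proof
    assume "q = p * m"
    then show ?thesis using assms unfolding struck_def by (intro disjI2 exI[of _ p] exI[of _ m]) auto
  qed (auto simp: struck_def intro: less_le_trans)
qed

text \<open>Time is charged to the growth of \<open>strikes\<close>: 60 per strike, plus 100 per
  prime for the setup.\<close>

lemma strike_spec:
  assumes env: "sieve_env v a" and b: "v 22 + v 19 \<le> L" "v 21 + v 19 \<le> 514 * x + 1"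
    and p: "prime (v 25)" "w < v 25" "v 25 * v 25 < v 21 + v 19" and u0: "0 < v 21"
    and st: "\<forall>i<v 19. a 0 (v 22 + i) = of_bool (struck (v 25) 0 (v 21 + i))"
    and Q: "\<And>v' a' n'. frame strike_com v a v' a' \<Longrightarrow>
      (\<forall>i<v 19. a' 0 (v 22 + i) = of_bool (struck (Suc (v 25)) 0 (v 21 + i))) \<Longrightarrow>
      (\<forall>q. q < v 22 \<or> v 22 + v 19 \<le> q \<longrightarrow> a' 0 q = a 0 q) \<Longrightarrow>
      n' + 60 * card (strikes (v 21) (v 21 + v 19) (v 25) 0) \<le>
        n + 60 * card (strikes (v 21) (v 21 + v 19) (Suc (v 25)) 0) + 100 \<Longrightarrow> Q v' a' n'"
  shows "wp strike_com Q v a n"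
proof (rule wp_frame)
  define p u e where "p = v 25" and "u = v 21" and "e = v 21 + v 19"
  have pp: "prime p" "w < p" "p * p < e" "p > 0" using p by (auto simp: p_def e_def prime_gt_0_nat)
  have p_le: "p \<le> 514 * x + 1" using pp(3) b le_square[of p] unfolding e_def by linarith
  define m0 where "m0 = (if (u + p - 1) div p < p then p else (u + p - 1) div p)"
  have gp: "0 < a 2 (m mod W)" "a 2 (m mod W) \<le> W" "rough w (m + a 2 (m mod W))"
    "\<forall>d. 0 < d \<and> d < a 2 (m mod W) \<longrightarrow> \<not> rough w (m + d)" for m
    using env unfolding sieve_env_def gapok_def by blast+
  have WL: "r < W \<Longrightarrow> r < L" for r using W_le unfolding L_def by linarith
  have Wx: "W \<le> x" using W_le c0_le by simp
  have m0: "p \<le> m0" "m0 \<le> u + p" 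
    unfolding m0_def using pp(4) div_le_dividend[of "u + p - 1" p] by (auto simp del: div_le_dividend)
  have m0u: "p * m < u" if "m < m0" "p \<le> m" for m
  proof -
    have "m < (u + p - 1) div p" using that unfolding m0_def by (auto split: if_splits)
    then have "Suc m * p \<le> u + p - 1"
      using less_eq_div_iff_mult_less_eq[OF pp(4), of "Suc m" "u + p - 1"] by (simp only: Suc_le_eq)
    then show ?thesis using pp(4) by (simp add: algebra_simps)
  qed
  have m0u': "u \<le> p * m0"
  proof -
    have "u \<le> p * ((u + p - 1) div p)"
    proof (rule ccontr)
      assume "\<not> ?thesis"
      then have "Suc ((u + p - 1) div p) * p \<le> u + p - 1" using pp(4) by (simp add: algebra_simps)
      then show False
        using less_eq_div_iff_mult_less_eq[OF pp(4), of "Suc ((u + p - 1) div p)" "u + p - 1"] by (simp only: Suc_le_eq less_irrefl)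
    qed
    also have "\<dots> \<le> p * m0" unfolding m0_def by (intro mult_le_mono2) auto
    finally show ?thesis .
  qed
  define m1 where "m1 = (m0 - 1) + a 2 ((m0 - 1) mod W)"
  have m1: "m0 \<le> m1" "m1 \<le> u + p + W" "rough w m1"
    using gp[of "m0 - 1"] m0 pp(4) unfolding m1_def by auto
  have m1r: "\<not> rough w m" if "m0 \<le> m" "m < m1" for m
  proof -
    have "0 < m - (m0 - 1)" "m - (m0 - 1) < a 2 ((m0 - 1) mod W)" "m = (m0 - 1) + (m - (m0 - 1))"
      using that m0 pp(4) unfolding m1_def by auto
    then show ?thesis using gp(4)[of "m0 - 1"] by metis
  qed
  \<comment> \<open>Starting at \<open>m1\<close> misses nothing: rough cofactors between
    \<open>p\<close> and \<open>m1\<close> give products below the segment.\<close>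
  have st1: "struck p m1 q \<longleftrightarrow> struck p 0 q" if "u \<le> q" for q
  proof
    assume "struck p m1 q"
    then show "struck p 0 q" unfolding struck_def
    proof (elim disjE exE conjE)
      fix p' m' assume a: "prime p'" "w < p'" "p' \<le> m'" "rough w m'" "q = p' * m'" "p' = p" "m' < m1"
      have "m' < m0" using m1r[of m'] a by (meson not_le)
      then have "q < u" using m0u[of m'] a by simp
      then show "\<not> rough w q \<or> (\<exists>p' m'. prime p' \<and> w < p' \<and> p' \<le> m' \<and> rough w m' \<and> q = p' * m' \<and>
        (p' < p \<or> (p' = p \<and> m' < 0)))" using that by simp
    qed blast+
  qed (auto simp: struck_def)
  let ?I = "\<lambda>v' a' n'. p \<le> v' 26 \<and> u \<le> p * v' 26 \<and> v' 26 \<le> e + x + p + 1 \<and> rough w (v' 26) \<and>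
      (\<forall>i<v 19. a' 0 (v 22 + i) = of_bool (struck p (v' 26) (u + i))) \<and>
      (\<forall>q. q < v 22 \<or> v 22 + v 19 \<le> q \<longrightarrow> a' 0 q = a 0 q) \<and>
      n' + 60 * card (strikes u e p 0) \<le> n + 60 * card (strikes u e p (v' 26)) + 80"
  have i0: "?I (v(26 := m1)) a (n + t)" if "t \<le> 80" for t
    using m0 m1 m0u' b that pp(4) Wx st st1 strikes_mono[of p p 0 m1 u e]
    by (auto simp: e_def u_def p_def intro: order_trans[OF _ mult_le_mono2])
  have sm: "(u + p - 1) div p \<le> u + p" using div_le_dividend[of "u + p - 1" p] by linarith
  show "wp strike_com (\<lambda>v' a' n'. (\<forall>i<v 19. a' 0 (v 22 + i) = of_bool (struck (Suc (v 25)) 0 (v 21 + i))) \<and>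
      (\<forall>q. q < v 22 \<or> v 22 + v 19 \<le> q \<longrightarrow> a' 0 q = a 0 q) \<and>
      n' + 60 * card (strikes (v 21) (v 21 + v 19) (v 25) 0) \<le>
        n + 60 * card (strikes (v 21) (v 21 + v 19) (Suc (v 25)) 0) + 100) v a n"
  proof -
    have loop: "wp (WHILE Var 25 \<otimes> Var 26 < Var 21 \<oplus> Var 19 DO
       (0\<langle>Var 22 \<oplus> (Var 25 \<otimes> Var 26 \<ominus> Var 21)\<rangle> ::= Num 1 ;;
        26 ::= Var 26 \<oplus> Arr 2 (Var 26 \<odot> Var 6)))
       (\<lambda>v' a' n'. (\<forall>i<v 19. a' 0 (v 22 + i) = of_bool (struck (Suc (v 25)) 0 (v 21 + i))) \<and>
      (\<forall>q. q < v 22 \<or> v 22 + v 19 \<le> q \<longrightarrow> a' 0 q = a 0 q) \<and>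
      n' + 60 * card (strikes (v 21) (v 21 + v 19) (v 25) 0) \<le>
        n + 60 * card (strikes (v 21) (v 21 + v 19) (Suc (v 25)) 0) + 100) (v(26 := m1)) a n1"
      if n1: "n1 \<le> n + 80" for n1
    proof (rule wp_While[where I = ?I and f = "\<lambda>v' a'. e - p * v' 26"], goal_cases)
      case 1
      show ?case using i0[of 0] i0[of "n1 - n"] n1
        by (cases "n1 \<le> n") auto
    next
      case (2 v' a' n')
      then show ?case by simp
    next
      case (3 v' a' n')
      have fr: "\<forall>y. y \<noteq> 26 \<longrightarrow> v' y = v y" "\<forall>A. A \<noteq> 0 \<longrightarrow> a' A = a A"
        using 3(1) by (auto simp: frame_def)
      define m where "m = v' 26"
      have I: "p \<le> m" "u \<le> p * m" "m \<le> e + x + p + 1" "rough w m"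
        "\<forall>i<v 19. a' 0 (v 22 + i) = of_bool (struck p m (u + i))"
        "\<forall>q. q < v 22 \<or> v 22 + v 19 \<le> q \<longrightarrow> a' 0 q = a 0 q"
        "n' + 60 * card (strikes u e p 0) \<le> n + 60 * card (strikes u e p m) + 80"
        using 3(2) by (auto simp: m_def)
      have pm: "p * m < e" using 3(3) fr by (simp add: p_def e_def m_def)
      define g where "g = a 2 (m mod W)"
      have g: "0 < g" "g \<le> W" "rough w (m + g)" "\<forall>d. 0 < d \<and> d < g \<longrightarrow> \<not> rough w (m + d)"
        using gp[of m] by (auto simp: g_def)
      have mlt: "m < e" using pm pp(4) by (metis less_le_trans mult.commute mult_le_mono2 nat_mult_1 not_less Suc_leI One_nat_def leD le_less_trans)
      have idx: "p * m - u < v 19" using pm I(2) by (simp add: e_def u_def)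
      have ss: "struck p (m + g) q \<longleftrightarrow> struck p m q \<or> q = p * m" for q
        using struck_step[OF pp(1,2) I(1,4) g(1,4)] .
      have upd: "\<forall>i<v 19. ((a' 0)(v 22 + (p * m - u) := 1)) (v 22 + i) = of_bool (struck p (m + g) (u + i))"
        using I(2,5) by (auto simp: ss)
      have cs: "Suc (card (strikes u e p m)) \<le> card (strikes u e p (m + g))"
        using g by (intro strikes_insert[OF pp(1,3) I(4,2) pm]) auto
      have "p * m < p * (m + g)" using pp(4) g(1) by simp
      then have meas: "e - p * (m + g) < e - p * m" using pm by linarith
      have "m mod W < L" using WL W_pos by simp
      moreover have "m + g \<le> U" using mlt g(2) Wx b U_ge unfolding e_def by linarith
      moreover have "p * (m + g) = p * m + p * g" by (simp add: distrib_left)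
      ultimately show ?case
        using fr env b I idx upd cs meas g mlt Wx U_ge
        by (auto simp: wok_def sieve_env_def p_def[symmetric] u_def[symmetric] m_def[symmetric] g_def[symmetric])
    next
      case (4 v' a' n')
      have fr: "\<forall>y. y \<noteq> 26 \<longrightarrow> v' y = v y" "\<forall>A. A \<noteq> 0 \<longrightarrow> a' A = a A"
        using 4(1) by (auto simp: frame_def)
      have pm: "e \<le> p * v' 26" using 4(3) fr by (simp add: p_def e_def)
      \<comment> \<open>Cofactors from the current one on give products at or beyond the end
        \<open>e\<close>.\<close>
      have fin: "struck p (v' 26) q \<longleftrightarrow> struck (Suc p) 0 q" if "q < e" for q
      proof
        assume "struck (Suc p) 0 q"
        then show "struck p (v' 26) q" unfolding struck_def
        proof (elim disjE exE conjE)
          fix p' m' assume a: "prime p'" "w < p'" "p' \<le> m'" "rough w m'" "q = p' * m'" "p' < Suc p"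
          have "p' < p \<or> p' = p \<and> m' < v' 26"
          proof (rule ccontr)
            assume "\<not> ?thesis"
            then have "p' = p" "v' 26 \<le> m'" using a by auto
            then have "p * v' 26 \<le> q" using a by simp
            then show False using that pm by simp
          qed
          then show "\<not> rough w q \<or> (\<exists>p' m'. prime p' \<and> w < p' \<and> p' \<le> m' \<and> rough w m' \<and> q = p' * m' \<and>
            (p' < p \<or> (p' = p \<and> m' < v' 26)))" using a by blast
        qed auto
      qed (auto simp: struck_def less_Suc_eq)
      have "card (strikes u e p (v' 26)) \<le> card (strikes u e (Suc p) 0)" by (intro strikes_mono) simp
      then show ?case using 4(2) fin by (auto simp: p_def e_def u_def)
    qed
    have WLm: "(m0 - 1) mod W < L" using WL W_pos by simp
    have m1U: "m1 \<le> U" "u + p \<le> U" "m0 \<le> U" "p \<le> U" "(u + p - 1) div p \<le> U"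
      using m1 m0 sm Wx p_le b U_ge unfolding u_def by linarith+
    have v6: "v 6 = W" using env by (simp add: sieve_env_def)
    have init: "wp strike_init_com Q' v a n" if Q': "\<And>n1. n1 \<le> n + 80 \<Longrightarrow> Q' (v(26 := m1)) a n1" for Q'
    proof (cases "(u + p - 1) div p < p")
      case True
      then have m0p: "m0 = p" by (simp add: m0_def)
      have m1eq: "v 25 - Suc 0 + a 2 ((v 25 - Suc 0) mod W) = m1" by (simp add: m1_def m0p p_def)
      have lt: "(v 21 + v 25 - Suc 0) div v 25 < v 25" using True by (simp add: p_def u_def)
      have U': "(v 21 + v 25 - Suc 0) div v 25 \<le> U" "v 25 \<le> U" "v 25 - Suc 0 \<le> U"
        "(v 25 - Suc 0) mod W < L"
        using m1U WLm by (auto simp: p_def u_def m0p)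
      show ?thesis unfolding strike_init_com_def
        by (simp add: v6 m1eq lt U' m1U(1) Q')
    next
      case False
      let ?d = "(v 21 + v 25 - Suc 0) div v 25"
      have m0p: "m0 = ?d" using False by (simp add: m0_def p_def u_def)
      have m1eq: "?d - Suc 0 + a 2 ((?d - Suc 0) mod W) = m1" by (simp add: m1_def m0p)
      have lt: "\<not> ?d < v 25" using False by (simp add: p_def u_def)
      have U': "?d \<le> U" "?d - Suc 0 \<le> U" "(?d - Suc 0) mod W < L"
        using m1U WLm by (auto simp: p_def u_def m0p)
      show ?thesis unfolding strike_init_com_def
        by (simp add: v6 m1eq lt U' m1U(1) Q')
    qed
    show ?thesis unfolding strike_com_def wp_Seq by (rule init) (rule loop)
  qed
qed (use Q in blast)

definition refill_pre :: "(nat \<Rightarrow> nat) \<Rightarrow> (nat \<Rightarrow> nat \<Rightarrow> nat) \<Rightarrow> bool" where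
  "refill_pre v a \<longleftrightarrow> sieve_env v a \<and> (\<forall>q<T. a 0 q = of_bool (\<not> prime q)) \<and> T \<le> v 22 \<and> v 22 + v 19 \<le> L \<and>
     T \<le> v 21 \<and> v 21 + v 19 \<le> 514 * x + 1"

lemma rough_dvd: "rough w m \<Longrightarrow> d dvd m \<Longrightarrow> rough w d"
  unfolding rough_def by (meson dvd_trans)

text \<open>A composite rough \<open>q\<close> is struck by its least prime factor, which is above
  \<open>w\<close>, below \<open>p\<close> and at most its rough cofactor. Conversely
  \<open>q \<ge> T > w\<close>, so a divisor up to \<open>w\<close> is a proper one.\<close>

lemma struck_final:
  assumes "e \<le> p * p" "T \<le> q" "q < e"
  shows "struck p 0 q \<longleftrightarrow> \<not> prime q"
proof
  have wq: "w < q" "q > 1" using assms(2) T_gt W_le w_le c0_ge1 by linarith+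
  assume "struck p 0 q"
  then consider d where "d \<in> {2..w}" "d dvd q" | p' m' where "prime p'" "p' \<le> m'" "q = p' * m'"
    unfolding struck_def rough_def by blast
  then show "\<not> prime q"
  proof cases
    case 1
    then show ?thesis using wq by (auto simp: prime_nat_iff)
  next
    case 2
    then have "1 < p'" "1 < m'" using prime_ge_2_nat[of p'] by auto
    then show ?thesis using 2(3) prime_product by auto
  qed
next
  have q1: "q > 1" using assms(2) T_gt c0_ge1 by linarith
  assume np: "\<not> prime q"
  show "struck p 0 q"
  proof (cases "rough w q")
    case True
    define P where "P = (LEAST d. d > 1 \<and> d dvd q)"
    have P: "P > 1" "P dvd q" using LeastI[of "\<lambda>d. d > 1 \<and> d dvd q" q] q1 by (auto simp: P_def)
    have Pmin: "P \<le> d" if "d > 1" "d dvd q" for d unfolding P_def using that by (intro Least_le) auto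
    have prP: "prime P"
      unfolding prime_nat_iff
    proof (intro conjI allI impI)
      fix d assume "d dvd P"
      then have "d dvd q" using P(2) dvd_trans by blast
      have "d > 0" using \<open>d dvd P\<close> P(1) by (auto intro: Nat.gr0I)
      have "d \<le> P" using \<open>d dvd P\<close> P(1) by (auto intro: dvd_imp_le)
      then show "d = 1 \<or> d = P" using Pmin[of d] \<open>d > 0\<close> \<open>d dvd q\<close> by (cases "d = 1") auto
    qed (use P in auto)
    obtain m where m: "q = P * m" using P(2) by auto
    have m1: "m > 1" using m np prP q1 by (cases "m = 0"; cases "m = 1") auto
    have Pm: "P \<le> m" using Pmin[of m] m m1 by auto
    have "w < P"
    proof (rule ccontr)
      assume "\<not> w < P"
      then have "P \<in> {2..w}" using P(1) by auto
      then show False using True P(2) by (auto simp: rough_def)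
    qed
    moreover have "rough w m" using rough_dvd[OF True] m by auto
    moreover have "P < p"
    proof (rule ccontr)
      assume "\<not> P < p"
      then have "p * p \<le> P * m" using Pm by (intro mult_le_mono) auto
      then show False using assms m by linarith
    qed
    ultimately show ?thesis unfolding struck_def using prP Pm m by blast
  qed (auto simp: struck_def)
qed

text \<open>Guarantees that the shared table contains all primes needed for sieving up to
  \<open>514 * x + 1\<close>.\<close>

lemma T_sq: "514 * x + 1 \<le> T * T"
proof -
  have "c0 * c0 * c0 \<le> c0 * c0 * (c0 * c0)" using c0_ge1 by simp
  then have "x \<le> c0 * c0 * (c0 * c0)" using x_le_c0 by linarith
  moreover have "T * T = 262144 * (c0 * c0 * (c0 * c0)) + 1024 * (c0 * c0) + 1"
    by (simp add: T_def algebra_simps)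
  ultimately show ?thesis by linarith
qed

text \<open>\<open>B\<close> bounds the square root of the end of the block and hence the number of
  candidates looked up in the table.\<close>

lemma refill_spec:
  assumes pre: "refill_pre v a" and B: "v 21 + v 19 \<le> B * B"
    and Q: "\<And>v' a' n'. frame refill_com v a v' a' \<Longrightarrow>
      (\<forall>i<v 19. a' 0 (v 22 + i) = of_bool (\<not> prime (v 21 + i))) \<Longrightarrow>
      (\<forall>q. q < v 22 \<or> v 22 + v 19 \<le> q \<longrightarrow> a' 0 q = a 0 q) \<Longrightarrow>
      n' \<le> n + 40 * v 19 + 200 * B + 60 * card (strikes (v 21) (v 21 + v 19) (v 21 + v 19) 0) + 200 \<Longrightarrow> Q v' a' n'"
  shows "wp refill_com Q v a n"
proof (rule wp_frame)
  define u e where "u = v 21" and "e = v 21 + v 19"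
  let ?I = "\<lambda>v' a' n'. w < v' 25 \<and> v' 25 \<le> B + w + 1 \<and>
      (\<forall>i<v 19. a' 0 (v 22 + i) = of_bool (struck (v' 25) 0 (u + i))) \<and>
      (\<forall>q. q < v 22 \<or> v 22 + v 19 \<le> q \<longrightarrow> a' 0 q = a 0 q) \<and>
      n' \<le> n + 40 * v 19 + 60 + 200 * (v' 25 - (w + 1)) + 60 * card (strikes u e (v' 25) 0)"
  have env: "sieve_env v a" and tab: "\<forall>q<T. a 0 q = of_bool (\<not> prime q)" and b: "T \<le> v 22" "v 22 + v 19 \<le> L"
    "T \<le> u" "e \<le> 514 * x + 1" using pre by (auto simp: refill_pre_def u_def e_def)
  have v5: "v 5 = w" using env by (simp add: sieve_env_def)
  have wx: "w \<le> x" using w_le W_le c0_le by simp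
  have s0: "struck (Suc w) 0 q \<longleftrightarrow> \<not> rough w q" for q unfolding struck_def by auto
  have u0: "u > 0" using b(3) T_gt by linarith
  have "wp refill_com (\<lambda>v' a' n'. (\<forall>i<v 19. a' 0 (v 22 + i) = of_bool (\<not> prime (v 21 + i))) \<and>
      (\<forall>q. q < v 22 \<or> v 22 + v 19 \<le> q \<longrightarrow> a' 0 q = a 0 q) \<and>
      n' \<le> n + 40 * v 19 + 200 * B + 60 * card (strikes (v 21) (v 21 + v 19) (v 21 + v 19) 0) + 200) v a n"
    unfolding refill_com_def wp_Seq
  proof (rule fill_spec[OF env b(2) b(4)[unfolded e_def]], goal_cases)
    case (1 v1 a1 n1)
    have fr1: "\<forall>y. y \<noteq> 23 \<longrightarrow> v1 y = v y" "\<forall>A. A \<noteq> 0 \<longrightarrow> a1 A = a A"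
      using 1(1) by (auto simp: frame_def fill_com_def)
    have "wp (WHILE Var 25 \<otimes> Var 25 < Var 21 \<oplus> Var 19 DO
       (IF Arr 0 (Var 25) < Num 1 THEN strike_com ELSE Skip ;;
        25 ::= Var 25 \<oplus> Num 1))
      (\<lambda>v' a' n'. (\<forall>i<v 19. a' 0 (v 22 + i) = of_bool (\<not> prime (v 21 + i))) \<and>
      (\<forall>q. q < v 22 \<or> v 22 + v 19 \<le> q \<longrightarrow> a' 0 q = a 0 q) \<and>
      n' \<le> n + 40 * v 19 + 200 * B + 60 * card (strikes (v 21) (v 21 + v 19) (v 21 + v 19) 0) + 200)
      (v1(25 := Suc w)) a1 (6 + n1)"
    proof (rule wp_While[where I = ?I and f = "\<lambda>v' a'. e - v' 25"], goal_cases)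
      case 1
      then show ?case using \<open>n1 \<le> _\<close> \<open>\<forall>i<v 19. a1 0 _ = _\<close> \<open>\<forall>q. _ \<longrightarrow> a1 0 q = a 0 q\<close>
        by (simp add: s0 u_def)
    next
      case (2 v' a' n')
      have fr: "\<forall>y. y \<notin> {23, 25, 26} \<longrightarrow> v' y = v y" "\<forall>A. A \<noteq> 0 \<longrightarrow> a' A = a A"
        using 2(1) fr1 by (auto simp: frame_def strike_com_def strike_init_com_def)
      show ?case by simp
    next
      case (3 v' a' n')
      have fr: "\<forall>y. y \<notin> {23, 25, 26} \<longrightarrow> v' y = v y" "\<forall>A. A \<noteq> 0 \<longrightarrow> a' A = a A"
        using 3(1) fr1 by (auto simp: frame_def strike_com_def strike_init_com_def)
      define p where "p = v' 25"
      have I: "w < p" "p \<le> B + w + 1" "\<forall>i<v 19. a' 0 (v 22 + i) = of_bool (struck p 0 (u + i))"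
        "\<forall>q. q < v 22 \<or> v 22 + v 19 \<le> q \<longrightarrow> a' 0 q = a 0 q"
        "n' \<le> n + 40 * v 19 + 60 + 200 * (p - (w + 1)) + 60 * card (strikes u e p 0)"
        using 3(2) by (auto simp: p_def)
      have pe: "p * p < e" using 3(3) fr by (simp add: p_def e_def)
      have pT: "p < T"
      proof (rule ccontr)
        assume "\<not> p < T"
        then have "T * T \<le> p * p" by (intro mult_le_mono) auto
        then show False using pe b(4) T_sq by linarith
      qed
      have pB: "p < B"
      proof (rule ccontr)
        assume "\<not> p < B"
        then have "B * B \<le> p * p" by (intro mult_le_mono) auto
        then show False using pe B by (simp add: e_def)
      qed
      have ple: "p < e" using pe le_square[of p] by linarith
      have pL: "p < L" using pT b(1,2) by linarith
      have tp: "a' 0 p = of_bool (\<not> prime p)" using I(4) tab pT b(1) by simp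
      have SpU: "Suc p \<le> U" using ple b(4) U_ge by linarith
      have cs: "card (strikes u e p 0) \<le> card (strikes u e (Suc p) 0)" by (intro strikes_mono) simp
      have dif: "Suc p - (w + 1) = Suc (p - (w + 1))" using I(1) by simp
      show ?case
      proof (cases "prime p")
        case True
        have e1: "sieve_env v' a'" using env fr by (simp add: sieve_env_def)
        have hyp: "v' 22 + v' 19 \<le> L" "v' 21 + v' 19 \<le> 514 * x + 1" "prime (v' 25)" "w < v' 25"
           "v' 25 * v' 25 < v' 21 + v' 19" "0 < v' 21"
           "\<forall>i<v' 19. a' 0 (v' 22 + i) = of_bool (struck (v' 25) 0 (v' 21 + i))"
          using fr b I pe True u0 by (auto simp: p_def[symmetric] u_def e_def)
        have IFT: "wp (IF Arr 0 (Var 25) < Num 1 THEN strike_com ELSE Skip) Q2 v' a' m3"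
          if "\<And>n3. n3 \<le> m3 + 9 \<Longrightarrow> wp strike_com Q2 v' a' n3" for Q2 m3
          using that[of "9 + m3"] tp pL True by (simp add: p_def)
        show ?thesis unfolding wp_Seq
        proof (rule IFT, rule strike_spec[OF e1 hyp], goal_cases)
          case (1 n3 v2 a2 n2)
          have f2: "v2 25 = p" using 1(2) by (simp add: frame_def strike_com_def strike_init_com_def p_def)
          have "n2 + 60 * card (strikes u e p 0) \<le> n' + 30 + 60 * card (strikes u e (Suc p) 0) + 100"
            using 1(1,5) fr by (simp add: u_def e_def p_def)
          moreover have "\<forall>i<v 19. a2 0 (v 22 + i) = of_bool (struck (Suc p) 0 (u + i))"
            using 1(3) fr by (simp add: u_def p_def)
          moreover have "\<forall>q. q < v 22 \<or> v 22 + v 19 \<le> q \<longrightarrow> a2 0 q = a 0 q"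
            using 1(4) fr I(4) by simp
          ultimately show ?case using f2 I(1,2,5) pB SpU ple dif
            by (simp add: p_def[symmetric])
        qed
      next
        case False
        have sk: "struck (Suc p) 0 q \<longleftrightarrow> struck p 0 q" for q
          using False unfolding struck_def by (auto simp: less_Suc_eq)
        show ?thesis using fr tp pL SpU I cs pB ple dif False
          by (simp add: p_def[symmetric] sk)
      qed
    next
      case (4 v' a' n')
      have fr: "\<forall>y. y \<notin> {23, 25, 26} \<longrightarrow> v' y = v y" "\<forall>A. A \<noteq> 0 \<longrightarrow> a' A = a A"
        using 4(1) fr1 by (auto simp: frame_def strike_com_def strike_init_com_def)
      define p where "p = v' 25"
      have I: "w < p" "p \<le> B + w + 1" "\<forall>i<v 19. a' 0 (v 22 + i) = of_bool (struck p 0 (u + i))"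
        "\<forall>q. q < v 22 \<or> v 22 + v 19 \<le> q \<longrightarrow> a' 0 q = a 0 q"
        "n' \<le> n + 40 * v 19 + 60 + 200 * (p - (w + 1)) + 60 * card (strikes u e p 0)"
        using 4(2) by (auto simp: p_def)
      have pe: "e \<le> p * p" using 4(3) fr by (simp add: p_def e_def)
      have "p - (w + 1) \<le> B" using I(2) by simp
      moreover have "card (strikes u e p 0) \<le> card (strikes u e e 0)"
      proof (intro card_mono finite_strikes subsetI)
        fix z assume z: "z \<in> strikes u e p 0"
        then obtain p' m' where "z = (p', m')" "prime p'" "p' * p' < e" by (auto simp: strikes_def)
        moreover from this have "p' < e" using le_square[of p'] by linarith
        ultimately show "z \<in> strikes u e e 0" using z by (auto simp: strikes_def)
      qed
      moreover have "\<forall>i<v 19. a' 0 (v 22 + i) = of_bool (\<not> prime (u + i))"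
        using I(3) struck_final[OF pe] b(3) by (simp add: e_def u_def)
      ultimately show ?case using I(4,5) by (simp add: u_def e_def)
    qed
    note loop = this
    have assign: "wp (25 ::= Var 5 \<oplus> Num 1) Q2 v1 a1 n1" if "Q2 (v1(25 := Suc w)) a1 (6 + n1)" for Q2
      using that fr1 v5 wx U_ge by simp
    show ?case by (rule assign) (rule loop)
  qed
  then show "wp refill_com (\<lambda>v' a' n'. (\<forall>i<v 19. a' 0 (v 22 + i) = of_bool (\<not> prime (v 21 + i))) \<and>
      (\<forall>q. q < v 22 \<or> v 22 + v 19 \<le> q \<longrightarrow> a' 0 q = a 0 q) \<and>
      n' \<le> n + 40 * v 19 + 200 * B + 60 * card (strikes (v 21) (v 21 + v 19) (v 21 + v 19) 0) + 200) v a n" .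
qed (use Q in blast)

end

section \<open>Windows of consecutive primes\<close>

definition win :: "nat \<Rightarrow> nat \<Rightarrow> nat set" where
  "win a b = {p. prime p \<and> a \<le> p \<and> p < b}"

lemma finite_win [simp]: "finite (win a b)"
  unfolding win_def by (rule finite_subset[of _ "{..b}"]) auto

lemma win_Suc_right: "win a (Suc b) = (if prime b \<and> a \<le> b then insert b (win a b) else win a b)"
  by (auto simp: win_def less_Suc_eq)

lemma win_Suc_left: "win (Suc a) b = win a b - {a}"
  by (auto simp: win_def)

lemma win_self [simp]: "win a a = {}"
  by (auto simp: win_def)

lemma consecutive_primes_win: "win a b \<noteq> {} \<Longrightarrow> consecutive_primes (win a b)"
  unfolding consecutive_primes_def
  by (intro conjI exI[of _ a] exI[of _ "b - 1"]) (auto simp: win_def)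

lemma consecutive_primesD:
  assumes "consecutive_primes S"
  shows "finite S" "S \<noteq> {}" "S = win (Min S) (Suc (Max S))" "prime (Min S)" "Min S \<in> S" "Max S \<in> S"
proof -
  from assms obtain a b where S: "S = {p. prime p \<and> a \<le> p \<and> p \<le> b}" "S \<noteq> {}"
    unfolding consecutive_primes_def by auto
  show fin: "finite S" unfolding S by (rule finite_subset[of _ "{..b}"]) auto
  show "S \<noteq> {}" by fact
  show mm: "Min S \<in> S" "Max S \<in> S" using fin S(2) by auto
  then show "prime (Min S)" using S(1) by auto
  have le: "p \<in> S \<Longrightarrow> Min S \<le> p \<and> p \<le> Max S" for p using fin by auto
  have "a \<le> Min S" "Max S \<le> b" using mm S(1) by auto
  then show "S = win (Min S) (Suc (Max S))"
    unfolding win_def using le S(1) by (auto simp: less_Suc_eq_le)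
qed

lemma consecutive_primes_memD:
  assumes "consecutive_primes S" "p \<in> S"
  shows "prime p" "Min S \<le> p" "p \<le> Max S"
  using assms consecutive_primesD(1)[OF assms(1)] by (auto simp: consecutive_primes_def)

text \<open>Both sets have equally many elements outside the other; those of the window lie below
  \<open>b\<close>, those of \<open>S\<close> are primes from \<open>a\<close> on outside the window
  and hence at least \<open>b\<close>.\<close>

lemma win_sum_less:
  assumes S: "finite S" "S \<subseteq> {p. a \<le> p \<and> prime p}" "card S = card (win a b)" "S \<noteq> win a b"
  shows "\<Sum>(win a b) < \<Sum>S"
proof -
  let ?A = "win a b"
  have cd: "card (?A - S) = card (S - ?A)"
    using S by (simp add: card_Diff_subset_Int Int_commute)
  have ne: "S - ?A \<noteq> {}"
  proof
    assume "S - ?A = {}"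
    then have "S \<subseteq> ?A" by auto
    then have "S = ?A" using S by (intro card_subset_eq) auto
    then show False using S by simp
  qed
  then have pos: "card (S - ?A) > 0" using S by (simp add: card_gt_0_iff)
  have ne': "?A - S \<noteq> {}" using cd pos by (metis card.empty less_numeral_extra(3))
  have "\<Sum>(?A - S) < (\<Sum>p\<in>?A - S. b)"
    using ne' by (intro sum_strict_mono) (auto simp: win_def)
  also have "\<dots> = card (S - ?A) * b" using cd by simp
  also have "\<dots> = (\<Sum>p\<in>S - ?A. b)" by simp
  also have "\<dots> \<le> \<Sum>(S - ?A)"
    using S(2) by (intro sum_mono) (auto simp: win_def)
  finally have "\<Sum>(?A - S) < \<Sum>(S - ?A)" .
  moreover have "\<Sum>?A = \<Sum>(?A - S) + \<Sum>(?A \<inter> S)"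
    by (metis Int_commute finite_win sum.Int_Diff add.commute)
  moreover have "\<Sum>S = \<Sum>(S - ?A) + \<Sum>(?A \<inter> S)"
    using S(1) by (metis Int_commute sum.Int_Diff add.commute)
  ultimately show ?thesis by simp
qed

text \<open>For fixed length the sum grows strictly with the least prime. Hence a number has at most
  one representation of each length.\<close>

lemma consecutive_primes_eqI:
  assumes "consecutive_primes S" "consecutive_primes S'" "card S = card S'" "\<Sum>S = \<Sum>S'"
  shows "S = S'"
proof -
  have less: "\<Sum>A < \<Sum>B" if "consecutive_primes A" "consecutive_primes B" "card A = card B"
    "Min A \<le> Min B" "A \<noteq> B" for A B
  proof -
    note A = consecutive_primesD[OF that(1)] and B = consecutive_primesD[OF that(2)]
    have "\<Sum>(win (Min A) (Suc (Max A))) < \<Sum>B"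
    proof (rule win_sum_less)
      show "B \<subseteq> {p. Min A \<le> p \<and> prime p}"
      proof
        fix p assume "p \<in> B"
        then have "Min B \<le> p" "prime p" using consecutive_primes_memD[OF that(2)] by auto
        then show "p \<in> {p. Min A \<le> p \<and> prime p}" using that(4) by simp
      qed
    qed (use that A(3)[symmetric] B(1) in auto)
    then show ?thesis using A(3)[symmetric] by simp
  qed
  show ?thesis
    using less[of S S'] less[of S' S] assms by (metis less_irrefl nat_le_linear)
qed

text \<open>If they differed, both would be windows starting at \<open>a\<close> with equal
  cardinality, and \<open>win_sum_less\<close> would make each sum smaller than the other.\<close>

lemma win_eq_of_Min:
  assumes "consecutive_primes S" "Min S = a" "card S = card (win a b)"
  shows "S = win a b"
proof (rule ccontr)
  assume ne: "S \<noteq> win a b"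
  note S = consecutive_primesD[OF assms(1)]
  have sub: "S \<subseteq> {p. a \<le> p \<and> prime p}" using consecutive_primes_memD[OF assms(1)] assms(2) by auto
  have Se: "win a (Suc (Max S)) = S" using S(3) assms(2) by simp
  have 1: "\<Sum>(win a b) < \<Sum>S" using win_sum_less[OF S(1) sub assms(3) ne] .
  have "\<Sum>(win a (Suc (Max S))) < \<Sum>(win a b)"
  proof (rule win_sum_less)
    show "win a b \<subseteq> {p. a \<le> p \<and> prime p}" by (auto simp: win_def)
  qed (use Se assms(3) ne in auto)
  then show False using 1 Se by simp
qed

text \<open>\<open>P k\<close> is the position of the lower end of window \<open>k\<close>; a run is
  counted when that end passes its least prime.\<close>

definition recorded :: "(nat \<Rightarrow> nat) \<Rightarrow> nat \<Rightarrow> nat set set" where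
  "recorded P n = {S. consecutive_primes S \<and> \<Sum>S = n \<and> Min S < P (card S)}"

lemma finite_reps: "finite {S. consecutive_primes S \<and> \<Sum>S = n}"
proof (rule finite_subset)
  show "{S. consecutive_primes S \<and> \<Sum>S = n} \<subseteq> Pow {..n}"
  proof clarify
    fix S p assume S: "consecutive_primes S" "p \<in> S"
    then show "p \<le> \<Sum>S" using consecutive_primesD(1)[OF S(1)] by (intro member_le_sum) auto
  qed
qed simp

lemma finite_recorded [simp]: "finite (recorded P n)"
  unfolding recorded_def by (rule finite_subset[OF _ finite_reps[of n]]) auto

text \<open>By \<open>consecutive_primes_eqI\<close> a run with sum \<open>n\<close> is determined
  by its length.\<close>

lemma card_recorded_le:
  assumes "\<And>k. k > r \<Longrightarrow> P k = 0"
  shows "card (recorded P n) \<le> r"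
proof -
  have "card (recorded P n) = card (card ` recorded P n)"
    by (rule card_image[symmetric]) (auto simp: inj_on_def recorded_def dest: consecutive_primes_eqI)
  also have "\<dots> \<le> card {1..r}"
  proof (intro card_mono subsetI)
    fix k assume "k \<in> card ` recorded P n"
    then obtain S where S: "consecutive_primes S" "Min S < P k" "k = card S" by (auto simp: recorded_def)
    then have "k \<le> r" using assms[of k] by (cases "k \<le> r") auto
    moreover have "k > 0" using consecutive_primesD(1,2)[OF S(1)] S(3) by (simp add: card_gt_0_iff)
    ultimately show "k \<in> {1..r}" by auto
  qed simp
  finally show ?thesis by simp
qed

text \<open>By \<open>win_eq_of_Min\<close> the current window is the only run of length
  \<open>k\<close> starting at \<open>a\<close>, so passing \<open>a\<close> records just this
  one.\<close>

lemma recorded_prime: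
  assumes "prime a" "card (win a b) = k" "win a b \<noteq> {}" "a < b"
  shows "recorded (P(k := Suc a)) n =
    (if n = \<Sum>(win a b) then insert (win a b) (recorded (P(k := a)) n) else recorded (P(k := a)) n)"
    and "win a b \<notin> recorded (P(k := a)) n" and "Min (win a b) = a"
proof -
  show m: "Min (win a b) = a"
    using assms by (intro Min_eqI) (auto simp: win_def)
  have c: "consecutive_primes (win a b)" using assms by (intro consecutive_primes_win)
  have eq: "S = win a b" if "consecutive_primes S" "card S = k" "Min S = a" for S
    using that assms by (intro win_eq_of_Min) auto
  show "win a b \<notin> recorded (P(k := a)) n" using m assms by (simp add: recorded_def)
  have r1: "recorded (P(k := Suc a)) n = recorded (P(k := a)) n \<union>
      {S. consecutive_primes S \<and> \<Sum>S = n \<and> card S = k \<and> Min S = a}"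
    by (auto simp: recorded_def less_Suc_eq)
  have r2: "{S. consecutive_primes S \<and> \<Sum>S = n \<and> card S = k \<and> Min S = a} =
      (if n = \<Sum>(win a b) then {win a b} else {})"
  proof -
    have "consecutive_primes S \<and> \<Sum>S = n \<and> card S = k \<and> Min S = a \<longleftrightarrow> S = win a b \<and> n = \<Sum>(win a b)" for S
    proof
      assume S: "consecutive_primes S \<and> \<Sum>S = n \<and> card S = k \<and> Min S = a"
      then have "S = win a b" using eq by blast
      then show "S = win a b \<and> n = \<Sum>(win a b)" using S by blast
    next
      assume "S = win a b \<and> n = \<Sum>(win a b)"
      then show "consecutive_primes S \<and> \<Sum>S = n \<and> card S = k \<and> Min S = a" using c m assms(2) by blast
    qed
    then show ?thesis by auto
  qed
  show "recorded (P(k := Suc a)) n =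
    (if n = \<Sum>(win a b) then insert (win a b) (recorded (P(k := a)) n) else recorded (P(k := a)) n)"
    unfolding r1 r2 by simp
qed

lemma recorded_not_prime: "\<not> prime a \<Longrightarrow> recorded (P(k := Suc a)) n = recorded (P(k := a)) n"
  unfolding recorded_def using consecutive_primesD(4) by (auto simp: less_Suc_eq)

text \<open>Allows a full window to pause: once its sum is beyond the segment, so is that of every
  later run of its length.\<close>

lemma win_sum_le_of_card:
  assumes "consecutive_primes S" "a \<le> Min S" "card S = card (win a b)"
  shows "\<Sum>(win a b) \<le> \<Sum>S"
proof (cases "S = win a b")
  case False
  note S = consecutive_primesD[OF assms(1)]
  have "S \<subseteq> {p. a \<le> p \<and> prime p}"
    using consecutive_primes_memD[OF assms(1)] assms(2) by (auto intro: order_trans)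
  then show ?thesis using win_sum_less[OF S(1) _ assms(3) False] by simp
qed simp

text \<open>Allows a window to stop for good: if it is still short of primes at \<open>b\<close>,
  later runs of its length must reach \<open>b\<close>.\<close>

lemma Max_ge_of_card:
  assumes "consecutive_primes S" "a \<le> Min S" "card (win a b) < card S"
  shows "b \<le> Max S"
proof (rule ccontr)
  assume "\<not> b \<le> Max S"
  note S = consecutive_primesD[OF assms(1)]
  have "S \<subseteq> win a b"
  proof
    fix p assume "p \<in> S"
    note consecutive_primes_memD[OF assms(1) this]
    then show "p \<in> win a b" using assms(2) \<open>\<not> b \<le> Max S\<close> by (auto simp: win_def)
  qed
  then show False using assms(3) card_mono[of "win a b" S] by simp
qed

section \<open>Streams of primes\<close>

definition ensure_com :: "nat \<Rightarrow> nat \<Rightarrow> nat \<Rightarrow> exp \<Rightarrow> com" where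
  "ensure_com q e t b = (IF Var q < Var e THEN Skip ELSE
     (21 ::= Var e ;; 22 ::= b ;; refill_com ;; e ::= Var e \<oplus> Var 19 ;; t ::= Var 22 \<oplus> Var 19))"

context puzzle
begin

text \<open>With \<open>e = t = T\<close> the index \<open>t - (e - q)\<close> is \<open>q\<close>
  itself and the stream reads the shared table; after a refill it reads the private buffer at
  \<open>b\<close>. The clause \<open>e \<le> q + ell k\<close> keeps the index inside that
  buffer.\<close>

definition head :: "(nat \<Rightarrow> nat) \<Rightarrow> nat \<Rightarrow> nat \<Rightarrow> nat \<Rightarrow> nat \<Rightarrow> nat \<Rightarrow> bool" where
  "head bt k b q e t \<longleftrightarrow> q \<le> e \<and>
    (e = T \<and> t = T \<or> k < c0 \<and> T < e \<and> t = b + ell k \<and> e \<le> q + ell k \<and> e \<le> lim k + ell k) \<and>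
    (\<forall>q'. q \<le> q' \<and> q' < e \<longrightarrow> bt (t - (e - q')) = of_bool (\<not> prime q'))"

definition table :: "(nat \<Rightarrow> nat) \<Rightarrow> bool" where
  "table bt \<longleftrightarrow> (\<forall>q<T. bt q = of_bool (\<not> prime q))"

text \<open>Collects the strike-outs of all refills of a stream. The common bound on
  \<open>p * p\<close> makes the disjoint contributions of the blocks fit into one set.\<close>

definition SK :: "nat \<Rightarrow> nat \<Rightarrow> (nat \<times> nat) set" where
  "SK k e = {(p, m). prime p \<and> p * p < lim k + ell k \<and> rough w m \<and> T \<le> p * m \<and> p * m < e}"

text \<open>Potential that pays for the refills of a stream up to \<open>e\<close>.\<close>

definition rc :: "nat \<Rightarrow> nat \<Rightarrow> nat" where
  "rc k e = 5000 * (e - T) + 60 * card (SK k e)"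

lemma lim_le: "lim k \<le> 512 * x + 1"
  unfolding lim_def by simp

lemma lim_le_T: "c0 \<le> k \<Longrightarrow> lim k \<le> T"
proof -
  assume "c0 \<le> k"
  have "512 * x \<le> 512 * (c0 * c0) * k"
  proof -
    have "512 * x \<le> 512 * (c0 * c0 * c0)" using x_le_c0 by simp
    also have "\<dots> \<le> 512 * (c0 * c0 * k)" using \<open>c0 \<le> k\<close> by (intro mult_le_mono2)
    finally show ?thesis by (simp add: mult.assoc)
  qed
  then have "512 * x div k \<le> 512 * (c0 * c0)"
    using \<open>c0 \<le> k\<close> c0_ge1 by (metis div_le_mono div_mult_self_is_m less_le_trans zero_less_one)
  then show ?thesis by (simp add: lim_def T_def mult.assoc)
qed

lemma lim_le_ell: "k \<ge> 1 \<Longrightarrow> lim k \<le> 512 * (ell k * ell k) + 1"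
proof -
  assume k: "k \<ge> 1"
  have "512 * x \<le> 512 * (ell k * ell k) * k" using ell_ge[OF k] by (simp add: mult.assoc)
  then have "512 * x div k \<le> 512 * (ell k * ell k)"
    using k by (metis div_le_mono div_mult_self_is_m less_le_trans zero_less_one)
  then show ?thesis by (simp add: lim_def)
qed

lemma finite_SK [simp]: "finite (SK k e)"
proof (rule finite_subset)
  show "SK k e \<subseteq> {..e} \<times> {..e}"
  proof (clarsimp simp: SK_def)
    fix p m assume a: "prime p" "T \<le> p * m" "p * m < e"
    have "m > 0" using a(2) T_gt by (cases m) auto
    then have "p \<le> p * m" "m \<le> p * m" using prime_ge_1_nat[OF a(1)] by auto
    then show "p \<le> e \<and> m \<le> e" using a by linarith
  qed
qed simp

lemma rc_mono: "e \<le> e' \<Longrightarrow> rc k e \<le> rc k e'"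
proof -
  assume "e \<le> e'"
  then have "card (SK k e) \<le> card (SK k e')" by (intro card_mono finite_SK) (auto simp: SK_def)
  then show ?thesis using \<open>e \<le> e'\<close> unfolding rc_def by (intro add_mono mult_le_mono2) auto
qed

text \<open>The products struck in the new block are disjoint from the earlier ones, and 5000 per
  number covers 40 + 200 * 23 + 200 because \<open>ell k \<ge> 1\<close>.\<close>

lemma rc_refill:
  assumes "T \<le> u" "u \<le> lim k" "k \<ge> 1"
  shows "40 * ell k + 200 * (23 * ell k) + 60 * card (strikes u (u + ell k) (u + ell k) 0) + 200 + rc k u
    \<le> rc k (u + ell k)"
proof -
  have "SK k u \<inter> strikes u (u + ell k) (u + ell k) 0 = {}" by (auto simp: SK_def strikes_def)
  then have "card (SK k u) + card (strikes u (u + ell k) (u + ell k) 0) =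
      card (SK k u \<union> strikes u (u + ell k) (u + ell k) 0)" by (simp add: card_Un_disjoint)
  also have "\<dots> \<le> card (SK k (u + ell k))"
    using assms by (intro card_mono finite_SK) (auto simp: SK_def strikes_def)
  finally show ?thesis using ell_ge1[OF assms(3)] assms(1) unfolding rc_def by simp
qed

lemma ensure_spec:
  assumes vars: "distinct [q, e, t]" "\<forall>y\<in>{q, e, t}. y \<notin> {5, 6, 19, 20, 21, 22, 23, 25, 26}"
    and env: "sieve_env v a" and tab: "table (a 0)"
    and k: "k \<ge> 1" "k < c0 \<longrightarrow> v 19 = ell k"
    and h: "head (a 0) k b (v q) (v e) (v t)" and ql: "v q < lim k"
    and b: "\<And>y. k < c0 \<Longrightarrow> eok bx (v(21 := y)) a \<and> eval bx (v(21 := y)) a = b"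
      "k < c0 \<Longrightarrow> T \<le> b" "k < c0 \<Longrightarrow> b + ell k \<le> L" "ecost bx \<le> 10"
    and Q: "\<And>v' a' n'. frame (ensure_com q e t bx) v a v' a' \<Longrightarrow>
      head (a' 0) k b (v q) (v' e) (v' t) \<Longrightarrow> v q < v' e \<Longrightarrow> table (a' 0) \<Longrightarrow>
      (\<forall>j. j < b \<or> b + ell k \<le> j \<or> c0 \<le> k \<longrightarrow> a' 0 j = a 0 j) \<Longrightarrow>
      n' + rc k (v e) \<le> n + rc k (v' e) + 60 \<Longrightarrow> Q v' a' n'"
  shows "wp (ensure_com q e t bx) Q v a n"
proof (rule wp_frame)
  show "wp (ensure_com q e t bx) (\<lambda>v' a' n'. head (a' 0) k b (v q) (v' e) (v' t) \<and> v q < v' e \<and> table (a' 0) \<and>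
      (\<forall>j. j < b \<or> b + ell k \<le> j \<or> c0 \<le> k \<longrightarrow> a' 0 j = a 0 j) \<and>
      n' + rc k (v e) \<le> n + rc k (v' e) + 60) v a n"
  proof (cases "v q < v e")
    case True
    then show ?thesis unfolding ensure_com_def using h tab by simp
  next
    case False
    then have qe: "v q = v e" using h by (simp add: head_def)
    \<comment> \<open>For \<open>k \<ge> c0\<close> the table reaches up to \<open>lim k\<close>, so
      such a stream never runs dry.\<close>
    have kc: "k < c0" using h ql qe lim_le_T[of k] by (cases "k < c0") (auto simp: head_def)
    have l: "v 19 = ell k" using k kc by simp
    have ue: "T \<le> v e" using h by (auto simp: head_def)
    let ?v2 = "v(21 := v e, 22 := b)"
    have eu: "v e + ell k \<le> 513 * x" using ql qe lim_le[of k] ell_le[OF k(1)] by linarith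
    have pre: "refill_pre ?v2 a"
      using env tab b kc ue eu l by (auto simp: refill_pre_def sieve_env_def table_def)
    have "ell k \<le> ell k * ell k" using ell_ge1[OF k(1)] by simp
    \<comment> \<open>The true bound 513 * (ell k)^2 + 1 is rounded up to the square 529 = 23^2, so
      that \<open>23 * ell k\<close> bounds the sieving primes.\<close>
    then have "v e + ell k \<le> 529 * (ell k * ell k)" using ql qe lim_le_ell[OF k(1)] by linarith
    then have BB: "?v2 21 + ?v2 19 \<le> (23 * ell k) * (23 * ell k)" using l by simp
    have el: "v e \<le> lim k" using ql qe by simp
    have fin: "wp refill_com (\<lambda>v' a' n'. wp (e ::= Var e \<oplus> Var 19 ;; t ::= Var 22 \<oplus> Var 19)
       (\<lambda>v' a' n'. head (a' 0) k b (v q) (v' e) (v' t) \<and> v q < v' e \<and> table (a' 0) \<and>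
      (\<forall>j. j < b \<or> b + ell k \<le> j \<or> c0 \<le> k \<longrightarrow> a' 0 j = a 0 j) \<and>
      Suc n' + rc k (v e) \<le> n + rc k (v' e) + 60) v' a' n') ?v2 a n2" if n2: "n2 \<le> n + 30" for n2
    proof (rule refill_spec[OF pre BB], goal_cases)
      case (1 v3 a3 n3)
      have f: "\<forall>y. y \<notin> {23, 25, 26} \<longrightarrow> v3 y = ?v2 y"
        using 1(1) by (auto simp: frame_def refill_com_def fill_com_def strike_com_def strike_init_com_def)
      have fe: "v3 e = v e" "v3 22 = b" "v3 19 = ell k" using f vars l by auto
      have fe': "e \<noteq> t" "e \<noteq> 22" "e \<noteq> 19" "e \<noteq> 21" "t \<noteq> 22" "q \<noteq> e" using vars by auto
      have bits: "\<forall>i<ell k. a3 0 (b + i) = of_bool (\<not> prime (v e + i))"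
        using 1(2) l by simp
      have out: "\<forall>j. j < b \<or> b + ell k \<le> j \<longrightarrow> a3 0 j = a 0 j" using 1(3) l by simp
      have hd: "head (a3 0) k b (v q) (v e + ell k) (b + ell k)"
        unfolding head_def
      proof (intro conjI allI impI)
        fix q' assume q': "v q \<le> q' \<and> q' < v e + ell k"
        define i where "i = q' - v e"
        have i: "q' = v e + i" "i < ell k" using q' qe by (auto simp: i_def)
        have "b + ell k - (v e + ell k - q') = b + i" using i by simp
        then show "a3 0 (b + ell k - (v e + ell k - q')) = of_bool (\<not> prime q')"
          using bits i by simp
      qed (use qe kc ue el ell_ge1[OF k(1)] in auto)
      have tab3: "table (a3 0)" using tab out b(2)[OF kc] by (auto simp: table_def)
      have time: "n3 + rc k (v e) + 15 \<le> n + rc k (v e + ell k) + 60"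
        using 1(4) rc_refill[OF ue el k(1)] l n2 by simp
      have "v e + ell k \<le> U" "b + ell k \<le> U" using eu b(3)[OF kc] U_ge by linarith+
      then show ?case using hd tab3 out time fe fe' ell_ge1[OF k(1)] qe kc by simp
    qed
    have pre1: "wp (21 ::= Var e ;; 22 ::= bx) Q2 v a n1" if "\<And>n2. n2 \<le> n1 + 20 \<Longrightarrow> Q2 ?v2 a n2" for Q2 n1
    proof -
      have "v e \<le> U" "b \<le> U" using eu b(3)[OF kc] U_ge by linarith+
      then show ?thesis using b(1)[OF kc, of "v e"] b(4) by (simp add: that)
    qed
    have i: "wp (ensure_com q e t bx) Q2 v a n" if
      "wp (21 ::= Var e ;; 22 ::= bx) (\<lambda>v a n. wp refill_com (\<lambda>v' a' n'. wp (e ::= Var e \<oplus> Var 19 ;; t ::= Var 22 \<oplus> Var 19) (\<lambda>v a n. Q2 v a (Suc n)) v' a' n') v a n) v a (n + 2 + 2 + 1)" for Q2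
      using that False unfolding ensure_com_def wp_If ecost.simps eok.simps eval.simps wp_Seq
      by (simp only: if_False simp_thms)
    show ?thesis by (rule i, rule pre1, rule fin) simp
  qed
qed (use Q in blast)

end

definition advB_com :: com where
  "advB_com = (ensure_com 12 17 18 (Var 20 \<oplus> Var 19) ;;
     IF Arr 0 (Var 18 \<ominus> (Var 17 \<ominus> Var 12)) < Num 1
     THEN (13 ::= Var 13 \<oplus> Var 12 ;; 14 ::= Var 14 \<oplus> Num 1) ELSE Skip ;;
     12 ::= Var 12 \<oplus> Num 1)"

text \<open>The window is counted just before its least prime is dropped, so every run is counted
  once.\<close>

definition advA_com :: com where
  "advA_com = (ensure_com 11 15 16 (Var 20) ;;
     IF Arr 0 (Var 16 \<ominus> (Var 15 \<ominus> Var 11)) < Num 1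
     THEN (13\<langle>Var 13 \<ominus> Var 7\<rangle> ::= Arr 13 (Var 13 \<ominus> Var 7) \<oplus> Num 1 ;;
           13 ::= Var 13 \<ominus> Var 11 ;; 14 ::= Var 14 \<ominus> Num 1) ELSE Skip ;;
     11 ::= Var 11 \<oplus> Num 1)"

text \<open>Variable 27 is a go flag. A window rests when it is full with a sum beyond the segment,
  or when it lacks primes at \<open>lim k\<close>.\<close>

definition scan_com :: com where
  "scan_com = WHILE Num 0 < Var 27 DO
     (IF Var 14 < Var 9
      THEN (IF Var 12 < Var 10 THEN advB_com ELSE 27 ::= Num 0)
      ELSE (IF Var 13 < Var 8 THEN advA_com ELSE 27 ::= Num 0))"

section \<open>Sliding one window through one segment\<close>

context puzzle
begin

lemmas refill_frame_defs = ensure_com_def refill_com_def fill_com_def strike_com_def strike_init_com_def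

definition wstate :: "nat \<Rightarrow> (nat \<Rightarrow> nat) \<Rightarrow> (nat \<Rightarrow> nat \<Rightarrow> nat) \<Rightarrow> bool" where
  "wstate k v a \<longleftrightarrow> v 11 \<le> v 12 \<and> v 12 \<le> lim k \<and> v 14 \<le> k \<and>
     v 13 = \<Sum>(win (v 11) (v 12)) \<and> v 14 = card (win (v 11) (v 12)) \<and>
     head (a 0) k (bas k) (v 11) (v 15) (v 16) \<and>
     head (a 0) k (bas k + ell k) (v 12) (v 17) (v 18) \<and> table (a 0)"

definition kctx :: "nat \<Rightarrow> nat \<Rightarrow> (nat \<Rightarrow> nat) \<Rightarrow> (nat \<Rightarrow> nat \<Rightarrow> nat) \<Rightarrow> bool" where
  "kctx k N v a \<longleftrightarrow> sieve_env v a \<and> 1 \<le> k \<and> k \<le> R \<and> v 9 = k \<and> v 10 = lim k \<and> v 7 = N \<and> v 8 = N + R \<and>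
     1 \<le> N \<and> N \<le> x \<and> (k < c0 \<longrightarrow> v 19 = ell k \<and> v 20 = bas k)"

text \<open>Positions and stream ends never decrease, so over all segments the scanning time
  telescopes to the final potential.\<close>

definition pot :: "nat \<Rightarrow> (nat \<Rightarrow> nat) \<Rightarrow> nat" where
  "pot k v = 400 * (v 11 + v 12) + rc k (v 15) + rc k (v 17)"

lemma bas_mono: "i \<le> j \<Longrightarrow> bas i \<le> bas j"
  unfolding bas_def by (intro add_left_mono mult_le_mono2 sum_mono2) auto

lemma T_le_bas: "T \<le> bas k"
  by (simp add: bas_def)

lemma bas_Suc: "k \<ge> 1 \<Longrightarrow> bas (Suc k) = bas k + 2 * ell k"
  by (simp add: bas_def sum.atLeastLessThan_Suc)

lemma bas_L: "k \<ge> 1 \<Longrightarrow> k < c0 \<Longrightarrow> bas k + 2 * ell k < L"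
  using bas_mono[of "Suc k" c0] by (simp add: bas_Suc L_def)

lemma T_L: "T < L"
  using T_le_bas[of c0] by (simp add: L_def)

lemma head_cong:
  assumes "head bt k b q e t" "\<forall>j<T. bt' j = bt j" "k < c0 \<longrightarrow> (\<forall>j. b \<le> j \<and> j < b + ell k \<longrightarrow> bt' j = bt j)"
  shows "head bt' k b q e t"
  unfolding head_def
proof (intro conjI allI impI)
  fix q' assume q': "q \<le> q' \<and> q' < e"
  have "bt' (t - (e - q')) = bt (t - (e - q'))"
  proof (cases "e = T \<and> t = T")
    case True
    then show ?thesis using assms(2) q' by simp
  next
    case False
    then have "k < c0" "t = b + ell k" "e \<le> q + ell k" using assms(1) by (auto simp: head_def)
    moreover from this have "b \<le> t - (e - q')" "t - (e - q') < b + ell k" using q' by auto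
    ultimately show ?thesis using assms(3) by blast
  qed
  then show "bt' (t - (e - q')) = of_bool (\<not> prime q')" using assms(1) q' by (simp add: head_def)
qed (use assms(1) in \<open>auto simp: head_def\<close>)

lemma head_Suc: "head bt k b q e t \<Longrightarrow> q < e \<Longrightarrow> head bt k b (Suc q) e t"
  by (auto simp: head_def)

lemma head_bit: "head bt k b q e t \<Longrightarrow> q < e \<Longrightarrow> bt (t - (e - q)) = of_bool (\<not> prime q)"
  by (auto simp: head_def)

lemma head_idx:
  assumes "head bt k b q e t" "q < e" "k < c0 \<Longrightarrow> b + ell k \<le> L"
  shows "t - (e - q) < L"
  using assms T_L by (auto simp: head_def)

lemma sum_win_le: "\<Sum>(win a b) \<le> card (win a b) * b"
  using sum_mono[of "win a b" "\<lambda>p. p" "\<lambda>_. b"] by (auto simp: win_def)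

lemma k_lim: "k * lim k \<le> 512 * x + k"
  by (simp add: lim_def)

lemma wstate_sum_le: "wstate k v a \<Longrightarrow> v 13 \<le> 512 * x + k"
proof -
  assume w: "wstate k v a"
  have "v 13 \<le> card (win (v 11) (v 12)) * v 12" using w sum_win_le by (simp add: wstate_def)
  also have "\<dots> \<le> k * lim k" using w by (intro mult_le_mono) (auto simp: wstate_def)
  also have "\<dots> \<le> 512 * x + k" by (rule k_lim)
  finally show ?thesis .
qed

text \<open>A move earns 400 units; the 150 left over pay for the tests of the surrounding
  loop.\<close>

lemma advB_spec:
  assumes ctx: "kctx k N v a" and w: "wstate k v a" and c: "v 14 < k" and l: "v 12 < lim k"
    and Q: "\<And>v' a' n'. frame advB_com v a v' a' \<Longrightarrow> wstate k v' a' \<Longrightarrow> v' 12 = Suc (v 12) \<Longrightarrow>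
      (\<forall>j. j < bas k + ell k \<or> bas k + 2 * ell k \<le> j \<or> c0 \<le> k \<longrightarrow> a' 0 j = a 0 j) \<Longrightarrow>
      n' + pot k v + 150 \<le> n + pot k v' \<Longrightarrow> Q v' a' n'"
  shows "wp advB_com Q v a n"
proof (rule wp_frame)
  have k: "k \<ge> 1" "k < c0 \<longrightarrow> v 19 = ell k" and env: "sieve_env v a" and k2: "k < c0 \<longrightarrow> v 20 = bas k" and kR: "k \<le> R"
    using ctx by (auto simp: kctx_def)
  have h: "head (a 0) k (bas k + ell k) (v 12) (v 17) (v 18)" and tab: "table (a 0)"
    and hA: "head (a 0) k (bas k) (v 11) (v 15) (v 16)" using w by (auto simp: wstate_def)
  have b3: "k < c0 \<Longrightarrow> bas k + ell k + ell k \<le> L" using bas_L[of k] k by simp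
  show "wp advB_com (\<lambda>v' a' n'. wstate k v' a' \<and> v' 12 = Suc (v 12) \<and>
      (\<forall>j. j < bas k + ell k \<or> bas k + 2 * ell k \<le> j \<or> c0 \<le> k \<longrightarrow> a' 0 j = a 0 j) \<and>
      n' + pot k v + 150 \<le> n + pot k v') v a n"
    unfolding advB_com_def wp_Seq
  proof (rule ensure_spec[where k = k and b = "bas k + ell k"], goal_cases)
    case (13 v1 a1 n1)
    have f: "\<forall>y. y \<notin> {17, 18, 21, 22, 23, 25, 26} \<longrightarrow> v1 y = v y" "\<forall>A. A \<noteq> 0 \<longrightarrow> a1 A = a A"
      using 13(1) by (auto simp: frame_def refill_frame_defs)
    have fv: "v1 11 = v 11" "v1 12 = v 12" "v1 13 = v 13" "v1 14 = v 14" "v1 15 = v 15" "v1 16 = v 16"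
      using f by auto
    have bit: "a1 0 (v1 18 - (v1 17 - v 12)) = of_bool (\<not> prime (v 12))" using head_bit[OF 13(2,3)] .
    have idx: "v1 18 - (v1 17 - v 12) < L" using head_idx[OF 13(2,3)] b3 by simp
    have hB: "head (a1 0) k (bas k + ell k) (Suc (v 12)) (v1 17) (v1 18)" using head_Suc[OF 13(2,3)] .
    have hA1: "head (a1 0) k (bas k) (v 11) (v 15) (v 16)"
      by (rule head_cong[OF hA]) (use 13(4,5) tab in \<open>auto simp: table_def\<close>)
    have out: "\<forall>j. j < bas k + ell k \<or> bas k + 2 * ell k \<le> j \<or> c0 \<le> k \<longrightarrow> a1 0 j = a 0 j"
      using 13(5) by simp
    have sU: "v 13 + v 12 \<le> U" "Suc (v 12) \<le> U" "Suc (v 14) \<le> U"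
      using wstate_sum_le[OF w] l lim_le[of k] U_ge c kR R_le by linarith+
    have ws: "v 11 \<le> v 12" "v 13 = \<Sum>(win (v 11) (v 12))" "v 14 = card (win (v 11) (v 12))"
      using w by (auto simp: wstate_def)
    show ?case
    proof (cases "prime (v 12)")
      case True
      have nin: "v 12 \<notin> win (v 11) (v 12)" by (auto simp: win_def)
      show ?thesis using True bit idx sU fv hB hA1 13(4,6) out ws c l nin
        by (simp add: wstate_def pot_def win_Suc_right)
    next
      case False
      show ?thesis using False bit idx sU fv hB hA1 13(4,6) out ws c l
        by (simp add: wstate_def pot_def win_Suc_right)
    qed
  qed (use env tab k k2 h l b3 T_le_bas[of k] in auto)
qed (use Q in blast)

lemma advA_spec:
  assumes ctx: "kctx k N v a" and w: "wstate k v a" and c: "v 14 = k" and s: "v 13 < N + R"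
    and F: "prime (v 11) \<Longrightarrow> N \<le> v 13" "prime (v 11) \<Longrightarrow> a 13 (v 13 - N) \<le> R"
    and Q: "\<And>v' a' n'. frame advA_com v a v' a' \<Longrightarrow> wstate k v' a' \<Longrightarrow> v' 11 = Suc (v 11) \<Longrightarrow>
      a' 13 = (if prime (v 11) then (a 13)(v 13 - N := Suc (a 13 (v 13 - N))) else a 13) \<Longrightarrow>
      (\<forall>j. j < bas k \<or> bas k + ell k \<le> j \<or> c0 \<le> k \<longrightarrow> a' 0 j = a 0 j) \<Longrightarrow>
      n' + pot k v + 150 \<le> n + pot k v' \<Longrightarrow> Q v' a' n'"
  shows "wp advA_com Q v a n"
proof (rule wp_frame)
  have k: "k \<ge> 1" "k < c0 \<longrightarrow> v 19 = ell k" and env: "sieve_env v a" and k2: "k < c0 \<longrightarrow> v 20 = bas k"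
    and v7: "v 7 = N" and kR: "k \<le> R"
    using ctx by (auto simp: kctx_def)
  have h: "head (a 0) k (bas k + ell k) (v 12) (v 17) (v 18)" and tab: "table (a 0)"
    and hA: "head (a 0) k (bas k) (v 11) (v 15) (v 16)" using w by (auto simp: wstate_def)
  have b3: "k < c0 \<Longrightarrow> bas k + ell k + ell k \<le> L" using bas_L[of k] k by simp
  have ws: "v 11 \<le> v 12" "v 12 \<le> lim k" "v 13 = \<Sum>(win (v 11) (v 12))" "v 14 = card (win (v 11) (v 12))"
    using w by (auto simp: wstate_def)
  have ne: "win (v 11) (v 12) \<noteq> {}" using ws(4) c k by auto
  then have lt: "v 11 < v 12" by (auto simp: win_def)
  then have l: "v 11 < lim k" using ws(2) by simp
  show "wp advA_com (\<lambda>v' a' n'. wstate k v' a' \<and> v' 11 = Suc (v 11) \<and>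
      a' 13 = (if prime (v 11) then (a 13)(v 13 - N := Suc (a 13 (v 13 - N))) else a 13) \<and>
      (\<forall>j. j < bas k \<or> bas k + ell k \<le> j \<or> c0 \<le> k \<longrightarrow> a' 0 j = a 0 j) \<and>
      n' + pot k v + 150 \<le> n + pot k v') v a n"
    unfolding advA_com_def wp_Seq
  proof (rule ensure_spec[where k = k and b = "bas k"], goal_cases)
    case (13 v1 a1 n1)
    have f: "\<forall>y. y \<notin> {15, 16, 21, 22, 23, 25, 26} \<longrightarrow> v1 y = v y" "\<forall>A. A \<noteq> 0 \<longrightarrow> a1 A = a A"
      using 13(1) by (auto simp: frame_def refill_frame_defs)
    have fv: "v1 11 = v 11" "v1 12 = v 12" "v1 13 = v 13" "v1 14 = v 14" "v1 17 = v 17" "v1 18 = v 18" "v1 7 = N"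
        "a1 13 = a 13"
      using f v7 by auto
    have bit: "a1 0 (v1 16 - (v1 15 - v 11)) = of_bool (\<not> prime (v 11))" using head_bit[OF 13(2,3)] .
    have idx: "v1 16 - (v1 15 - v 11) < L" by (rule head_idx[OF 13(2,3)]) (use b3 in fastforce)
    have hA1: "head (a1 0) k (bas k) (Suc (v 11)) (v1 15) (v1 16)" using head_Suc[OF 13(2,3)] .
    have hB: "head (a1 0) k (bas k + ell k) (v 12) (v 17) (v 18)"
      by (rule head_cong[OF h]) (use 13(4,5) tab in \<open>auto simp: table_def\<close>)
    have sU: "v 13 - v 11 \<le> U" "Suc (v 11) \<le> U" "v 14 - Suc 0 \<le> U"
      using wstate_sum_le[OF w] l lim_le[of k] U_ge c kR R_le by linarith+
    have sI: "v 13 - N < Lw" "v 13 - N < L" using s R_ge2 by (auto simp: Lw_def L_def)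
    show ?case
    proof (cases "prime (v 11)")
      case True
      have mem: "v 11 \<in> win (v 11) (v 12)" using True lt by (auto simp: win_def)
      have sm: "\<Sum>(win (v 11) (v 12) - {v 11}) = v 13 - v 11" using mem ws(3) by (simp add: sum_diff1_nat)
      have cd: "card (win (v 11) (v 12) - {v 11}) = v 14 - 1" using mem ws(4) by simp
      have "Suc (a 13 (v 13 - N)) \<le> U" using F(2)[OF True] R_le U_ge by linarith
      then show ?thesis using True bit idx sU fv hB hA1 13(4,5,6) ws c l lt sm cd sI
        by (simp add: wstate_def pot_def win_Suc_left wok_def)
    next
      case False
      have nin: "win (v 11) (v 12) - {v 11} = win (v 11) (v 12)" using False by (auto simp: win_def)
      show ?thesis using False bit idx sU fv hB hA1 13(4,5,6) ws c l lt
        by (simp add: wstate_def pot_def win_Suc_left nin)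
    qed
  qed (use env tab k k2 hA l b3 T_le_bas[of k] in auto)
qed (use Q in blast)

text \<open>Restricts the stored positions to the lengths that are actually scanned.\<close>

definition Pof :: "(nat \<Rightarrow> nat) \<Rightarrow> nat \<Rightarrow> nat" where
  "Pof f j = (if 1 \<le> j \<and> j \<le> R then f j else 0)"

text \<open>\<open>old\<close> and \<open>new\<close> say that the lower end separates the runs of
  length \<open>k\<close> at the start of the segment; the conclusion moves this cut to the end of
  the segment. The alternative \<open>x < \<Sum>S\<close> covers windows that stopped at
  \<open>lim k\<close>.\<close>

lemma scan_spec:
  assumes ctx: "kctx k N v a" and w: "wstate k v a" and go: "v 27 = 1"
    and F: "\<forall>i<R. a 13 i = card (recorded (P(k := v 11)) (N + i))" and P: "\<And>j. j > R \<Longrightarrow> P j = 0"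
    and old: "\<forall>S. consecutive_primes S \<and> card S = k \<and> Min S < v 11 \<longrightarrow> \<Sum>S < N"
    and new: "\<forall>S. consecutive_primes S \<and> card S = k \<and> v 11 \<le> Min S \<longrightarrow> N \<le> \<Sum>S \<or> x < \<Sum>S"
    and Q: "\<And>v' a' n'. frame scan_com v a v' a' \<Longrightarrow> wstate k v' a' \<Longrightarrow>
      \<forall>i<R. a' 13 i = card (recorded (P(k := v' 11)) (N + i)) \<Longrightarrow>
      \<forall>S. consecutive_primes S \<and> card S = k \<and> Min S < v' 11 \<longrightarrow> \<Sum>S < N + R \<Longrightarrow>
      \<forall>S. consecutive_primes S \<and> card S = k \<and> v' 11 \<le> Min S \<longrightarrow> N + R \<le> \<Sum>S \<or> x < \<Sum>S \<Longrightarrow>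
      (\<forall>j. j < bas k \<or> bas k + 2 * ell k \<le> j \<or> c0 \<le> k \<longrightarrow> a' 0 j = a 0 j) \<Longrightarrow>
      n' + pot k v \<le> n + pot k v' + 200 \<Longrightarrow> Q v' a' n'"
  shows "wp scan_com Q v a n"
proof (rule wp_frame)
  have k: "k \<ge> 1" "k \<le> R" "N \<le> x" "v 8 = N + R" "v 10 = lim k" "v 9 = k" using ctx by (auto simp: kctx_def)
  let ?I = "\<lambda>v' a' n'. wstate k v' a' \<and> v 11 \<le> v' 11 \<and>
      (\<forall>i<R. a' 13 i = card (recorded (P(k := v' 11)) (N + i))) \<and>
      (\<forall>S. consecutive_primes S \<and> card S = k \<and> Min S < v' 11 \<longrightarrow> \<Sum>S < N + R) \<and>
      (\<forall>j. j < bas k \<or> bas k + 2 * ell k \<le> j \<or> c0 \<le> k \<longrightarrow> a' 0 j = a 0 j) \<and>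
      v' 27 \<le> 1 \<and> (v' 27 = 0 \<longrightarrow> v' 14 = k \<and> N + R \<le> v' 13 \<or> v' 14 < k \<and> lim k \<le> v' 12) \<and>
      n' + pot k v \<le> n + pot k v' + (if v' 27 = 0 then 100 else 0)"
  have mv: "mvars advA_com = {11, 13, 14, 15, 16, 21, 22, 23, 25, 26}" "marrs advA_com = {0, 13}"
    "mvars advB_com = {12, 13, 14, 17, 18, 21, 22, 23, 25, 26}" "marrs advB_com = {0}"
    by (auto simp: advA_com_def advB_com_def refill_frame_defs)
  let ?c = "IF Var 14 < Var 9
      THEN (IF Var 12 < Var 10 THEN advB_com ELSE 27 ::= Num 0)
      ELSE (IF Var 13 < Var 8 THEN advA_com ELSE 27 ::= Num 0)"
  have fr: "(\<forall>y. y \<notin> {11, 12, 13, 14, 15, 16, 17, 18, 21, 22, 23, 25, 26, 27} \<longrightarrow> v' y = v y) \<and>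
      (\<forall>A. A \<notin> {0, 13} \<longrightarrow> a' A = a A)" if "frame ?c v a v' a'" for v' a'
    using that by (simp add: frame_def mv)
  have ctx': "kctx k N v' a'" if "frame ?c v a v' a'" for v' a'
    using fr[OF that] ctx by (simp add: kctx_def sieve_env_def)
  show "wp scan_com (\<lambda>v' a' n'. wstate k v' a' \<and>
      (\<forall>i<R. a' 13 i = card (recorded (P(k := v' 11)) (N + i))) \<and>
      (\<forall>S. consecutive_primes S \<and> card S = k \<and> Min S < v' 11 \<longrightarrow> \<Sum>S < N + R) \<and>
      (\<forall>S. consecutive_primes S \<and> card S = k \<and> v' 11 \<le> Min S \<longrightarrow> N + R \<le> \<Sum>S \<or> x < \<Sum>S) \<and>
      (\<forall>j. j < bas k \<or> bas k + 2 * ell k \<le> j \<or> c0 \<le> k \<longrightarrow> a' 0 j = a 0 j) \<and>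
      n' + pot k v \<le> n + pot k v' + 200) v a n"
    unfolding scan_com_def
  proof (rule wp_While[where I = ?I and f = "\<lambda>v' a'. (lim k - v' 11) + (lim k - v' 12) + v' 27"], goal_cases)
    case 1
    show ?case using w go F old by (auto intro: trans_less_add1)
  next
    case (2 v' a' n')
    then show ?case by simp
  next
    case (3 v' a' n')
    note fr3 = fr[OF 3(1)] and ctx3 = ctx'[OF 3(1)]
    have go1: "v' 27 = 1" using 3(2,3) by simp
    have I: "wstate k v' a'" "v 11 \<le> v' 11" "\<forall>i<R. a' 13 i = card (recorded (P(k := v' 11)) (N + i))"
      "\<forall>S. consecutive_primes S \<and> card S = k \<and> Min S < v' 11 \<longrightarrow> \<Sum>S < N + R"
      "\<forall>j. j < bas k \<or> bas k + 2 * ell k \<le> j \<or> c0 \<le> k \<longrightarrow> a' 0 j = a 0 j"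
      "n' + pot k v \<le> n + pot k v'"
      using 3(2) go1 by auto
    have ws: "v' 11 \<le> v' 12" "v' 12 \<le> lim k" "v' 14 \<le> k" "v' 13 = \<Sum>(win (v' 11) (v' 12))"
       "v' 14 = card (win (v' 11) (v' 12))" using I(1) by (auto simp: wstate_def)
    have vs: "v' 9 = k" "v' 10 = lim k" "v' 8 = N + R" using fr3 k by auto
    show ?case
    proof (cases "v' 14 < k")
      case True
      note c14 = True
      show ?thesis
      proof (cases "v' 12 < lim k")
        case True
        have I1: "wp ?c Q2 v' a' m" if "\<And>n2. n2 \<le> m + 20 \<Longrightarrow> wp advB_com Q2 v' a' n2" for Q2 m
          using that c14 True vs by simp
        show ?thesis
        proof (rule I1, rule advB_spec[OF ctx3 I(1) c14 True], goal_cases)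
          case (1 n2 v2 a2 n3)
          have f2: "v2 11 = v' 11" "v2 27 = 1" "a2 13 = a' 13"
            using 1(2) go1 by (simp_all add: frame_def mv)
          show ?case using 1 f2 I True go1 by auto
        qed
      next
        case False
        then show ?thesis using c14 vs I go1 ws by (auto simp: wstate_def pot_def)
      qed
    next
      case False
      then have ck: "v' 14 = k" using ws by simp
      show ?thesis
      proof (cases "v' 13 < N + R")
        case True
        have I1: "wp ?c Q2 v' a' m" if "\<And>n2. n2 \<le> m + 20 \<Longrightarrow> wp advA_com (\<lambda>v a n. Q2 v a (Suc n)) v' a' n2" for Q2 m
          using that ck True vs by simp
        have ne: "win (v' 11) (v' 12) \<noteq> {}" using ws(5) ck k by auto
        have cw: "card (win (v' 11) (v' 12)) = k" using ws(5) ck by simp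
        have lt: "v' 11 < v' 12" using ne by (auto simp: win_def)
        have NS: "N \<le> v' 13" if "prime (v' 11)"
        proof -
          have "Min (win (v' 11) (v' 12)) = v' 11" using recorded_prime(3)[OF that cw ne lt] .
          then have "N \<le> v' 13 \<or> x < v' 13"
            using new I(2) consecutive_primes_win[OF ne] cw ws(4) by simp
          then show ?thesis using k by auto
        qed
        \<comment> \<open>A number has at most one recorded run per length, which keeps the counter
          within the word bound.\<close>
        have FR: "a' 13 (v' 13 - N) \<le> R" if "prime (v' 11)"
        proof -
          have "v' 13 - N < R" using True NS[OF that] by simp
          then have "a' 13 (v' 13 - N) = card (recorded (P(k := v' 11)) (N + (v' 13 - N)))" using I(3) by simp
          also have "\<dots> \<le> R" using P k by (intro card_recorded_le) auto
          finally show ?thesis .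
        qed
        show ?thesis
        proof (rule I1, rule advA_spec[OF ctx3 I(1) ck True NS FR], assumption, assumption, goal_cases)
          case (1 n2 v2 a2 n3)
          have f2: "v2 12 = v' 12" "v2 27 = 1"
            using 1(2) go1 by (simp_all add: frame_def mv)
          have rec: "a2 13 i = card (recorded (P(k := v2 11)) (N + i))" if i: "i < R" for i
          proof (cases "prime (v' 11)")
            case pr: True
            note rp = recorded_prime(1,2)[OF pr cw ne lt, where P = P and n = "N + i"]
            show ?thesis unfolding 1(4) 1(5) rp(1)
              using pr I(3) i NS[OF pr] rp(2) ws(4) by auto
          next
            case False
            show ?thesis unfolding 1(4) 1(5) recorded_not_prime[OF False] using False I(3) i by simp
          qed
          have o2: "\<Sum>S < N + R" if S: "consecutive_primes S" "card S = k" "Min S < v2 11" for S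
          proof (cases "Min S = v' 11")
            case mS: True
            have "S = win (v' 11) (v' 12)" by (rule win_eq_of_Min[OF S(1) mS]) (use S cw in simp)
            then show ?thesis using ws(4) True by simp
          next
            case False
            then show ?thesis using I(4) S 1(4) by auto
          qed
          show ?case using 1 f2 I rec o2 lt ws(2) go1 by auto
        qed
      next
        case False
        then show ?thesis using ck vs I go1 ws by (auto simp: wstate_def pot_def)
      qed
    qed
  next
    case (4 v' a' n')
    have go0: "v' 27 = 0" using 4(3) by simp
    have I: "wstate k v' a'" "v' 14 = k \<and> N + R \<le> v' 13 \<or> v' 14 < k \<and> lim k \<le> v' 12"
      using 4(2) go0 by auto
    have ws: "v' 13 = \<Sum>(win (v' 11) (v' 12))"
       "v' 14 = card (win (v' 11) (v' 12))" using I(1) by (auto simp: wstate_def)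
    have "N + R \<le> \<Sum>S \<or> x < \<Sum>S" if S: "consecutive_primes S" "card S = k" "v' 11 \<le> Min S" for S
      using I(2)
    proof
      assume "v' 14 = k \<and> N + R \<le> v' 13"
      then show ?thesis using win_sum_le_of_card[OF S(1,3), of "v' 12"] S(2) ws by simp
    next
      assume a: "v' 14 < k \<and> lim k \<le> v' 12"
      \<comment> \<open>Every later run of this length reaches \<open>lim k\<close>, so by the
        Chebyshev estimate its sum exceeds \<open>x\<close>.\<close>
      have M: "lim k \<le> Max S" using Max_ge_of_card[OF S(1,3), of "v' 12"] S(2) ws a by simp
      show ?thesis
      proof (rule ccontr)
        assume "\<not> ?thesis"
        then have "k * Max S \<le> 512 * x" using consecutive_primes_card_Max_le[OF S(1)] S(2) by simp
        then have "Max S \<le> 512 * x div k" using k(1) by (simp add: less_eq_div_iff_mult_less_eq mult.commute)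
        then show False using M by (simp add: lim_def)
      qed
    qed
    then show ?case using 4(2) go0 by auto
  qed
qed (use Q in blast)

end

section \<open>The main loop\<close>

definition load_com :: com where
  "load_com = (10 ::= Num 512 \<otimes> Var 0 \<oslash> Var 9 \<oplus> Num 1 ;;
     11 ::= Arr 3 (Var 9) ;; 12 ::= Arr 4 (Var 9) ;; 13 ::= Arr 5 (Var 9) ;; 14 ::= Arr 6 (Var 9) ;;
     15 ::= Arr 7 (Var 9) ;; 16 ::= Arr 8 (Var 9) ;; 17 ::= Arr 9 (Var 9) ;; 18 ::= Arr 10 (Var 9) ;;
     19 ::= Arr 11 (Var 9) ;; 20 ::= Arr 12 (Var 9) ;; 27 ::= Num 1)"

definition save_com :: com where
  "save_com = (3\<langle>Var 9\<rangle> ::= Var 11 ;; 4\<langle>Var 9\<rangle> ::= Var 12 ;; 5\<langle>Var 9\<rangle> ::= Var 13 ;; 6\<langle>Var 9\<rangle> ::= Var 14 ;;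
     7\<langle>Var 9\<rangle> ::= Var 15 ;; 8\<langle>Var 9\<rangle> ::= Var 16 ;; 9\<langle>Var 9\<rangle> ::= Var 17 ;; 10\<langle>Var 9\<rangle> ::= Var 18 ;;
     9 ::= Var 9 \<oplus> Num 1)"

definition visit_com :: com where
  "visit_com = (load_com ;; scan_com ;; save_com)"

definition clear_com :: com where
  "clear_com = (23 ::= Num 0 ;;
     WHILE Var 23 < Var 3 DO (13\<langle>Var 23\<rangle> ::= Num 0 ;; 23 ::= Var 23 \<oplus> Num 1))"

definition tally_com :: com where
  "tally_com = (23 ::= Num 0 ;;
     WHILE Var 23 < Var 3 DO
       (IF Var 7 \<oplus> Var 23 < Var 0 \<oplus> Num 1
        THEN 14\<langle>Arr 13 (Var 23)\<rangle> ::= Arr 14 (Arr 13 (Var 23)) \<oplus> Num 1 ELSE Skip ;;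
        23 ::= Var 23 \<oplus> Num 1))"

definition visits_com :: com where
  "visits_com = (9 ::= Num 1 ;; WHILE Var 9 < Var 3 \<oplus> Num 1 DO visit_com)"

definition segment_com :: com where
  "segment_com = (8 ::= Var 7 \<oplus> Var 3 ;; clear_com ;; visits_com ;; tally_com ;; 7 ::= Var 8)"

text \<open>The output has \<open>R + 1\<close> entries because no number up to \<open>x\<close> has
  more than \<open>R\<close> representations.\<close>

definition main_com :: com where
  "main_com = (7 ::= Num 1 ;; WHILE Var 7 < Var 0 \<oplus> Num 1 DO segment_com ;; 1 ::= Var 3 \<oplus> Num 1)"

context puzzle
begin

definition kst :: "(nat \<Rightarrow> nat \<Rightarrow> nat) \<Rightarrow> nat \<Rightarrow> bool" where
  "kst a k \<longleftrightarrow> a 3 k \<le> a 4 k \<and> a 4 k \<le> lim k \<and> a 6 k \<le> k \<and>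
     a 5 k = \<Sum>(win (a 3 k) (a 4 k)) \<and> a 6 k = card (win (a 3 k) (a 4 k)) \<and>
     head (a 0) k (bas k) (a 3 k) (a 7 k) (a 8 k) \<and>
     head (a 0) k (bas k + ell k) (a 4 k) (a 9 k) (a 10 k) \<and>
     a 11 k = (if k < c0 then ell k else 0) \<and> a 12 k = (if k < c0 then bas k else 0)"

definition genv :: "(nat \<Rightarrow> nat) \<Rightarrow> (nat \<Rightarrow> nat \<Rightarrow> nat) \<Rightarrow> bool" where
  "genv v a \<longleftrightarrow> sieve_env v a \<and> v 0 = x \<and> v 3 = R \<and> table (a 0)"

definition apot :: "(nat \<Rightarrow> nat \<Rightarrow> nat) \<Rightarrow> nat \<Rightarrow> nat" where
  "apot a k = 400 * (a 3 k + a 4 k) + rc k (a 7 k) + rc k (a 9 k)"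

definition before :: "nat \<Rightarrow> nat \<Rightarrow> nat \<Rightarrow> bool" where
  "before k q n \<longleftrightarrow> (\<forall>S. consecutive_primes S \<and> card S = k \<and> Min S < q \<longrightarrow> \<Sum>S < n)"

definition after :: "nat \<Rightarrow> nat \<Rightarrow> nat \<Rightarrow> bool" where
  "after k q n \<longleftrightarrow> (\<forall>S. consecutive_primes S \<and> card S = k \<and> q \<le> Min S \<longrightarrow> n \<le> \<Sum>S \<or> x < \<Sum>S)"

lemma head_le_U:
  assumes "head bt k b q e t" "k \<ge> 1" "k < c0 \<Longrightarrow> b + ell k \<le> L"
  shows "e \<le> U" "t \<le> U"
proof -
  have "ell k \<le> x" using ell_le assms(2) by simp
  then show "e \<le> U" using assms(1) T_L U_ge lim_le[of k] by (auto simp: head_def)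
  show "t \<le> U" using assms T_L U_ge by (auto simp: head_def)
qed

lemma Pof_upd: "1 \<le> k \<Longrightarrow> k \<le> R \<Longrightarrow> Pof (f(k := y)) = (Pof f)(k := y)"
  by (auto simp: Pof_def fun_eq_iff)

text \<open>Buffers of different lengths occupy disjoint intervals, and all other bits lie in the
  unchanged table.\<close>

lemma kst_other:
  assumes "kst a j" "j \<noteq> k" "1 \<le> j" "1 \<le> k" "table (a 0)" "table (a' 0)"
    "\<forall>A\<in>{3..12}. a' A j = a A j"
    "\<forall>i. i < bas k \<or> bas k + 2 * ell k \<le> i \<or> c0 \<le> k \<longrightarrow> a' 0 i = a 0 i"
  shows "kst a' j"
proof -
  have eq: "a' 3 j = a 3 j" "a' 4 j = a 4 j" "a' 5 j = a 5 j" "a' 6 j = a 6 j" "a' 7 j = a 7 j"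
    "a' 8 j = a 8 j" "a' 9 j = a 9 j" "a' 10 j = a 10 j" "a' 11 j = a 11 j" "a' 12 j = a 12 j"
    using assms(7) by auto
  have reg: "a' 0 i = a 0 i" if "bas j \<le> i" "i < bas j + 2 * ell j" for i
  proof (cases "j < k")
    case True
    then have "bas (Suc j) \<le> bas k" by (intro bas_mono) simp
    then show ?thesis using that assms by (simp add: bas_Suc)
  next
    case False
    then have "bas (Suc k) \<le> bas j" using assms(2) by (intro bas_mono) simp
    then show ?thesis using that assms by (simp add: bas_Suc)
  qed
  have tb: "\<forall>i<T. a' 0 i = a 0 i" using assms(5,6) by (simp add: table_def)
  have "head (a' 0) j (bas j) (a 3 j) (a 7 j) (a 8 j)"
    by (rule head_cong[of "a 0"]) (use assms(1) tb reg in \<open>auto simp: kst_def\<close>)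
  moreover have "head (a' 0) j (bas j + ell j) (a 4 j) (a 9 j) (a 10 j)"
    by (rule head_cong[of "a 0"]) (use assms(1) tb reg in \<open>auto simp: kst_def\<close>)
  ultimately show ?thesis using assms(1) by (simp add: kst_def eq)
qed

section \<open>Visiting all windows of a segment\<close>

lemma load_spec:
  assumes g: "genv v a" and N: "v 7 = N" "v 8 = N + R" "1 \<le> N" "N \<le> x" and k: "v 9 = k" "1 \<le> k" "k \<le> R"
    and st: "kst a k"
    and Q: "\<And>v' n'. frame load_com v a v' a \<Longrightarrow> kctx k N v' a \<Longrightarrow> wstate k v' a \<Longrightarrow> v' 27 = 1 \<Longrightarrow>
      v' 11 = a 3 k \<Longrightarrow> pot k v' = apot a k \<Longrightarrow> n' \<le> n + 150 \<Longrightarrow> Q v' a n'"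
  shows "wp load_com Q v a n"
proof (rule wp_frame)
  have kL: "k < L" using k by (simp add: L_def)
  have b3: "k < c0 \<Longrightarrow> bas k + ell k + ell k \<le> L" using bas_L[of k] k by simp
  have b2: "k < c0 \<Longrightarrow> bas k + ell k \<le> L" using b3 by linarith
  note stD = st[unfolded kst_def]
  have w: "wstate k (v(11 := a 3 k, 12 := a 4 k, 13 := a 5 k, 14 := a 6 k, 15 := a 7 k, 16 := a 8 k, 17 := a 9 k, 18 := a 10 k)) a"
    using stD g by (simp add: wstate_def genv_def)
  from wstate_sum_le[OF this] have "a 5 k \<le> U" using k R_le U_ge by simp
  moreover have "lim k \<le> U" using lim_le[of k] U_ge by linarith
  moreover from this have "a 4 k \<le> U" "a 3 k \<le> U" using stD by linarith+
  moreover have "a 6 k \<le> U" using stD k R_le U_ge by linarith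
  moreover have "a 7 k \<le> U" "a 8 k \<le> U" using head_le_U[of "a 0" k "bas k" "a 3 k" "a 7 k" "a 8 k"] stD k b2 by auto
  moreover have "a 9 k \<le> U" "a 10 k \<le> U"
    using head_le_U[of "a 0" k "bas k + ell k" "a 4 k" "a 9 k" "a 10 k"] stD k b3 by auto
  moreover have "a 11 k \<le> U" "a 12 k \<le> U" using stD b2 ell_le[of k] k U_ge by auto
  ultimately show "wp load_com (\<lambda>v' a' n'. a' = a \<and> kctx k N v' a \<and> wstate k v' a \<and> v' 27 = 1 \<and>
      v' 11 = a 3 k \<and> pot k v' = apot a k \<and> n' \<le> n + 150) v a n"
    using g N k kL stD U_ge unfolding load_com_def
    by (simp add: kctx_def wstate_def pot_def apot_def genv_def sieve_env_def lim_def)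
qed (use Q in blast)

lemma visit_spec:
  assumes g: "genv v a" and N: "v 7 = N" "v 8 = N + R" "1 \<le> N" "N \<le> x" and k: "v 9 = k" "1 \<le> k" "k \<le> R"
    and st: "\<forall>j\<in>{1..R}. kst a j"
    and F: "\<forall>i<R. a 13 i = card (recorded (Pof (a 3)) (N + i))"
    and old: "before k (a 3 k) N" and new: "after k (a 3 k) N"
    and Q: "\<And>v' a' n'. frame visit_com v a v' a' \<Longrightarrow> v' 9 = Suc k \<Longrightarrow> genv v' a' \<Longrightarrow> \<forall>j\<in>{1..R}. kst a' j \<Longrightarrow>
      \<forall>i<R. a' 13 i = card (recorded (Pof (a' 3)) (N + i)) \<Longrightarrow>
      \<forall>j. j \<noteq> k \<longrightarrow> a' 3 j = a 3 j \<and> apot a' j = apot a j \<Longrightarrow>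
      before k (a' 3 k) (N + R) \<Longrightarrow> after k (a' 3 k) (N + R) \<Longrightarrow>
      n' + apot a k \<le> n + apot a' k + 500 \<Longrightarrow> Q v' a' n'"
  shows "wp visit_com Q v a n"
proof (rule wp_frame)
  have kR: "k \<in> {1..R}" using k by simp
  have P: "Pof f j = 0" if "j > R" for f j using that by (simp add: Pof_def)
  have Pk: "(Pof (a 3))(k := a 3 k) = Pof (a 3)" using k by (auto simp: Pof_def fun_eq_iff)
  have kLw: "k < Lw" using k by (simp add: Lw_def)
  have b3: "k < c0 \<Longrightarrow> bas k + ell k + ell k \<le> L" using bas_L[of k] k by simp
  have b2: "k < c0 \<Longrightarrow> bas k + ell k \<le> L" using b3 by linarith
  show "wp visit_com (\<lambda>v' a' n'. v' 9 = Suc k \<and> genv v' a' \<and> (\<forall>j\<in>{1..R}. kst a' j) \<and>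
      (\<forall>i<R. a' 13 i = card (recorded (Pof (a' 3)) (N + i))) \<and>
      (\<forall>j. j \<noteq> k \<longrightarrow> a' 3 j = a 3 j \<and> apot a' j = apot a j) \<and>
      before k (a' 3 k) (N + R) \<and> after k (a' 3 k) (N + R) \<and>
      n' + apot a k \<le> n + apot a' k + 500) v a n"
    unfolding visit_com_def wp_Seq
  proof (rule load_spec[OF g N k], goal_cases)
    case 1
    show ?case using st kR by blast
  next
    case (2 v1 n1)
    show ?case
    proof (rule scan_spec[OF 2(2,3,4), where P = "Pof (a 3)"], goal_cases)
      case 1
      show ?case using F by (simp add: 2(5) Pk)
    next
      case (2 j)
      then show ?case by (rule P)
    next
      case 3
      then show ?case using old by (simp add: before_def 2(5))
    next
      case 4
      then show ?case using new by (simp add: after_def 2(5))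
    next
      case (5 v2 a2 n2)
      have f1: "\<forall>y. y \<notin> {10, 11, 12, 13, 14, 15, 16, 17, 18, 19, 20, 27} \<longrightarrow> v1 y = v y"
        using 2(1) by (simp add: frame_def load_com_def)
      have f2: "\<forall>y. y \<notin> {11, 12, 13, 14, 15, 16, 17, 18, 21, 22, 23, 25, 26, 27} \<longrightarrow> v2 y = v1 y"
        "\<forall>A. A \<notin> {0, 13} \<longrightarrow> a2 A = a A"
        using 5(1) by (auto simp: frame_def scan_com_def advA_com_def advB_com_def refill_frame_defs)
      have vv: "v2 9 = k" "v2 0 = x" "v2 3 = R" "v2 5 = w" "v2 6 = W"
        using f1 f2(1) k g by (auto simp: genv_def sieve_env_def)
      have w2: "v2 11 \<le> v2 12" "v2 12 \<le> lim k" "v2 14 \<le> k" "v2 13 = \<Sum>(win (v2 11) (v2 12))"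
         "v2 14 = card (win (v2 11) (v2 12))" "head (a2 0) k (bas k) (v2 11) (v2 15) (v2 16)"
         "head (a2 0) k (bas k + ell k) (v2 12) (v2 17) (v2 18)" "table (a2 0)"
        using 5(2) by (auto simp: wstate_def)
      have "v2 13 \<le> U" using wstate_sum_le[OF 5(2)] k R_le U_ge by simp
      moreover have "lim k \<le> U" using lim_le[of k] U_ge by linarith
      moreover from this have "v2 11 \<le> U" "v2 12 \<le> U" using w2 by linarith+
      moreover have "v2 14 \<le> U" "Suc k \<le> U" using w2 k R_le U_ge by linarith+
      moreover have "v2 15 \<le> U" "v2 16 \<le> U" using head_le_U[OF w2(6)] k b2 by auto
      moreover have "v2 17 \<le> U" "v2 18 \<le> U" using head_le_U[OF w2(7)] k b3 by auto
      ultimately have bnds: "v2 13 \<le> U" "v2 11 \<le> U" "v2 12 \<le> U" "v2 14 \<le> U" "Suc k \<le> U" "v2 15 \<le> U" "v2 16 \<le> U"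
        "v2 17 \<le> U" "v2 18 \<le> U" by blast+
      define a3 where "a3 = a2(3 := (a2 3)(k := v2 11), 4 := (a2 4)(k := v2 12), 5 := (a2 5)(k := v2 13),
        6 := (a2 6)(k := v2 14), 7 := (a2 7)(k := v2 15), 8 := (a2 8)(k := v2 16), 9 := (a2 9)(k := v2 17),
        10 := (a2 10)(k := v2 18))"
      have save: "wp save_com Q2 v2 a2 n2" if "\<And>n3. n3 \<le> n2 + 100 \<Longrightarrow> Q2 (v2(9 := Suc k)) a3 n3" for Q2
        using that bnds kLw vv(1) unfolding save_com_def a3_def by (simp add: wok_def)
      have a3s: "a3 0 = a2 0" "a3 1 = a 1" "a3 2 = a 2" "a3 13 = a2 13" "a3 11 = a 11" "a3 12 = a 12"
        "a3 3 = (a 3)(k := v2 11)" "a3 4 = (a 4)(k := v2 12)" "a3 5 = (a 5)(k := v2 13)"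
        "a3 6 = (a 6)(k := v2 14)" "a3 7 = (a 7)(k := v2 15)" "a3 8 = (a 8)(k := v2 16)" "a3 9 = (a 9)(k := v2 17)"
        "a3 10 = (a 10)(k := v2 18)"
        using f2(2) by (simp_all add: a3_def)
      have ge: "genv (v2(9 := Suc k)) a3"
        using vv w2(8) g by (auto simp: genv_def sieve_env_def a3s a3s(2)[unfolded One_nat_def])
      have stk: "kst a3 k" using w2 st kR by (simp add: kst_def a3s)
      have sto: "kst a3 j" if "j \<in> {1..R}" "j \<noteq> k" for j
      proof (rule kst_other[of a j k])
        show "\<forall>A\<in>{3..12}. a3 A j = a A j"
        proof
          fix A :: nat assume "A \<in> {3..12}"
          then have "A = 3 \<or> A = 4 \<or> A = 5 \<or> A = 6 \<or> A = 7 \<or> A = 8 \<or> A = 9 \<or> A = 10 \<or> A = 11 \<or> A = 12"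
            unfolding atLeastAtMost_iff by presburger
          then show "a3 A j = a A j" using that(2) by (elim disjE) (simp_all add: a3s)
        qed
        show "\<forall>i. i < bas k \<or> bas k + 2 * ell k \<le> i \<or> c0 \<le> k \<longrightarrow> a3 0 i = a 0 i"
          using 5(6) by (simp add: a3s)
      qed (use that st k g w2(8) in \<open>auto simp: genv_def a3s\<close>)
      have rec: "\<forall>i<R. a3 13 i = card (recorded (Pof (a3 3)) (N + i))"
        using 5(3) k by (simp add: a3s Pof_upd)
      have oth: "\<forall>j. j \<noteq> k \<longrightarrow> a3 3 j = a 3 j \<and> apot a3 j = apot a j"
        by (simp add: apot_def a3s)
      have ba: "before k (a3 3 k) (N + R)" "after k (a3 3 k) (N + R)"
        using 5(4,5) by (auto simp: before_def after_def a3s)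
      have pk: "apot a3 k = pot k v2" by (simp add: apot_def pot_def a3s)
      have "\<forall>j\<in>{1..R}. kst a3 j" using stk sto by blast
      then show ?case
        by (intro save) (use ge rec oth ba pk 5(7) 2(6,7) in auto)
    qed
  qed
qed (use Q in blast)

lemma clear_spec:
  assumes "v 3 = R"
    and Q: "\<And>v' a' n'. frame clear_com v a v' a' \<Longrightarrow> \<forall>i<R. a' 13 i = 0 \<Longrightarrow> n' \<le> n + 40 * R + 40 \<Longrightarrow> Q v' a' n'"
  shows "wp clear_com Q v a n"
proof (rule wp_frame)
  let ?I = "\<lambda>v' a' n'. v' 23 \<le> R \<and> (\<forall>i<v' 23. a' 13 i = 0) \<and> n' \<le> n + 10 + 40 * v' 23"
  show "wp clear_com (\<lambda>v' a' n'. (\<forall>i<R. a' 13 i = 0) \<and> n' \<le> n + 40 * R + 40) v a n"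
    unfolding clear_com_def
    apply simp
  proof (rule wp_While[where I = ?I and f = "\<lambda>v' a'. R - v' 23"], goal_cases)
    case (3 v' a' n')
    have "v' 3 = R" using 3(1) assms(1) by (simp add: frame_def)
    then have i: "v' 23 < R" using 3(3) by simp
    then have "Suc (v' 23) \<le> U" "v' 23 < Lw" using R_le U_ge by (auto simp: Lw_def)
    then show ?case using 3(2) i by (auto simp: wok_def less_Suc_eq)
  next
    case (4 v' a' n')
    have "v' 3 = R" using 4(1) assms(1) by (simp add: frame_def)
    then show ?case using 4 by auto
  qed auto
qed (use Q in blast)

lemma sum_apot_upd:
  assumes "k \<in> {1..R}" "\<forall>j. j \<noteq> k \<longrightarrow> apot a' j = apot a j"
  shows "(\<Sum>j\<in>{1..R}. apot a' j) + apot a k = (\<Sum>j\<in>{1..R}. apot a j) + apot a' k"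
proof -
  have "(\<Sum>j\<in>{1..R} - {k}. apot a' j) = (\<Sum>j\<in>{1..R} - {k}. apot a j)"
    using assms(2) by (intro sum.cong) auto
  then show ?thesis using assms(1) by (simp add: sum.remove[of _ k])
qed

text \<open>A visit changes only its own summand of the total potential, and costs at most 600
  beyond that change.\<close>

lemma visits_spec:
  assumes g: "genv v a" and N: "v 7 = N" "v 8 = N + R" "1 \<le> N" "N \<le> x"
    and st: "\<forall>j\<in>{1..R}. kst a j"
    and F: "\<forall>i<R. a 13 i = card (recorded (Pof (a 3)) (N + i))"
    and ba: "\<forall>j\<in>{1..R}. before j (a 3 j) N \<and> after j (a 3 j) N"
    and Q: "\<And>v' a' n'. frame visits_com v a v' a' \<Longrightarrow> genv v' a' \<Longrightarrow> \<forall>j\<in>{1..R}. kst a' j \<Longrightarrow>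
      \<forall>i<R. a' 13 i = card (recorded (Pof (a' 3)) (N + i)) \<Longrightarrow>
      \<forall>j\<in>{1..R}. before j (a' 3 j) (N + R) \<and> after j (a' 3 j) (N + R) \<Longrightarrow>
      n' + (\<Sum>j\<in>{1..R}. apot a j) \<le> n + (\<Sum>j\<in>{1..R}. apot a' j) + 600 * R + 100 \<Longrightarrow> Q v' a' n'"
  shows "wp visits_com Q v a n"
proof (rule wp_frame)
  let ?I = "\<lambda>v' a' n'. 1 \<le> v' 9 \<and> v' 9 \<le> R + 1 \<and> genv v' a' \<and> (\<forall>j\<in>{1..R}. kst a' j) \<and>
      (\<forall>i<R. a' 13 i = card (recorded (Pof (a' 3)) (N + i))) \<and>
      (\<forall>j\<in>{1..R}. j < v' 9 \<longrightarrow> before j (a' 3 j) (N + R) \<and> after j (a' 3 j) (N + R)) \<and>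
      (\<forall>j\<in>{1..R}. v' 9 \<le> j \<longrightarrow> before j (a' 3 j) N \<and> after j (a' 3 j) N) \<and>
      n' + (\<Sum>j\<in>{1..R}. apot a j) \<le> n + (\<Sum>j\<in>{1..R}. apot a' j) + 600 * (v' 9 - 1) + 10"
  have mv: "mvars visit_com = {9,10,11,12,13,14,15,16,17,18,19,20,21,22,23,25,26,27}"
    by (auto simp: visit_com_def load_com_def save_com_def scan_com_def advA_com_def advB_com_def refill_frame_defs)
  have I0: "?I (v(9 := 1)) a (Suc (Suc (Suc n)))"
    using g st F ba by (auto simp: genv_def sieve_env_def)
  have loop: "wp (WHILE Var 9 < Var 3 \<oplus> Num 1 DO visit_com) (\<lambda>v' a' n'. genv v' a' \<and> (\<forall>j\<in>{1..R}. kst a' j) \<and>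
      (\<forall>i<R. a' 13 i = card (recorded (Pof (a' 3)) (N + i))) \<and>
      (\<forall>j\<in>{1..R}. before j (a' 3 j) (N + R) \<and> after j (a' 3 j) (N + R)) \<and>
      n' + (\<Sum>j\<in>{1..R}. apot a j) \<le> n + (\<Sum>j\<in>{1..R}. apot a' j) + 600 * R + 100) (v(9 := 1)) a (Suc (Suc (Suc n)))"
  proof (rule wp_While[where I = ?I and f = "\<lambda>v' a'. R + 1 - v' 9"], goal_cases)
    case 1
    show ?case by (rule I0)
  next
    case (2 v' a' n')
    then show ?case by simp
  next
    case (3 v' a' n')
    have fr: "\<forall>y. y \<notin> {9,10,11,12,13,14,15,16,17,18,19,20,21,22,23,25,26,27} \<longrightarrow> v' y = v y"
      using 3(1) by (simp add: frame_def mv)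
    define k where "k = v' 9"
    have I: "1 \<le> k" "genv v' a'" "\<forall>j\<in>{1..R}. kst a' j"
      "\<forall>i<R. a' 13 i = card (recorded (Pof (a' 3)) (N + i))"
      "\<forall>j\<in>{1..R}. j < k \<longrightarrow> before j (a' 3 j) (N + R) \<and> after j (a' 3 j) (N + R)"
      "\<forall>j\<in>{1..R}. k \<le> j \<longrightarrow> before j (a' 3 j) N \<and> after j (a' 3 j) N"
      "n' + (\<Sum>j\<in>{1..R}. apot a j) \<le> n + (\<Sum>j\<in>{1..R}. apot a' j) + 600 * (k - 1) + 10"
      using 3(2) unfolding k_def by blast+
    have kR: "k \<le> R" using 3(3) I(2) by (simp add: genv_def k_def)
    have N': "v' 7 = N" "v' 8 = N + R" using fr N by auto
    have kin: "k \<in> {1..R}" using I(1) kR by simp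
    have ba': "before k (a' 3 k) N" "after k (a' 3 k) N" using I(6) kin by auto
    show ?case
    proof (rule visit_spec[OF I(2) N' N(3,4) k_def[symmetric] I(1) kR I(3,4) ba'], goal_cases)
      case (1 v2 a2 n2)
      have sm: "(\<Sum>j\<in>{1..R}. apot a2 j) + apot a' k = (\<Sum>j\<in>{1..R}. apot a' j) + apot a2 k"
        using 1(6) by (intro sum_apot_upd[OF kin]) blast
      have t: "Suc n2 + (\<Sum>j\<in>{1..R}. apot a j) \<le> n + (\<Sum>j\<in>{1..R}. apot a2 j) + 600 * k + 10"
        using 1(9) sm I(7) I(1) by (simp add: algebra_simps)
      have b1: "\<forall>j\<in>{1..R}. j < Suc k \<longrightarrow> before j (a2 3 j) (N + R) \<and> after j (a2 3 j) (N + R)"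
        using I(5) 1(6,7,8) by (metis less_Suc_eq)
      have b2: "\<forall>j\<in>{1..R}. Suc k \<le> j \<longrightarrow> before j (a2 3 j) N \<and> after j (a2 3 j) N"
        using I(6) 1(6) by (metis Suc_leD not_less_eq_eq order_refl)
      show ?case using 1(2,3,4,5) t b1 b2 I(1) kR by (simp add: k_def[symmetric])
    qed
  next
    case (4 v' a' n')
    have I: "v' 9 \<le> R + 1" "genv v' a'" "\<forall>j\<in>{1..R}. kst a' j"
      "\<forall>i<R. a' 13 i = card (recorded (Pof (a' 3)) (N + i))"
      "\<forall>j\<in>{1..R}. j < v' 9 \<longrightarrow> before j (a' 3 j) (N + R) \<and> after j (a' 3 j) (N + R)"
      "n' + (\<Sum>j\<in>{1..R}. apot a j) \<le> n + (\<Sum>j\<in>{1..R}. apot a' j) + 600 * (v' 9 - 1) + 10"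
      using 4(2) by blast+
    have "v' 9 = R + 1" using 4(3) I(1,2) by (simp add: genv_def)
    then show ?case using I by auto
  qed
  have assign: "wp (9 ::= Num 1) Q2 v a n" if "Q2 (v(9 := 1)) a (Suc (Suc (Suc n)))" for Q2
    using that U_ge by simp
  show "wp visits_com (\<lambda>v' a' n'. genv v' a' \<and> (\<forall>j\<in>{1..R}. kst a' j) \<and>
      (\<forall>i<R. a' 13 i = card (recorded (Pof (a' 3)) (N + i))) \<and>
      (\<forall>j\<in>{1..R}. before j (a' 3 j) (N + R) \<and> after j (a' 3 j) (N + R)) \<and>
      n' + (\<Sum>j\<in>{1..R}. apot a j) \<le> n + (\<Sum>j\<in>{1..R}. apot a' j) + 600 * R + 100) v a n"
    unfolding visits_com_def wp_Seq by (rule assign) (rule loop)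
qed (use Q in blast)

definition hup :: "nat \<Rightarrow> nat \<Rightarrow> nat" where
  "hup N h = card {n. 1 \<le> n \<and> n < N \<and> n \<le> x \<and> consec_prime_reps n = h}"

lemma hup_Suc: "hup (Suc N) h = hup N h + of_bool (1 \<le> N \<and> N \<le> x \<and> consec_prime_reps N = h)"
proof -
  let ?A = "\<lambda>N. {n. 1 \<le> n \<and> n < N \<and> n \<le> x \<and> consec_prime_reps n = h}"
  have fin: "finite (?A N)" by (rule finite_subset[of _ "{..x}"]) auto
  have "?A (Suc N) = (if 1 \<le> N \<and> N \<le> x \<and> consec_prime_reps N = h then insert N (?A N) else ?A N)"
    by (auto simp: less_Suc_eq)
  then show ?thesis using fin by (auto simp: hup_def)
qed

lemma hup_le: "hup N h \<le> x"
proof -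
  have "hup N h \<le> card {1..x}" unfolding hup_def by (intro card_mono) auto
  then show ?thesis by simp
qed

lemma tally_spec:
  assumes v: "v 3 = R" "v 7 = N" "v 0 = x" and N: "1 \<le> N" "N \<le> x"
    and F: "\<forall>i<R. a 13 i \<le> R" "\<forall>i<R. N + i \<le> x \<longrightarrow> a 13 i = consec_prime_reps (N + i)"
    and H: "\<forall>h. a 14 h = hup N h"
    and Q: "\<And>v' a' n'. frame tally_com v a v' a' \<Longrightarrow> \<forall>h. a' 14 h = hup (N + R) h \<Longrightarrow>
      n' \<le> n + 100 * R + 100 \<Longrightarrow> Q v' a' n'"
  shows "wp tally_com Q v a n"
proof (rule wp_frame)
  let ?I = "\<lambda>v' a' n'. v' 23 \<le> R \<and> (\<forall>h. a' 14 h = hup (N + v' 23) h) \<and> n' \<le> n + 10 + 100 * v' 23"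
  show "wp tally_com (\<lambda>v' a' n'. (\<forall>h. a' 14 h = hup (N + R) h) \<and> n' \<le> n + 100 * R + 100) v a n"
    unfolding tally_com_def
    apply simp
  proof (rule wp_While[where I = ?I and f = "\<lambda>v' a'. R - v' 23"], goal_cases)
    case 1
    then show ?case using H by simp
  next
    case (3 v' a' n')
    have fr: "v' 3 = R" "v' 7 = N" "v' 0 = x" "a' 13 = a 13" using 3(1) v by (simp_all add: frame_def)
    define i where "i = v' 23"
    have i: "i < R" using 3(3) fr by (simp add: i_def)
    have b: "Suc i \<le> U" "i < L" "a 13 i < Lw" "a 13 i < L" using R_le U_ge F(1) i by (auto simp: Lw_def L_def i_def)
    have I: "\<forall>h. a' 14 h = hup (N + i) h" "n' \<le> n + 10 + 100 * i" using 3(2) by (auto simp: i_def)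
    have U1: "Suc (hup (N + i) h) \<le> U" for h using hup_le[of "N + i" h] U_ge by linarith
    show ?case
    proof (cases "N + i \<le> x")
      case True
      then have "a 13 i = consec_prime_reps (N + i)" using F(2) i by simp
      then show ?thesis using fr b I U1 i N True
        by (auto simp: wok_def i_def[symmetric] hup_Suc)
    next
      case False
      then show ?thesis using fr b I i by (simp add: i_def[symmetric] hup_Suc)
    qed
  next
    case (4 v' a' n')
    have "v' 3 = R" using 4(1) v by (simp add: frame_def)
    then show ?case using 4 by auto
  qed auto
qed (use Q in blast)

text \<open>\<open>k\<close> distinct naturals sum to at least 0 + ... + (k - 1). For
  \<open>k > R\<close> this would give \<open>(R + 1) * R \<le> 2 * x \<le> R * R\<close>.\<close>

lemma card_le_R:
  assumes "consecutive_primes S" "\<Sum>S \<le> x"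
  shows "card S \<le> R"
proof (rule ccontr)
  assume "\<not> card S \<le> R"
  then have R: "R < card S" by simp
  note S = consecutive_primesD[OF assms(1)]
  have "(\<Sum>i<card S. i) \<le> \<Sum>S" 
  proof -
    have "\<Sum>{0..<card S} \<le> \<Sum>S" using S(1)
    proof (induction "card S" arbitrary: S)
      case (Suc n)
      define M where "M = Max S"
      have ne: "S \<noteq> {}" using Suc(2) by auto
      have M: "M \<in> S" using Suc(3) ne by (auto simp: M_def)
      have "S \<subseteq> {..M}" using Suc(3) by (auto simp: M_def)
      then have "card S \<le> Suc M" using card_mono[of "{..M}" S] by simp
      moreover have c: "n = card (S - {M})" using Suc(2,3) M by simp
      then have "\<Sum>{0..<n} \<le> \<Sum>(S - {M})"
        using Suc(1)[OF c] Suc(3) by simp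
      moreover have "\<Sum>S = M + \<Sum>(S - {M})" using M Suc(3) by (simp add: sum.remove)
      ultimately show ?case using Suc(2)[symmetric] by simp
    qed simp
    then show ?thesis by (simp add: atLeast0LessThan)
  qed
  moreover have "2 * (\<Sum>i<card S. i) = card S * (card S - 1)"
    using gauss_sum_nat[of "card S - 1"] R by (cases "card S") (auto simp: lessThan_Suc_atMost atMost_atLeast0)
  moreover have "(R + 1) * R \<le> card S * (card S - 1)" using R by (intro mult_le_mono) auto
  ultimately have "(R + 1) * R \<le> 2 * x" using assms(2) by linarith
  then show False using R_ge R_ge2 by simp
qed

lemma segment_spec:
  assumes g: "genv v a" and N: "v 7 = N" "1 \<le> N" "N \<le> x"
    and st: "\<forall>j\<in>{1..R}. kst a j"
    and ba: "\<forall>j\<in>{1..R}. before j (a 3 j) N \<and> after j (a 3 j) N"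
    and H: "\<forall>h. a 14 h = hup N h"
    and Q: "\<And>v' a' n'. frame segment_com v a v' a' \<Longrightarrow> v' 7 = N + R \<Longrightarrow> genv v' a' \<Longrightarrow> \<forall>j\<in>{1..R}. kst a' j \<Longrightarrow>
      \<forall>j\<in>{1..R}. before j (a' 3 j) (N + R) \<and> after j (a' 3 j) (N + R) \<Longrightarrow>
      \<forall>h. a' 14 h = hup (N + R) h \<Longrightarrow>
      n' + (\<Sum>j\<in>{1..R}. apot a j) \<le> n + (\<Sum>j\<in>{1..R}. apot a' j) + 900 * R \<Longrightarrow> Q v' a' n'"
  shows "wp segment_com Q v a n"
proof (rule wp_frame)
  have vR: "v 3 = R" "v 0 = x" using g by (auto simp: genv_def)
  let ?Q = "\<lambda>v' a' n'. v' 7 = N + R \<and> genv v' a' \<and> (\<forall>j\<in>{1..R}. kst a' j) \<and>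
      (\<forall>j\<in>{1..R}. before j (a' 3 j) (N + R) \<and> after j (a' 3 j) (N + R)) \<and>
      (\<forall>h. a' 14 h = hup (N + R) h) \<and>
      n' + (\<Sum>j\<in>{1..R}. apot a j) \<le> n + (\<Sum>j\<in>{1..R}. apot a' j) + 900 * R"
  have NRU: "N + R \<le> U" using N R_le U_ge by linarith
  have a1: "wp (8 ::= Var 7 \<oplus> Var 3) Q2 v a n" if "Q2 (v(8 := N + R)) a (7 + n)" for Q2
    using that vR N NRU by simp
  have kst_eq: "kst a2 j \<longleftrightarrow> kst a1 j" if "\<forall>A. A \<notin> {13, 14} \<longrightarrow> a2 A = a1 A" for a1 a2 j
    using that by (simp add: kst_def)
  have apot_eq: "apot a2 j = apot a1 j" if "\<forall>A. A \<notin> {13, 14} \<longrightarrow> a2 A = a1 A" for a1 a2 j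
    using that by (simp add: apot_def)
  show "wp segment_com ?Q v a n"
    unfolding segment_com_def wp_Seq
  proof (rule a1, rule clear_spec, goal_cases)
    case 1
    show ?case using vR by simp
  next
    case (2 v1 a1 n1)
    have f1: "\<forall>y. y \<notin> {8, 23} \<longrightarrow> v1 y = v y" "v1 8 = N + R" "\<forall>A. A \<noteq> 13 \<longrightarrow> a1 A = a A"
      using 2(1) by (auto simp: frame_def clear_com_def)
    have g1: "genv v1 a1" using g f1 by (simp add: genv_def sieve_env_def)
    have f13: "\<forall>A. A \<notin> {13, 14} \<longrightarrow> a1 A = a A" using f1 by auto
    \<comment> \<open>All runs passed so far have sums below \<open>N\<close>, so cleared counters
      are correct for the new segment.\<close>
    have emp: "recorded (Pof (a 3)) (N + i) = {}" for i
    proof (rule ccontr)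
      assume "recorded (Pof (a 3)) (N + i) \<noteq> {}"
      then obtain S where S: "consecutive_primes S" "\<Sum>S = N + i" "Min S < Pof (a 3) (card S)"
        by (auto simp: recorded_def)
      then have "card S \<in> {1..R}" "Min S < a 3 (card S)" by (auto simp: Pof_def split: if_splits)
      then show False using ba S unfolding before_def by force
    qed
    show ?case
    proof (rule visits_spec[OF g1 _ f1(2) N(2,3)], goal_cases)
      case 1
      show ?case using f1 N by simp
    next
      case 2
      show ?case using st kst_eq[OF f13] by simp
    next
      case 3
      show ?case using \<open>\<forall>i<R. a1 13 i = 0\<close> emp f1 by simp
    next
      case 4
      show ?case using ba f1 by simp
    next
      case (5 v2 a2 n2)
      have f2: "v2 7 = N" "v2 8 = N + R" "a2 14 = a 14"
        using 5(1) f1 N by (simp_all add: frame_def visits_com_def visit_com_def load_com_def save_com_def scan_com_def advA_com_def advB_com_def refill_frame_defs)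
      have v2: "v2 3 = R" "v2 0 = x" using 5(2) by (auto simp: genv_def)
      have FR: "\<forall>i<R. a2 13 i \<le> R" using 5(4) card_recorded_le[of R "Pof (a2 3)"] by (simp add: Pof_def)
      have Freps: "a2 13 i = consec_prime_reps (N + i)" if i: "i < R" "N + i \<le> x" for i
      proof -
        \<comment> \<open>A run still ahead of its window would have a sum beyond the segment or
          above \<open>x\<close>, so the counters are complete.\<close>
        have "recorded (Pof (a2 3)) (N + i) = {S. consecutive_primes S \<and> \<Sum>S = N + i}"
        proof (intro equalityI subsetI)
          fix S assume S: "S \<in> {S. consecutive_primes S \<and> \<Sum>S = N + i}"
          then have "card S \<le> R" using card_le_R i by auto
          moreover have "card S \<ge> 1" using S consecutive_primesD(1,2)[of S] by (simp add: Suc_le_eq card_gt_0_iff)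
          moreover have "Min S < a2 3 (card S)"
          proof (rule ccontr)
            assume "\<not> Min S < a2 3 (card S)"
            then have "N + R \<le> \<Sum>S \<or> x < \<Sum>S"
              using 5(5) S calculation unfolding after_def by force
            then show False using S i by auto
          qed
          ultimately show "S \<in> recorded (Pof (a2 3)) (N + i)" using S by (simp add: recorded_def Pof_def)
        qed (auto simp: recorded_def)
        then show ?thesis using 5(4) i by (simp add: consec_prime_reps_def)
      qed
      have H2: "\<forall>h. a2 14 h = hup N h" using H f2 by simp
      show ?case
      proof (rule tally_spec[OF v2(1) f2(1) v2(2) N(2,3) FR _ H2], goal_cases)
        case 1
        show ?case using Freps by blast
      next
        case (2 v3 a3 n3)
        have f3: "\<forall>y. y \<noteq> 23 \<longrightarrow> v3 y = v2 y" "\<forall>A. A \<noteq> 14 \<longrightarrow> a3 A = a2 A"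
          using 2(1) by (simp_all add: frame_def tally_com_def)
        have f314: "\<forall>A. A \<notin> {13, 14} \<longrightarrow> a3 A = a2 A" using f3 by auto
        have g3: "genv (v3(7 := N + R)) a3" using 5(2) f3 by (simp add: genv_def sieve_env_def)
        have "n3 + 4 + (\<Sum>j\<in>{1..R}. apot a j) \<le> n + (\<Sum>j\<in>{1..R}. apot a3 j) + 900 * R"
          using 2(3) 5(6) \<open>n1 \<le> _\<close> R_ge2 by (simp add: apot_eq[OF f13] apot_eq[OF f314])
        then show ?case using f3 f2 g3 NRU 5(3,5) 2(2) kst_eq[OF f314] by simp
      qed
    qed
  qed
qed (use Q in blast)

text \<open>Outside the potential a segment of \<open>R\<close> numbers costs O(R), a constant per
  number. The last segment may overrun \<open>x\<close>, hence \<open>x + R\<close>.\<close>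

lemma main_spec:
  assumes g: "genv v a"
    and st: "\<forall>j\<in>{1..R}. kst a j"
    and ba: "\<forall>j\<in>{1..R}. a 3 j = 0"
    and H: "\<forall>h. a 14 h = 0"
    and Q: "\<And>v' a' n'. v' 1 = R + 1 \<Longrightarrow> \<forall>h. histogram x h = (if h < R + 1 then a' 14 h else 0) \<Longrightarrow>
      \<forall>j\<in>{1..R}. kst a' j \<Longrightarrow>
      n' \<le> n + (\<Sum>j\<in>{1..R}. apot a' j) + 1000 * (x + R) + 100 \<Longrightarrow> Q v' a' n'"
  shows "wp main_com Q v a n"
proof -
  let ?I = "\<lambda>v' a' n'. 1 \<le> v' 7 \<and> v' 7 \<le> x + R \<and> genv v' a' \<and> (\<forall>j\<in>{1..R}. kst a' j) \<and>
      (\<forall>j\<in>{1..R}. before j (a' 3 j) (v' 7) \<and> after j (a' 3 j) (v' 7)) \<and>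
      (\<forall>h. a' 14 h = hup (v' 7) h) \<and>
      n' \<le> n + (\<Sum>j\<in>{1..R}. apot a' j) + 950 * (v' 7 - 1) + 10"
  have sum1: "1 \<le> \<Sum>S" if "consecutive_primes S" for S
  proof -
    note S = consecutive_primesD[OF that]
    have "Min S \<le> \<Sum>S" using S by (intro member_le_sum) auto
    then show ?thesis using prime_ge_1_nat[OF S(4)] by linarith
  qed
  have hup1: "hup (Suc 0) h = 0" for h by (simp add: hup_def)
  have I0: "?I (v(7 := 1)) a (Suc (Suc (Suc n)))"
    using g st ba H x0 sum1 hup1 R_ge2 by (auto simp: genv_def sieve_env_def before_def after_def)
  have a1: "wp (7 ::= Num 1) Q2 v a n" if "Q2 (v(7 := 1)) a (Suc (Suc (Suc n)))" for Q2
    using that U_ge by simp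
  show ?thesis unfolding main_com_def wp_Seq
  proof (rule a1, rule wp_While[where I = ?I and f = "\<lambda>v' a'. x + R + 1 - v' 7"], goal_cases)
    case 1
    show ?case by (rule I0)
  next
    case (2 v' a' n')
    then show ?case by simp
  next
    case (3 v' a' n')
    define N where "N = v' 7"
    have I: "1 \<le> N" "genv v' a'" "\<forall>j\<in>{1..R}. kst a' j"
      "\<forall>j\<in>{1..R}. before j (a' 3 j) N \<and> after j (a' 3 j) N"
      "\<forall>h. a' 14 h = hup N h"
      "n' \<le> n + (\<Sum>j\<in>{1..R}. apot a' j) + 950 * (N - 1) + 10"
      using 3(2) unfolding N_def by blast+
    have Nx: "N \<le> x" using 3(3) I(2) by (simp add: genv_def N_def)
    show ?case
    proof (rule segment_spec[OF I(2) N_def[symmetric] I(1) Nx I(3,4,5)], goal_cases)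
      case (1 v2 a2 n2)
      have "N + R - 1 = (N - 1) + R" using I(1) by simp
      then have "950 * (N + R - 1) = 950 * (N - 1) + 950 * R" by simp
      then have "Suc n2 \<le> n + (\<Sum>j\<in>{1..R}. apot a2 j) + 950 * (N + R - 1) + 10"
        using 1(7) I(6) R_ge2 by simp
      then show ?case using 1(2-6) I(1) Nx R_ge2 by (simp add: N_def[symmetric])
    qed
  next
    case (4 v' a' n')
    define N where "N = v' 7"
    have I: "N \<le> x + R" "genv v' a'" "\<forall>j\<in>{1..R}. kst a' j"
      "\<forall>h. a' 14 h = hup N h"
      "n' \<le> n + (\<Sum>j\<in>{1..R}. apot a' j) + 950 * (N - 1) + 10"
      using 4(2) unfolding N_def by blast+
    have Nx: "x < N" using 4(3) I(2) by (simp add: genv_def N_def)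
    have hh: "histogram x h = a' 14 h" for h
    proof -
      have "{n. 1 \<le> n \<and> n < N \<and> n \<le> x \<and> consec_prime_reps n = h} = {n. 1 \<le> n \<and> n \<le> x \<and> consec_prime_reps n = h}"
        using Nx by auto
      then show ?thesis using I(4) by (simp add: hup_def histogram_def)
    qed
    have h0: "histogram x h = 0" if "h > R" for h
    proof -
      have "consec_prime_reps n \<le> R" if "n \<le> x" for n
      proof -
        \<comment> \<open>The least prime of a run is at most its sum, so with threshold
          \<open>Suc n\<close> all representations count as recorded and
          \<open>card_recorded_le\<close> applies.\<close>
        have "{S. consecutive_primes S \<and> \<Sum>S = n} = recorded (\<lambda>k. if k \<le> R then Suc n else 0) n"
        proof -
          have "Min S < (if card S \<le> R then Suc n else 0)" if S: "consecutive_primes S" "\<Sum>S = n" for S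
          proof -
            note D = consecutive_primesD[OF S(1)]
            have "Min S \<le> \<Sum>S" using D by (intro member_le_sum) auto
            then show ?thesis using card_le_R[OF S(1)] S \<open>n \<le> x\<close> by simp
          qed
          then show ?thesis unfolding recorded_def by blast
        qed
        then show ?thesis unfolding consec_prime_reps_def by (simp add: card_recorded_le)
      qed
      then have "{n. 1 \<le> n \<and> n \<le> x \<and> consec_prime_reps n = h} = {}" using that by force
      then show ?thesis by (simp add: histogram_def)
    qed
    have "R + 1 \<le> U" using R_le U_ge by linarith
    moreover have "n' + 20 \<le> n + (\<Sum>j\<in>{1..R}. apot a' j) + 1000 * (x + R) + 100"
      using I(1,5) by simp
    moreover have "v' 3 = R" using I(2) by (simp add: genv_def)
    ultimately show ?case using I(3) hh h0 by (auto intro!: Q)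
  qed
qed

end

section \<open>Initialisation\<close>

definition sizes_com :: com where
  "sizes_com =
    (2 ::= Num 0 ;; WHILE Var 2 \<otimes> Var 2 \<otimes> Var 2 < Var 0 DO 2 ::= Var 2 \<oplus> Num 1 ;;
     3 ::= Num 0 ;; WHILE Var 3 \<otimes> Var 3 < Num 2 \<otimes> Var 0 DO 3 ::= Var 3 \<oplus> Num 1 ;;
     4 ::= Num 512 \<otimes> Var 2 \<otimes> Var 2 \<oplus> Num 1)"

text \<open>Multiples of every \<open>i\<close> are struck, prime or not. The cost
  O(\<open>T\<close> log \<open>T\<close>) is affordable because the table is so short.\<close>

definition table_com :: com where
  "table_com =
    (0\<langle>Num 0\<rangle> ::= Num 1 ;; 0\<langle>Num 1\<rangle> ::= Num 1 ;; 23 ::= Num 2 ;;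
     WHILE Var 23 < Var 4 DO
       (24 ::= Var 23 \<oplus> Var 23 ;;
        WHILE Var 24 < Var 4 DO (0\<langle>Var 24\<rangle> ::= Num 1 ;; 24 ::= Var 24 \<oplus> Var 23) ;;
        23 ::= Var 23 \<oplus> Num 1))"

definition wheel_com :: com where
  "wheel_com =
    (5 ::= Num 1 ;; 6 ::= Num 1 ;;
     WHILE Var 6 \<otimes> (Var 5 \<oplus> Num 1) < Var 2 \<oplus> Num 1 DO
       (5 ::= Var 5 \<oplus> Num 1 ;; 6 ::= Var 6 \<otimes> Var 5))"

definition residues_com :: com where
  "residues_com =
    (23 ::= Num 2 ;;
     WHILE Var 23 < Var 5 \<oplus> Num 1 DO
       (24 ::= Num 0 ;;
        WHILE Var 24 < Var 6 DO (1\<langle>Var 24\<rangle> ::= Num 1 ;; 24 ::= Var 24 \<oplus> Var 23) ;;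
        23 ::= Var 23 \<oplus> Num 1))"

text \<open>Runs downwards from \<open>W\<close>, whose successor is rough: the distance is 1 if the
  next number is rough and otherwise one more than the distance from there.\<close>

definition gaps_com :: com where
  "gaps_com =
    (23 ::= Var 6 ;; 28 ::= Num 1 ;;
     WHILE Num 0 < Var 23 DO
       (IF Arr 1 (Var 23 \<odot> Var 6) < Num 1 THEN 28 ::= Num 1 ELSE 28 ::= Var 28 \<oplus> Num 1 ;;
        23 ::= Var 23 \<ominus> Num 1 ;; 2\<langle>Var 23\<rangle> ::= Var 28))"

definition buffer_com :: com where
  "buffer_com =
    (19 ::= Num 0 ;; WHILE Var 19 \<otimes> Var 19 \<otimes> Var 9 < Var 0 DO 19 ::= Var 19 \<oplus> Num 1 ;;
     11\<langle>Var 9\<rangle> ::= Var 19 ;; 12\<langle>Var 9\<rangle> ::= Var 20 ;; 20 ::= Var 20 \<oplus> Var 19 \<oplus> Var 19)"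

definition heads_com :: com where
  "heads_com =
    (9 ::= Num 1 ;; 20 ::= Var 4 ;;
     WHILE Var 9 < Var 3 \<oplus> Num 1 DO
       (7\<langle>Var 9\<rangle> ::= Var 4 ;; 8\<langle>Var 9\<rangle> ::= Var 4 ;; 9\<langle>Var 9\<rangle> ::= Var 4 ;; 10\<langle>Var 9\<rangle> ::= Var 4 ;;
        IF Var 9 < Var 2 THEN buffer_com ELSE Skip ;;
        9 ::= Var 9 \<oplus> Num 1))"

definition puzzle_com :: com where
  "puzzle_com = (sizes_com ;; table_com ;; wheel_com ;; residues_com ;; gaps_com ;; heads_com ;; main_com)"

lemma wf_puzzle_com: "wf puzzle_com"
  by (simp add: puzzle_com_def sizes_com_def table_com_def wheel_com_def residues_com_def gaps_com_def
    buffer_com_def heads_com_def main_com_def segment_com_def visits_com_def tally_com_def clear_com_def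
    visit_com_def save_com_def load_com_def scan_com_def advA_com_def advB_com_def ensure_com_def
    refill_com_def strike_com_def strike_init_com_def fill_com_def)

lemma lits_puzzle_com: "lits puzzle_com \<subseteq> {0, 1, 2, 512}"
  by (simp add: puzzle_com_def sizes_com_def table_com_def wheel_com_def residues_com_def gaps_com_def
    buffer_com_def heads_com_def main_com_def segment_com_def visits_com_def tally_com_def clear_com_def
    visit_com_def save_com_def load_com_def scan_com_def advA_com_def advB_com_def ensure_com_def
    refill_com_def strike_com_def strike_init_com_def fill_com_def)

context puzzle
begin

section \<open>Roots and the shared prime table\<close>

lemma search_spec:
  assumes e: "\<And>i. eok e1 (v(y := i)) a \<and> eok e2 (v(y := i)) a"
    "\<And>i. eval e1 (v(y := i)) a = f i" "\<And>i. eval e2 (v(y := i)) a = b"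
    and l: "b \<le> f l" "\<And>d. d < l \<Longrightarrow> f d < b" "l \<le> U"
    and Q: "\<And>n'. n' \<le> n + (ecost e1 + ecost e2 + 10) * (l + 1) \<Longrightarrow> Q (v(y := l)) a n'"
  shows "wp (WHILE e1 < e2 DO y ::= Var y \<oplus> Num 1) Q (v(y := 0)) a n"
proof -
  let ?K = "ecost e1 + ecost e2 + 10"
  let ?I = "\<lambda>v' a' n'. a' = a \<and> v' = v(y := v' y) \<and> v' y \<le> l \<and> n' \<le> n + ?K * v' y"
  show ?thesis
  proof (rule wp_While[where I = ?I and f = "\<lambda>v' a'. l - v' y"], goal_cases)
    case 1
    show ?case by simp
  next
    case (2 v' a' n')
    then show ?case using e(1)[of "v' y"] by metis
  next
    case (3 v' a' n')
    define i where "i = v' y"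
    have v': "v' = v(y := i)" "a' = a" "i \<le> l" "n' \<le> n + ?K * i" using 3(2) by (auto simp: i_def)
    have "f i < b" using 3(3) unfolding v' e by simp
    then have il: "i < l" using l(1) v'(3) by (cases "i = l") auto
    then have "i + 1 \<le> U" using l(3) by simp
    then show ?case using il v'(4) unfolding v'(1,2) by (simp add: algebra_simps)
  next
    case (4 v' a' n')
    define i where "i = v' y"
    have v': "v' = v(y := i)" "a' = a" "i \<le> l" "n' \<le> n + ?K * i" using 4(2) by (auto simp: i_def)
    have "\<not> f i < b" using 4(3) unfolding v' e by simp
    then have il: "i = l" using l(2)[of i] v'(3) by (cases "i < l") auto
    show ?case unfolding v'(1,2) il by (rule Q) (use v'(4) il in simp)
  qed
qed

lemma sizes_spec:
  assumes v: "v 0 = x"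
    and Q: "\<And>n'. n' \<le> n + 30 * (c0 + R) + 200 \<Longrightarrow> Q (v(2 := c0, 3 := R, 4 := T)) a n'"
  shows "wp sizes_com Q v a n"
proof -
  have cU: "c0 \<le> U" "R \<le> U" "T \<le> U" using c0_le R_le U_ge T_L by linarith+
  have a1: "wp (2 ::= Num 0) Q2 v a n" if "Q2 (v(2 := 0)) a (Suc (Suc (Suc n)))" for Q2
    using that by simp
  have a2: "wp (3 ::= Num 0) Q2 v' a n'" if "Q2 (v'(3 := 0)) a (Suc (Suc (Suc n')))" for Q2 v' n'
    using that by simp
  show ?thesis unfolding sizes_com_def wp_Seq
  proof (rule a1, rule search_spec[where f = "\<lambda>c. c * c * c" and b = x and l = c0], goal_cases)
    case (7 n1)
    show ?case
    proof (rule a2, rule search_spec[where f = "\<lambda>r. r * r" and b = "2 * x" and l = R], goal_cases)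
      case (7 n2)
      have "512 * c0 * c0 + 1 = T" by (simp add: T_def)
      moreover have "wp (4 ::= Num 512 \<otimes> Var 2 \<otimes> Var 2 \<oplus> Num 1) Q2 (v(2 := c0, 3 := R)) a n2"
        if "512 * c0 * c0 + 1 = T" "\<And>n3. n3 \<le> n2 + 20 \<Longrightarrow> Q2 (v(2 := c0, 3 := R, 4 := T)) a n3" for Q2
        using that cU(3) by simp
      ultimately show ?case using 7 \<open>n1 \<le> _\<close> by (auto intro!: Q)
    qed (use v cU R_ge R_least in auto)
  qed (use v cU x_le_c0 c0_least in auto)
qed

text \<open>The marks of the table sieve before round \<open>i\<close>; 0 and 1 are marked by
  hand.\<close>

definition hasfac :: "nat \<Rightarrow> nat \<Rightarrow> bool" where
  "hasfac i q \<longleftrightarrow> q < 2 \<or> (\<exists>d e. 2 \<le> d \<and> d < i \<and> 2 \<le> e \<and> q = d * e)"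

lemma hasfac_Suc: "2 \<le> i \<Longrightarrow> hasfac (Suc i) q \<longleftrightarrow> hasfac i q \<or> (\<exists>e\<ge>2. q = i * e)"
  unfolding hasfac_def by (auto simp: less_Suc_eq)

lemma hasfac_prime:
  assumes "q < T"
  shows "hasfac T q \<longleftrightarrow> \<not> prime q"
proof
  assume "hasfac T q"
  then show "\<not> prime q" unfolding hasfac_def by (auto dest: prime_ge_2_nat prime_product)
next
  assume np: "\<not> prime q"
  show "hasfac T q"
  proof (cases "q < 2")
    case False
    then obtain d where d: "d dvd q" "d \<noteq> 1" "d \<noteq> q" using np by (auto simp: prime_nat_iff)
    then obtain e where e: "q = d * e" by auto
    have "d \<ge> 2" "e \<ge> 2" using d e False by (cases d; cases e; auto)+
    moreover have "d < T" using assms d False by (metis dvd_imp_le le_less_trans less_le_trans zero_less_numeral not_less)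
    ultimately show ?thesis unfolding hasfac_def using e by blast
  qed (simp add: hasfac_def)
qed

definition table_time :: nat where
  "table_time = (\<Sum>i=2..<T. T div i + 2)"

lemma table_spec:
  assumes v: "v 4 = T" and a0: "\<forall>q. a 0 q = 0"
    and Q: "\<And>v' a' n'. frame table_com v a v' a' \<Longrightarrow> table (a' 0) \<Longrightarrow> n' \<le> n + 100 * table_time + 100 \<Longrightarrow> Q v' a' n'"
  shows "wp table_com Q v a n"
proof (rule wp_frame)
  let ?I = "\<lambda>v' a' n'. 2 \<le> v' 23 \<and> v' 23 \<le> T \<and> (\<forall>q<T. a' 0 q = of_bool (hasfac (v' 23) q)) \<and>
      n' \<le> n + 50 + 100 * (\<Sum>i=2..<v' 23. T div i + 2)"
  have T2: "T \<ge> 2" using c0_ge1 by (simp add: T_def)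
  have UT: "2 * T \<le> U" "Suc T \<le> U" using T_L by (auto simp: U_def)
  have pre0: "wp (0\<langle>Num 0\<rangle> ::= Num 1) (\<lambda>v a n. wp (0\<langle>Num 1\<rangle> ::= Num 1) (\<lambda>v a n. wp (23 ::= Num 2) Q2 v a n) v a n) v a n"
    if "\<And>n1. n1 \<le> n + 30 \<Longrightarrow> Q2 (v(23 := 2)) (a(0 := (a 0)(0 := 1, Suc 0 := 1))) n1" for Q2
    using that T_L T2 UT by (simp add: wok_def)
  have "wp (WHILE Var 23 < Var 4 DO
       (24 ::= Var 23 \<oplus> Var 23 ;;
        WHILE Var 24 < Var 4 DO (0\<langle>Var 24\<rangle> ::= Num 1 ;; 24 ::= Var 24 \<oplus> Var 23) ;;
        23 ::= Var 23 \<oplus> Num 1))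
    (\<lambda>v' a' n'. table (a' 0) \<and> n' \<le> n + 100 * table_time + 100) (v(23 := 2)) (a(0 := (a 0)(0 := 1, Suc 0 := 1))) n1"
    if n1: "n1 \<le> n + 30" for n1
  proof (rule wp_While[where I = ?I and f = "\<lambda>v' a'. T - v' 23"], goal_cases)
    case 1
    then show ?case using a0 T2 n1 by (auto simp: hasfac_def less_2_cases_iff)
  next
    case (2 v' a' n')
    then show ?case by simp
  next
    case (3 v' a' n')
    have fr: "v' 4 = T" using 3(1) v by (simp add: frame_def)
    define i where "i = v' 23"
    have I: "2 \<le> i" "i < T" "\<forall>q<T. a' 0 q = of_bool (hasfac i q)"
      "n' \<le> n + 50 + 100 * (\<Sum>i=2..<i. T div i + 2)" using 3(2,3) fr by (auto simp: i_def)
    let ?J = "\<lambda>v'' a'' n''. (\<exists>e\<ge>2. v'' 24 = i * e) \<and> v'' 24 \<le> T + i \<and>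
       (\<forall>q<T. a'' 0 q = of_bool (hasfac i q \<or> (\<exists>e\<ge>2. q = i * e \<and> q < v'' 24))) \<and>
       n'' \<le> n' + 20 + 40 * (v'' 24 div i)"
    have iU: "i + i \<le> U" using I UT by simp
    have inner: "wp (WHILE Var 24 < Var 4 DO (0\<langle>Var 24\<rangle> ::= Num 1 ;; 24 ::= Var 24 \<oplus> Var 23))
      (\<lambda>v'' a'' n''. v'' 23 = i \<and> (\<forall>q<T. a'' 0 q = of_bool (hasfac (Suc i) q)) \<and> n'' \<le> n' + 100 + 40 * (T div i))
      (v'(24 := i + i)) a' n1" if "n1 \<le> n' + 30" for n1
    proof (rule wp_While[where I = ?J and f = "\<lambda>v'' a''. T - v'' 24"], goal_cases)
      case 1
      have "i + i = i * 2" by simp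
      then have "(i + i) div i = 2" using I(1) by simp
      moreover have "\<not> (q < i + i \<and> (\<exists>e\<ge>2. q = i * e))" for q
      proof
        assume "q < i + i \<and> (\<exists>e\<ge>2. q = i * e)"
        then obtain e where e: "e \<ge> 2" "i * e < i + i" by auto
        have "i * 2 \<le> i * e" using e by (intro mult_le_mono2)
        then show False using e(2) by linarith
      qed
      ultimately show ?case using I that by (auto intro!: exI[of _ 2])
    next
      case (2 v2 a2 n2)
      then show ?case by simp
    next
      case (3 v2 a2 n2)
      have f2: "v2 4 = T" "v2 23 = i" using 3(1) fr by (auto simp: frame_def i_def)
      obtain e where e: "e \<ge> 2" "v2 24 = i * e" using 3(2) by auto
      have lt: "i * e < T" using 3(3) f2 e by simp
      have d1: "(i * e) div i = e" "(i * e + i) div i = Suc e" using I(1) by auto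
      have "\<exists>e'\<ge>2. i * e + i = i * e'" using e by (intro exI[of _ "Suc e"]) auto
      moreover have "(\<exists>e'\<ge>2. q = i * e' \<and> q < i * e + i) \<longleftrightarrow> (\<exists>e'\<ge>2. q = i * e' \<and> q < i * e) \<or> q = i * e" for q
      proof
        assume "\<exists>e'\<ge>2. q = i * e' \<and> q < i * e + i"
        then obtain e' where e': "e' \<ge> 2" "q = i * e'" "i * e' < i * Suc e" by auto
        then have "e' \<le> e" using I(1) by (simp only: mult_less_cancel1) auto
        then show "(\<exists>e'\<ge>2. q = i * e' \<and> q < i * e) \<or> q = i * e" using e' I(1) by (cases "e' = e") auto
      qed (use e I(1) in \<open>auto simp: trans_less_add1\<close>)
      moreover have "i * e + i \<le> U" using lt I UT by simp
      ultimately show ?case using 3(2) f2 e lt d1 T_L I(1) by (auto simp: wok_def)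
    next
      case (4 v2 a2 n2)
      have f2: "v2 4 = T" "v2 23 = i" using 4(1) fr by (auto simp: frame_def i_def)
      have ge: "T \<le> v2 24" "v2 24 \<le> T + i" using 4(2,3) f2 by auto
      have "v2 24 div i \<le> (T + i) div i" using ge(2) by (rule div_le_mono)
      also have "\<dots> = T div i + 1" using I(1) by simp
      finally have "n2 + 10 \<le> n' + 100 + 40 * (T div i)" using 4(2) by linarith
      then show ?case using 4(2) f2 ge by (auto simp: hasfac_Suc[OF I(1)])
    qed
    have pre: "wp (24 ::= Var 23 \<oplus> Var 23) Q2 v' a' n2" if "\<And>n1. n1 \<le> n2 + 10 \<Longrightarrow> Q2 (v'(24 := i + i)) a' n1" for Q2 n2
      using that iU by (simp add: i_def)
    show ?case unfolding wp_Seq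
    proof (rule pre, rule wp_mono[OF inner], goal_cases)
      case (1 n1)
      then show ?case by simp
    next
      case (2 n1 v2 a2 n2)
      have "(\<Sum>i=2..<Suc i. T div i + 2) = (\<Sum>i=2..<i. T div i + 2) + (T div i + 2)"
        using I(1) by (simp add: sum.atLeastLessThan_Suc)
      then show ?case using 2 I UT by (simp add: i_def[symmetric])
    qed
  next
    case (4 v' a' n')
    have fr: "v' 4 = T" using 4(1) v by (simp add: frame_def)
    have "v' 23 = T" using 4(2,3) fr by simp
    then show ?case using 4(2) hasfac_prime by (auto simp: table_def table_time_def)
  qed
  then show "wp table_com (\<lambda>v' a' n'. table (a' 0) \<and> n' \<le> n + 100 * table_time + 100) v a n"
    unfolding table_com_def wp_Seq by (intro pre0)
qed (use Q in blast)

section \<open>The tables of the wheel\<close>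

lemma w_unique: "1 \<le> y \<Longrightarrow> fact y \<le> c0 \<Longrightarrow> c0 < fact (Suc y) \<Longrightarrow> y = w"
  unfolding w_def
proof (rule Least_equality[symmetric])
  fix z assume a: "fact y \<le> c0" "c0 < fact (Suc z)"
  show "y \<le> z"
  proof (rule ccontr)
    assume "\<not> y \<le> z"
    then have "(fact (Suc z) :: nat) \<le> fact y" by (intro fact_mono) simp
    then show False using a by linarith
  qed
qed

lemma wheel_spec:
  assumes v: "v 2 = c0"
    and Q: "\<And>v' n'. frame wheel_com v a v' a \<Longrightarrow> v' 5 = w \<Longrightarrow> v' 6 = W \<Longrightarrow> n' \<le> n + 60 * c0 + 100 \<Longrightarrow> Q v' a n'"
  shows "wp wheel_com Q v a n"
proof (rule wp_frame)
  let ?I = "\<lambda>v' a' n'. a' = a \<and> 1 \<le> v' 5 \<and> v' 6 = fact (v' 5) \<and> fact (v' 5) \<le> c0 \<and> n' \<le> n + 20 + 50 * v' 5"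
  have cU: "Suc c0 \<le> U" using c0_le U_ge by linarith
  have pre0: "wp (5 ::= Num 1) (\<lambda>v a n. wp (6 ::= Num 1) Q2 v a n) v a n"
    if "\<And>n1. n1 \<le> n + 20 \<Longrightarrow> Q2 (v(5 := 1, 6 := 1)) a n1" for Q2
    using that cU by simp
  have "wp (WHILE Var 6 \<otimes> (Var 5 \<oplus> Num 1) < Var 2 \<oplus> Num 1 DO
       (5 ::= Var 5 \<oplus> Num 1 ;; 6 ::= Var 6 \<otimes> Var 5))
     (\<lambda>v' a' n'. a' = a \<and> v' 5 = w \<and> v' 6 = W \<and> n' \<le> n + 60 * c0 + 100) (v(5 := 1, 6 := 1)) a n1"
    if n1: "n1 \<le> n + 20" for n1
  proof (rule wp_While[where I = ?I and f = "\<lambda>v' a'. c0 + 1 - v' 5"], goal_cases)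
    case 1
    then show ?case using c0_ge1 n1 by simp
  next
    case (2 v' a' n')
    then show ?case by simp
  next
    case (3 v' a' n')
    have v2: "v' 2 = c0" using 3(1) v by (simp add: frame_def)
    define y where "y = v' 5"
    have I: "a' = a" "1 \<le> y" "v' 6 = fact y" "fact y \<le> c0" "n' \<le> n + 20 + 50 * y"
      using 3(2) by (auto simp: y_def)
    have lt: "fact (Suc y) \<le> c0" using 3(3) v2 I by (simp add: y_def[symmetric] algebra_simps)
    have "Suc y \<le> fact (Suc y)" by (rule fact_ge_self)
    then have yc: "Suc y \<le> c0" using lt by linarith
    have e: "fact y * Suc y = fact (Suc y)" by (simp add: algebra_simps)
    show ?case using I lt yc cU v2 by (simp add: y_def[symmetric] e del: fact_Suc mult_Suc_right) auto
  next
    case (4 v' a' n')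
    have v2: "v' 2 = c0" using 4(1) v by (simp add: frame_def)
    define y where "y = v' 5"
    have I: "a' = a" "1 \<le> y" "v' 6 = fact y" "fact y \<le> c0" "n' \<le> n + 20 + 50 * y"
      using 4(2) by (auto simp: y_def)
    have "c0 < fact (Suc y)" using 4(3) v2 I by (simp add: y_def[symmetric] algebra_simps)
    then have yw: "y = w" using w_unique I by simp
    have "y \<le> c0" using I(4) fact_ge_self[of y] by linarith
    then show ?case using I yw by (simp add: y_def[symmetric] W_def)
  qed
  then show "wp wheel_com (\<lambda>v' a' n'. a' = a \<and> v' 5 = w \<and> v' 6 = W \<and> n' \<le> n + 60 * c0 + 100) v a n"
    unfolding wheel_com_def wp_Seq by (intro pre0)
qed (use Q in blast)

lemma residues_spec:
  assumes v: "v 5 = w" "v 6 = W" and a0: "\<forall>q. a 1 q = 0"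
    and Q: "\<And>v' a' n'. frame residues_com v a v' a' \<Longrightarrow> \<forall>r<W. a' 1 r = of_bool (\<not> rough w r) \<Longrightarrow>
      n' \<le> n + 100 * ((w + 1) * (W + 1)) + 100 \<Longrightarrow> Q v' a' n'"
  shows "wp residues_com Q v a n"
proof (rule wp_frame)
  define tm where "tm = (\<lambda>i. 100 * ((i - 2) * (W + 1)))"
  have tm: "tm 2 = 0" "i \<ge> 2 \<Longrightarrow> tm (Suc i) = tm i + 100 * (W + 1)" "tm (Suc w) \<le> 100 * ((w + 1) * (W + 1))" for i
  proof -
    assume "i \<ge> 2"
    then have "Suc i - 2 = Suc (i - 2)" by simp
    then show "tm (Suc i) = tm i + 100 * (W + 1)" by (simp add: tm_def)
  next
    show "tm (Suc w) \<le> 100 * ((w + 1) * (W + 1))" unfolding tm_def by (intro mult_le_mono) auto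
  qed (simp add: tm_def)
  let ?I = "\<lambda>v' a' n'. 2 \<le> v' 23 \<and> v' 23 \<le> w + 1 \<and> (\<forall>r<W. a' 1 r = of_bool (\<not> rough (v' 23 - 1) r)) \<and>
      n' \<le> n + 20 + tm (v' 23)"
  have wx: "w + 3 \<le> U" "2 * c0 + 2 \<le> U" using w_le W_le c0_le U_ge by linarith+
  have WLw: "r < W \<Longrightarrow> r < Lw" for r using W_le unfolding Lw_def by linarith
  have r1: "rough (Suc 0) r" for r by (auto simp: rough_def)
  have pre0: "wp (23 ::= Num 2) Q2 v a n" if "\<And>n1. n1 \<le> n + 20 \<Longrightarrow> Q2 (v(23 := 2)) a n1" for Q2
    using that wx by simp
  have "wp (WHILE Var 23 < Var 5 \<oplus> Num 1 DO
       (24 ::= Num 0 ;;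
        WHILE Var 24 < Var 6 DO (1\<langle>Var 24\<rangle> ::= Num 1 ;; 24 ::= Var 24 \<oplus> Var 23) ;;
        23 ::= Var 23 \<oplus> Num 1)) (\<lambda>v' a' n'. (\<forall>r<W. a' 1 r = of_bool (\<not> rough w r)) \<and>
      n' \<le> n + 100 * ((w + 1) * (W + 1)) + 100) (v(23 := 2)) a n1" if n1: "n1 \<le> n + 20" for n1
  proof (rule wp_While[where I = ?I and f = "\<lambda>v' a'. w + 2 - v' 23"], goal_cases)
    case 1
    show ?case using a0 r1 n1 w_ge1 by (simp add: tm(1))
  next
    case (2 v' a' n')
    then show ?case by simp
  next
    case (3 v' a' n')
    have fr: "v' 5 = w" "v' 6 = W" using 3(1) v by (auto simp: frame_def)
    define i where "i = v' 23"
    have I: "2 \<le> i" "i \<le> w" "\<forall>r<W. a' 1 r = of_bool (\<not> rough (i - 1) r)"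
      "n' \<le> n + 20 + tm i" using 3(2,3) fr by (auto simp: i_def)
    have rs: "\<not> rough i r \<longleftrightarrow> \<not> rough (i - 1) r \<or> i dvd r" for r
    proof -
      have "{2..i} = insert i {2..i - 1}" using I(1) by auto
      then show ?thesis by (auto simp: rough_def)
    qed
    let ?J = "\<lambda>v'' a'' n''. i dvd v'' 24 \<and> v'' 24 \<le> W + i \<and>
       (\<forall>r<W. a'' 1 r = of_bool (\<not> rough (i - 1) r \<or> (i dvd r \<and> r < v'' 24))) \<and>
       n'' \<le> n' + 30 + 40 * v'' 24"
    have inner: "wp (WHILE Var 24 < Var 6 DO (1\<langle>Var 24\<rangle> ::= Num 1 ;; 24 ::= Var 24 \<oplus> Var 23))
      (\<lambda>v'' a'' n''. v'' 23 = i \<and> (\<forall>r<W. a'' 1 r = of_bool (\<not> rough i r)) \<and> n'' \<le> n' + 80 + 40 * (W + i))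
      (v'(24 := 0)) a' n1" if "n1 \<le> n' + 30" for n1
    proof (rule wp_While[where I = ?J and f = "\<lambda>v'' a''. W - v'' 24"], goal_cases)
      case 1
      show ?case using I that by auto
    next
      case (2 v2 a2 n2)
      then show ?case by simp
    next
      case (3 v2 a2 n2)
      have f2: "v2 6 = W" "v2 23 = i" using 3(1) fr by (auto simp: frame_def i_def)
      define j where "j = v2 24"
      have J: "i dvd j" "\<forall>r<W. a2 1 r = of_bool (\<not> rough (i - 1) r \<or> (i dvd r \<and> r < j))" "n2 \<le> n' + 30 + 40 * j"
        using 3(2) by (auto simp: j_def)
      have lt: "j < W" using 3(3) f2 by (simp add: j_def)
      have step: "i dvd r \<and> r < j + i \<longleftrightarrow> i dvd r \<and> r < j \<or> r = j" for r
      proof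
        assume r: "i dvd r \<and> r < j + i"
        show "i dvd r \<and> r < j \<or> r = j"
        proof (cases "r \<le> j")
          case False
          then have "i dvd r - j" "r - j < i" "r - j > 0" using r J(1) by (auto intro: dvd_diff_nat)
          then show ?thesis using dvd_imp_le[of i "r - j"] by simp
        qed (use r in auto)
      qed (use J(1) I(1) in auto)
      have "j + i \<le> U" using lt I W_le w_le wx by linarith
      moreover have "\<forall>r<W. ((a2 1)(j := 1)) r = of_bool (\<not> rough (i - 1) r \<or> (i dvd r \<and> r < j + i))"
        using J(1,2) by (auto simp: step)
      moreover have "1 \<le> U" using wx by simp
      ultimately show ?case using J(1,3) f2 lt WLw[OF lt] I(1) by (simp add: wok_def j_def[symmetric])
    next
      case (4 v2 a2 n2)
      have f2: "v2 6 = W" "v2 23 = i" using 4(1) fr by (auto simp: frame_def i_def)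
      have ge: "W \<le> v2 24" "v2 24 \<le> W + i" using 4(2,3) f2 by auto
      have "40 * v2 24 \<le> 40 * (W + i)" using ge(2) by (rule mult_le_mono2)
      then show ?case using 4(2) f2 ge(1) by (auto simp: rs)
    qed
    have pre: "wp (24 ::= Num 0) Q2 v' a' n2" if "\<And>n1. n1 \<le> n2 + 10 \<Longrightarrow> Q2 (v'(24 := 0)) a' n1" for Q2 n2
      using that by simp
    show ?case unfolding wp_Seq
    proof (rule pre, rule wp_mono[OF inner], goal_cases)
      case (1 n1)
      then show ?case by simp
    next
      case (2 n1 v2 a2 n2)
      have "i \<le> W" using I w_le by simp
      moreover have "W \<ge> 1" using W_pos by simp
      ultimately have "n2 + 7 \<le> n + 20 + tm (Suc i)" using 2 I(4) tm(2)[OF I(1)] by simp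
      then show ?case using 2 I wx by (simp add: i_def[symmetric])
    qed
  next
    case (4 v' a' n')
    have fr: "v' 5 = w" "v' 6 = W" using 4(1) v by (auto simp: frame_def)
    have "v' 23 = Suc w" using 4(2,3) fr by auto
    then show ?case using 4(2) tm(3) by simp
  qed
  then show "wp residues_com (\<lambda>v' a' n'. (\<forall>r<W. a' 1 r = of_bool (\<not> rough w r)) \<and>
      n' \<le> n + 100 * ((w + 1) * (W + 1)) + 100) v a n"
    unfolding residues_com_def wp_Seq by (intro pre0)
qed (use Q in blast)

definition gap :: "nat \<Rightarrow> nat \<Rightarrow> bool" where
  "gap m g \<longleftrightarrow> 0 < g \<and> rough w (m + g) \<and> (\<forall>d. 0 < d \<and> d < g \<longrightarrow> \<not> rough w (m + d))"

lemma rough_mod_W: "rough w (m mod W) \<longleftrightarrow> rough w m"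
  unfolding W_def by (rule rough_mod_fact)

text \<open>Some number congruent to 1 modulo \<open>W\<close> lies at distance at most
  \<open>W\<close> above \<open>m\<close>, and such numbers are rough.\<close>

lemma gap_le: "gap m g \<Longrightarrow> g \<le> W"
proof (rule ccontr)
  assume g: "gap m g" "\<not> g \<le> W"
  have m: "m = W * (m div W) + m mod W" "m mod W < W" using W_pos by auto
  show False
  proof (cases "m mod W = 0")
    case True
    have "rough w (m + 1)"
    proof -
      have "(m + 1) mod W = 1 mod W" using True by (metis mod_add_left_eq add.left_neutral)
      then have "rough w (m + 1) \<longleftrightarrow> rough w (1 mod W)" using rough_mod_W[of "m + 1"] by simp
      also have "\<dots> \<longleftrightarrow> rough w 1" by (rule rough_mod_W)
      finally show ?thesis by (auto simp: rough_def)
    qed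
    moreover have "1 < g" using g(2) W_pos by simp
    ultimately show False using g(1) by (auto simp: gap_def)
  next
    case False
    let ?d = "W + 1 - m mod W"
    have "W * (m div W + 1) = W * (m div W) + W" by simp
    then have "m + ?d = 1 + (m div W + 1) * W" using m unfolding mult.commute[of _ W] by linarith
    then have "rough w (m + ?d) \<longleftrightarrow> rough w 1"
      unfolding W_def using rough_add_mult_fact[of w 1 "m div fact w + 1"] by (simp only:)
    then have "rough w (m + ?d)" by (auto simp: rough_def)
    moreover have "0 < ?d" "?d < g" using False m(2) g(2) by auto
    ultimately show False using g(1) unfolding gap_def by blast
  qed
qed

lemma gap_mod: "gap (m mod W) g \<longleftrightarrow> gap m g"
proof -
  have "rough w (m mod W + d) \<longleftrightarrow> rough w (m + d)" for d
    by (metis mod_add_left_eq rough_mod_W)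
  then show ?thesis by (simp add: gap_def)
qed

lemma gaps_spec:
  assumes v: "v 6 = W" and a1: "\<forall>r<W. a 1 r = of_bool (\<not> rough w r)"
    and Q: "\<And>v' a' n'. frame gaps_com v a v' a' \<Longrightarrow> gapok (a' 2) \<Longrightarrow> n' \<le> n + 60 * W + 100 \<Longrightarrow> Q v' a' n'"
  shows "wp gaps_com Q v a n"
proof (rule wp_frame)
  let ?I = "\<lambda>v' a' n'. v' 23 \<le> W \<and> gap (v' 23) (v' 28) \<and> (\<forall>r. v' 23 \<le> r \<and> r < W \<longrightarrow> gap r (a' 2 r)) \<and>
     n' + 60 * v' 23 \<le> n + 60 * W + 20"
  have WU: "Suc W \<le> U" using W_le c0_le U_ge by linarith
  have WLw: "r < W \<Longrightarrow> r < Lw" "r < W \<Longrightarrow> r < L" for r using W_le unfolding Lw_def L_def by linarith+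
  have gW: "gap W 1"
  proof -
    have "rough w (1 + 1 * fact w)" using rough_add_mult_fact[of w 1 1] by (auto simp: rough_def)
    then have "rough w (W + 1)" by (simp add: W_def add.commute)
    then show ?thesis by (simp add: gap_def)
  qed
  have pre0: "wp (23 ::= Var 6) (\<lambda>v a n. wp (28 ::= Num 1) Q2 v a n) v a n"
    if "\<And>n1. n1 \<le> n + 20 \<Longrightarrow> Q2 (v(23 := W, 28 := 1)) a n1" for Q2
    using that WU v by simp
  have "wp (WHILE Num 0 < Var 23 DO
       (IF Arr 1 (Var 23 \<odot> Var 6) < Num 1 THEN 28 ::= Num 1 ELSE 28 ::= Var 28 \<oplus> Num 1 ;;
        23 ::= Var 23 \<ominus> Num 1 ;; 2\<langle>Var 23\<rangle> ::= Var 28))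
     (\<lambda>v' a' n'. gapok (a' 2) \<and> n' \<le> n + 60 * W + 100) (v(23 := W, 28 := 1)) a n1" if n1: "n1 \<le> n + 20" for n1
  proof (rule wp_While[where I = ?I and f = "\<lambda>v' a'. v' 23"], goal_cases)
    case 1
    show ?case using gW n1 by auto
  next
    case (2 v' a' n')
    then show ?case by simp
  next
    case (3 v' a' n')
    have fr: "v' 6 = W" "a' 1 = a 1" using 3(1) v by (auto simp: frame_def)
    define i where "i = v' 23"
    have I: "i \<le> W" "gap i (v' 28)" "\<forall>r. i \<le> r \<and> r < W \<longrightarrow> gap r (a' 2 r)" "n' + 60 * i \<le> n + 60 * W + 20"
      "i > 0" using 3(2,3) by (auto simp: i_def)
    have bit: "a 1 (i mod W) = of_bool (\<not> rough w i)" using a1 W_pos rough_mod_W[of i] by simp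
    have iL: "i mod W < L" "i - Suc 0 < Lw" using WLw I W_pos by auto
    have gnew: "gap (i - 1) (if rough w i then 1 else Suc (v' 28))"
    proof (cases "rough w i")
      case True
      then show ?thesis using I(5) by (simp add: gap_def)
    next
      case False
      have "\<not> rough w (i - 1 + d)" if "0 < d" "d < Suc (v' 28)" for d
      proof (cases "d = 1")
        case True
        then show ?thesis using False I(5) by simp
      next
        case d1: False
        then have "0 < d - 1" "d - 1 < v' 28" "i - 1 + d = i + (d - 1)" using that I(5) by auto
        then show ?thesis using I(2) unfolding gap_def by metis
      qed
      moreover have "rough w (i - 1 + Suc (v' 28))" using I(2,5) by (simp add: gap_def)
      ultimately show ?thesis using False by (simp add: gap_def)
    qed
    have all: "\<forall>r. i - Suc 0 \<le> r \<and> r < W \<longrightarrow> gap r (((a' 2)(i - Suc 0 := if rough w i then 1 else Suc (v' 28))) r)"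
      using I(3,5) gnew by auto
    have "v' 28 \<le> W" using gap_le[OF I(2)] .
    then show ?case using fr bit iL gnew all I WU
      by (cases "rough w i") (auto simp: wok_def i_def[symmetric])
  next
    case (4 v' a' n')
    have "gap r (a' 2 r)" if "r < W" for r using 4(2,3) that by auto
    then have gm: "gap m (a' 2 (m mod W))" for m using gap_mod W_pos by (metis mod_less_divisor)
    have "gapok (a' 2)" unfolding gapok_def
    proof
      fix m
      show "0 < a' 2 (m mod W) \<and> a' 2 (m mod W) \<le> W \<and> rough w (m + a' 2 (m mod W)) \<and>
         (\<forall>d. 0 < d \<and> d < a' 2 (m mod W) \<longrightarrow> \<not> rough w (m + d))"
        using gm[of m] gap_le[OF gm[of m]] unfolding gap_def by blast
    qed
    then show ?case using 4(2) by auto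
  qed
  then show "wp gaps_com (\<lambda>v' a' n'. gapok (a' 2) \<and> n' \<le> n + 60 * W + 100) v a n"
    unfolding gaps_com_def wp_Seq by (intro pre0)
qed (use Q in blast)

lemma buffer_spec:
  assumes v: "v 0 = x" "v 9 = k" "v 20 = bas k" and k: "1 \<le> k" "k < c0" "k \<le> R"
    and Q: "\<And>n'. n' \<le> n + 20 * ell k + 80 \<Longrightarrow>
      Q (v(19 := ell k, 20 := bas (Suc k))) (a(11 := (a 11)(k := ell k), 12 := (a 12)(k := bas k))) n'"
  shows "wp buffer_com Q v a n"
proof -
  have lU: "ell k \<le> U" using ell_le[OF k(1)] U_ge by linarith
  have bU: "bas k + ell k + ell k \<le> U" using bas_L[OF k(1,2)] U_ge by linarith
  have kLw: "k < Lw" using k by (simp add: Lw_def)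
  have pre0: "wp (19 ::= Num 0) Q2 v a n" if "Q2 (v(19 := 0)) a (Suc (Suc (Suc n)))" for Q2
    using that by simp
  have fin: "wp (11\<langle>Var 9\<rangle> ::= Var 19) (\<lambda>v a n. wp (12\<langle>Var 9\<rangle> ::= Var 20)
     (\<lambda>v a n. wp (20 ::= Var 20 \<oplus> Var 19 \<oplus> Var 19) Q2 v a n) v a n) (v(19 := ell k)) a n1"
    if "\<And>n'. n' \<le> n1 + 40 \<Longrightarrow> Q2 (v(19 := ell k, 20 := bas k + ell k + ell k)) (a(11 := (a 11)(k := ell k), 12 := (a 12)(k := bas k))) n'" for Q2 n1
    using that v lU bU kLw by (simp add: wok_def)
  show ?thesis unfolding buffer_com_def wp_Seq
  proof (rule pre0, rule search_spec[where f = "\<lambda>l. l * l * k" and b = x and l = "ell k"], goal_cases)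
    case (7 n1)
    have b: "bas (Suc k) = bas k + ell k + ell k" using bas_Suc[OF k(1)] by simp
    show ?case
      by (rule fin, rule Q[unfolded b]) (use 7 in simp)
  qed (use v lU ell_ge[OF k(1)] ell_least in auto)
qed

text \<open>Initially every window is empty at 0 and both of its streams read the shared
  table.\<close>

lemma heads_spec:
  assumes v: "v 0 = x" "v 2 = c0" "v 3 = R" "v 4 = T" and tab: "table (a 0)"
    and a0: "\<forall>j. a 3 j = 0" "\<forall>j. a 4 j = 0" "\<forall>j. a 5 j = 0" "\<forall>j. a 6 j = 0" "\<forall>j. a 11 j = 0" "\<forall>j. a 12 j = 0"
    and Q: "\<And>v' a' n'. frame heads_com v a v' a' \<Longrightarrow> \<forall>j\<in>{1..R}. kst a' j \<Longrightarrow>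
      n' \<le> n + 200 * R + 20 * bas c0 + 100 \<Longrightarrow> Q v' a' n'"
  shows "wp heads_com Q v a n"
proof (rule wp_frame)
  \<comment> \<open>The minimum reflects that no buffers are allocated from length \<open>c0\<close>
    on.\<close>
  let ?I = "\<lambda>v' a' n'. 1 \<le> v' 9 \<and> v' 9 \<le> R + 1 \<and> v' 20 = bas (min (v' 9) c0) \<and>
     (\<forall>j. 1 \<le> j \<and> j < v' 9 \<longrightarrow> a' 7 j = T \<and> a' 8 j = T \<and> a' 9 j = T \<and> a' 10 j = T \<and>
        a' 11 j = (if j < c0 then ell j else 0) \<and> a' 12 j = (if j < c0 then bas j else 0)) \<and>
     (\<forall>j. v' 9 \<le> j \<longrightarrow> a' 11 j = 0 \<and> a' 12 j = 0) \<and>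
     n' \<le> n + 20 + 200 * (v' 9 - 1) + 20 * v' 20"
  have TU: "T \<le> U" "1 \<le> U" "Suc R \<le> U" using T_L U_ge R_le by linarith+
  have mvb: "mvars buffer_com = {19, 20}" "marrs buffer_com = {11, 12}" by (auto simp: buffer_com_def)
  have b1: "bas (min 1 c0) = T" using c0_ge1 by (simp add: bas_def min_def)
  have pre0: "wp (9 ::= Num 1) (\<lambda>v a n. wp (20 ::= Var 4) Q2 v a n) v a n"
    if "\<And>n1. n1 \<le> n + 20 \<Longrightarrow> Q2 (v(9 := 1, 20 := T)) a n1" for Q2
    using that v TU by simp
  have "wp (WHILE Var 9 < Var 3 \<oplus> Num 1 DO
       (7\<langle>Var 9\<rangle> ::= Var 4 ;; 8\<langle>Var 9\<rangle> ::= Var 4 ;; 9\<langle>Var 9\<rangle> ::= Var 4 ;; 10\<langle>Var 9\<rangle> ::= Var 4 ;;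
        IF Var 9 < Var 2 THEN buffer_com ELSE Skip ;;
        9 ::= Var 9 \<oplus> Num 1))
     (\<lambda>v' a' n'. (\<forall>j\<in>{1..R}. kst a' j) \<and> n' \<le> n + 200 * R + 20 * bas c0 + 100) (v(9 := 1, 20 := T)) a n1"
    if n1: "n1 \<le> n + 20" for n1
  proof (rule wp_While[where I = ?I and f = "\<lambda>v' a'. R + 1 - v' 9"], goal_cases)
    case 1
    show ?case using n1 a0 b1 by simp
  next
    case (2 v' a' n')
    then show ?case by simp
  next
    case (3 v' a' n')
    have fr: "v' 0 = x" "v' 2 = c0" "v' 3 = R" "v' 4 = T" using 3(1) v by (simp_all add: frame_def mvb)
    define k where "k = v' 9"
    have I: "1 \<le> k" "v' 20 = bas (min k c0)"
     "\<forall>j. 1 \<le> j \<and> j < k \<longrightarrow> a' 7 j = T \<and> a' 8 j = T \<and> a' 9 j = T \<and> a' 10 j = T \<and>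
        a' 11 j = (if j < c0 then ell j else 0) \<and> a' 12 j = (if j < c0 then bas j else 0)"
     "\<forall>j. k \<le> j \<longrightarrow> a' 11 j = 0 \<and> a' 12 j = 0"
     "n' \<le> n + 20 + 200 * (k - 1) + 20 * v' 20" using 3(2) unfolding k_def by blast+
    have kR: "k \<le> R" using 3(3) fr by (simp add: k_def)
    have kLw: "k < Lw" using kR by (simp add: Lw_def)
    define a2 where "a2 = a'(7 := (a' 7)(k := T), 8 := (a' 8)(k := T), 9 := (a' 9)(k := T), 10 := (a' 10)(k := T))"
    have stores: "wp (7\<langle>Var 9\<rangle> ::= Var 4) (\<lambda>v a n. wp (8\<langle>Var 9\<rangle> ::= Var 4) (\<lambda>v a n. wp (9\<langle>Var 9\<rangle> ::= Var 4)
       (\<lambda>v a n. wp (10\<langle>Var 9\<rangle> ::= Var 4) Q2 v a n) v a n) v a n) v' a' n2"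
      if "\<And>n3. n3 \<le> n2 + 40 \<Longrightarrow> Q2 v' a2 n3" for Q2 n2
      using that fr TU kLw by (simp add: wok_def k_def[symmetric] a2_def)
    have SkU: "Suc k \<le> U" using kR TU by simp
    show ?case
    proof (cases "k < c0")
      case True
      have bk: "v' 20 = bas k" using I(2) True by (simp add: min_def)
      have IFT: "wp (IF Var 9 < Var 2 THEN buffer_com ELSE Skip) Q2 v' a2 n2"
        if "\<And>n3. n3 \<le> n2 + 10 \<Longrightarrow> wp buffer_com Q2 v' a2 n3" for Q2 n2
        using that True fr by (simp add: k_def)
      have mm: "min (Suc k) c0 = Suc k" using True by simp
      have bs: "bas (Suc k) = bas k + 2 * ell k" using bas_Suc[OF I(1)] .
      have e1: "1 \<le> ell k" using ell_ge1[OF I(1)] .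
      show ?thesis unfolding wp_Seq
      proof (rule stores, rule IFT, rule buffer_spec[OF fr(1) k_def[symmetric] bk I(1) True kR], goal_cases)
        case (1 n3 n4 n5)
        have "n5 + 10 \<le> n + 20 + 200 * k + 20 * bas (Suc k)" using 1 I(1,5) bk bs by simp
        then show ?case using I SkU kR True mm e1
          by (auto simp: k_def[symmetric] a2_def less_Suc_eq)
      qed
    next
      case False
      have IFF: "wp (IF Var 9 < Var 2 THEN buffer_com ELSE Skip) Q2 v' a2 n2"
        if "\<And>n3. n3 \<le> n2 + 10 \<Longrightarrow> Q2 v' a2 n3" for Q2 n2
        using that False fr by (simp add: k_def)
      have mm: "min (Suc k) c0 = c0" "min k c0 = c0" using False by auto
      show ?thesis unfolding wp_Seq
      proof (rule stores, rule IFF, goal_cases)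
        case (1 n3 n4)
        then show ?case using I SkU kR False mm
          by (auto simp: k_def[symmetric] a2_def less_Suc_eq)
      qed
    qed
  next
    case (4 v' a' n')
    have fr: "v' 3 = R" "\<forall>j. a' 3 j = 0" "\<forall>j. a' 4 j = 0" "\<forall>j. a' 5 j = 0" "\<forall>j. a' 6 j = 0" "a' 0 = a 0"
      using 4(1) v a0 by (simp_all add: frame_def mvb)
    have k: "v' 9 = R + 1" using 4(2,3) fr by auto
    have kk: "kst a' j" if j: "j \<in> {1..R}" for j
    proof -
      have I: "a' 7 j = T" "a' 8 j = T" "a' 9 j = T" "a' 10 j = T"
        "a' 11 j = (if j < c0 then ell j else 0)" "a' 12 j = (if j < c0 then bas j else 0)"
        using 4(2) k j by auto
      have "head (a 0) j b 0 T T" for b using tab by (auto simp: head_def table_def)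
      then show ?thesis using fr I by (simp add: kst_def)
    qed
    have "bas (min (v' 9) c0) \<le> bas c0" by (intro bas_mono) simp
    then have "20 * v' 20 \<le> 20 * bas c0" using 4(2) by simp
    then show ?case using kk k 4(2) by auto
  qed
  then show "wp heads_com (\<lambda>v' a' n'. (\<forall>j\<in>{1..R}. kst a' j) \<and> n' \<le> n + 200 * R + 20 * bas c0 + 100) v a n"
    unfolding heads_com_def wp_Seq by (intro pre0)
qed (use Q in blast)

text \<open>The refill potential of a stream at its last possible end; 0 if it never leaves the
  shared table.\<close>

definition rcm :: "nat \<Rightarrow> nat" where
  "rcm k = (if k < c0 \<and> T < lim k + ell k then rc k (lim k + ell k) else 0)"

lemma rc_head_le: "head bt k b q e t \<Longrightarrow> rc k e \<le> rcm k"
proof -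
  assume h: "head bt k b q e t"
  show ?thesis
  proof (cases "e = T")
    case True
    have "SK k T = {}" by (auto simp: SK_def)
    then show ?thesis using True by (simp add: rc_def)
  next
    case False
    then have "k < c0" "T < e" "e \<le> lim k + ell k" using h by (auto simp: head_def)
    then show ?thesis using rc_mono[of e "lim k + ell k" k] by (simp add: rcm_def)
  qed
qed

lemma apot_le: "kst a k \<Longrightarrow> apot a k \<le> 800 * lim k + 2 * rcm k"
  using rc_head_le[of "a 0" k "bas k" "a 3 k" "a 7 k" "a 8 k"]
    rc_head_le[of "a 0" k "bas k + ell k" "a 4 k" "a 9 k" "a 10 k"]
  by (simp add: kst_def apot_def)

definition total_time :: nat where
  "total_time = 2000 * (x + R + c0 + table_time + (w + 1) * (W + 1) + W + bas c0 + (\<Sum>k\<in>{1..R}. lim k + rcm k) + 1)"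

lemma puzzle_spec:
  "wp puzzle_com (\<lambda>v a n. v 1 \<le> Lw \<and> n \<le> total_time \<and> (\<forall>k. histogram x k = (if k < v 1 then a 14 k else 0)))
    ((\<lambda>_. 0)(0 := x)) (\<lambda>_ _. 0) 0"
  unfolding puzzle_com_def wp_Seq
proof (rule sizes_spec, goal_cases)
  case (2 n1)
  note n1 = 2
  let ?v1 = "((\<lambda>_. 0)(0 := x))(2 := c0, 3 := R, 4 := T) :: nat \<Rightarrow> nat"
  show ?case
  proof (rule table_spec, goal_cases)
    case (3 v2 a2 n2)
    have f2: "v2 0 = x" "v2 2 = c0" "v2 3 = R" "v2 4 = T" "\<forall>A. A \<noteq> 0 \<longrightarrow> (\<forall>j. a2 A j = 0)"
      using 3(1) by (auto simp: frame_def table_com_def)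
    note t2 = 3(2) and n2 = 3(3)
    show ?case
    proof (rule wheel_spec[where v = v2, OF f2(2)], goal_cases)
      case (1 v3 n3)
      have f3: "v3 0 = x" "v3 2 = c0" "v3 3 = R" "v3 4 = T"
        using 1(1) f2 by (auto simp: frame_def wheel_com_def)
      note v3 = 1(2,3) and n3 = 1(4)
      show ?case
      proof (rule residues_spec[where v = v3, OF v3], goal_cases)
        case 1
        show ?case using f2(5) by simp
      next
        case (2 v4 a4 n4)
        have f4: "v4 0 = x" "v4 2 = c0" "v4 3 = R" "v4 4 = T" "v4 5 = w" "v4 6 = W" "\<forall>A. A \<noteq> 1 \<longrightarrow> a4 A = a2 A"
          using 2(1) f3 v3 by (auto simp: frame_def residues_com_def)
        note a4 = 2(2) and n4 = 2(3)
        show ?case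
        proof (rule gaps_spec[where v = v4 and a = a4, OF f4(6) a4], goal_cases)
          case (1 v5 a5 n5)
          have f5: "v5 0 = x" "v5 2 = c0" "v5 3 = R" "v5 4 = T" "v5 5 = w" "v5 6 = W" "\<forall>A. A \<noteq> 2 \<longrightarrow> a5 A = a4 A"
            using 1(1) f4 by (auto simp: frame_def gaps_com_def)
          note g5 = 1(2) and n5 = 1(3)
          have z5: "\<forall>A. A \<notin> {0, 1, 2} \<longrightarrow> (\<forall>j. a5 A j = 0)" using f5(7) f4(7) f2(5) by simp
          have t5: "table (a5 0)" using t2 f5(7) f4(7) by simp
          have e5: "sieve_env v5 a5" using f5 a4 g5 by (simp add: sieve_env_def)
          show ?case
          proof (rule heads_spec[where v = v5 and a = a5, OF f5(1-4) t5], goal_cases)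
            case (7 v6 a6 n6)
            have f6: "v6 0 = x" "v6 3 = R" "v6 5 = w" "v6 6 = W" "\<forall>A. A \<notin> {7, 8, 9, 10, 11, 12} \<longrightarrow> a6 A = a5 A"
              using 7(1) f5 by (auto simp: frame_def heads_com_def buffer_com_def)
            have g6: "genv v6 a6" using f6 e5 t5 by (simp add: genv_def sieve_env_def)
            show ?case
            proof (rule main_spec[OF g6 7(2)], goal_cases)
              case 1
              show ?case using f6(5) z5 by simp
            next
              case 2
              show ?case using f6(5) z5 by simp
            next
              case (3 v7 a7 n7)
              have "(\<Sum>j\<in>{1..R}. apot a7 j) \<le> (\<Sum>j\<in>{1..R}. 2000 * (lim j + rcm j))"
              proof (intro sum_mono)
                fix j assume "j \<in> {1..R}"
                then show "apot a7 j \<le> 2000 * (lim j + rcm j)" using apot_le[of a7 j] 3(3) by simp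
              qed
              also have "\<dots> = 2000 * (\<Sum>j\<in>{1..R}. lim j + rcm j)" by (simp add: sum_distrib_left)
              finally have s: "(\<Sum>j\<in>{1..R}. apot a7 j) \<le> 2000 * (\<Sum>j\<in>{1..R}. lim j + rcm j)" .
              define p q where "p = (w + 1) * (W + 1)" and "q = (\<Sum>j\<in>{1..R}. lim j + rcm j)"
              have "n7 \<le> 2000 * (x + R + c0 + table_time + p + W + bas c0 + q + 1)"
                using 3(4) s 7(3) n5 n4 n3 n2 n1 unfolding p_def[symmetric] q_def[symmetric]
                by (simp add: distrib_left)
              then have "n7 \<le> total_time" by (simp add: total_time_def p_def q_def)
              moreover have "v7 1 \<le> Lw" using 3(1) by (simp add: Lw_def)
              ultimately show ?case using 3(1,2) by simp
            qed
          qed (use z5 in auto)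
        qed
      qed
    qed
  qed auto
qed auto

end

section \<open>Asymptotics\<close>

text \<open>Telescopes, since 1 / sqrt (n + 1) is at most 2 * (sqrt (n + 1) - sqrt n).\<close>

lemma sum_inverse_sqrt_le: "(\<Sum>k=1..n. 1 / sqrt (real k)) \<le> 2 * sqrt (real n)"
proof (induction n)
  case (Suc n)
  let ?a = "sqrt (real n)" and ?b = "sqrt (real (Suc n))"
  have b: "?b > 0" "?a \<le> ?b" by auto
  have "(?b - ?a) * (?b + ?a) = 1" by (simp add: algebra_simps)
  moreover have "(?b - ?a) * (?b + ?a) \<le> (?b - ?a) * (2 * ?b)" using b by (intro mult_left_mono) auto
  ultimately have "1 \<le> (2 * ?b - 2 * ?a) * ?b" by (simp add: algebra_simps)
  then have "1 / ?b \<le> 2 * ?b - 2 * ?a" using b by (simp add: pos_divide_le_eq)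
  then show ?case using Suc by simp
qed simp

text \<open>Bounds \<open>total_time\<close> summand by summand in closed form. The
  \<open>ln 13\<close> is \<open>ln (b + 3)\<close> of \<open>card_sieve_strikes_le\<close> at
  \<open>b = 10\<close>.\<close>

definition time_bound :: "real \<Rightarrow> real" where
  "time_bound x = 2000 * (x + 3 * x + x + 2049 * x * (3 + ln (2049 * x)) +
     9 * x + x + 2065 * x + (512 * x * (1 + ln (3 * x)) + 3 * x) +
     (5000 + 60 * (4 * (7 + 2 * ln 13))) * ((512 * x * (1 + ln (3 * x)) + 3 * x) + 2065 * x) + 1)"

section \<open>Real bounds for the parameters\<close>

context puzzle
begin

definition y :: real where "y = real x powr (1/3)"

lemma y_ge1: "y \<ge> 1"
  unfolding y_def using x0 by (intro ge_one_powr_ge_zero) auto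

lemma y_pow3: "y ^ 3 = real x"
  unfolding y_def using x0 by (simp add: powr_power)

lemma y_pow2: "y ^ 2 = real x powr (2/3)"
  unfolding y_def using x0 by (simp add: powr_power)

lemma y_pow2_le: "y \<le> y ^ 2" "y ^ 2 \<le> real x"
  using y_ge1 power_increasing[of 1 2 y] power_increasing[of 2 3 y] y_pow3 by auto

lemma sqrt_x_le: "sqrt (real x) \<le> y ^ 2"
proof (rule real_le_lsqrt)
  have "y ^ 3 \<le> y ^ 4" using y_ge1 by (intro power_increasing) auto
  then show "real x \<le> (y\<^sup>2)\<^sup>2" using y_pow3 by (simp add: power_mult[symmetric])
qed (use y_ge1 in auto)

lemma y_le_sqrt: "y \<le> sqrt (real x)"
  using y_pow2_le by (intro real_le_rsqrt) auto

lemma c0_le_real: "real c0 \<le> 2 * y"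
proof -
  have "(c0 - 1) * (c0 - 1) * (c0 - 1) < x" using c0_ge1 by (intro c0_least) simp
  then have "real ((c0 - 1) * (c0 - 1) * (c0 - 1)) < real x" by (rule of_nat_less_iff[THEN iffD2])
  then have "real (c0 - 1) ^ 3 < y ^ 3" unfolding y_pow3 by (simp only: power3_eq_cube of_nat_mult)
  then have "real (c0 - 1) < y" by (rule power_less_imp_less_base) (use y_ge1 in simp)
  moreover have "real (c0 - 1) = real c0 - 1" using c0_ge1 by simp
  ultimately show ?thesis using y_ge1 by linarith
qed

lemma R_le_real: "real R \<le> 3 * sqrt (real x)"
proof -
  have "(R - 1) * (R - 1) < 2 * x" using R_ge2 by (intro R_least) simp
  then have "real ((R - 1) * (R - 1)) < real (2 * x)" by (rule of_nat_less_iff[THEN iffD2])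
  then have "real (R - 1) ^ 2 < (2 * sqrt (real x)) ^ 2" by (simp add: power2_eq_square power_mult_distrib)
  then have "real (R - 1) < 2 * sqrt (real x)" by (rule power_less_imp_less_base) simp
  moreover have "1 \<le> sqrt (real x)" using x0 by simp
  moreover have "real (R - 1) = real R - 1" using R_ge2 by simp
  ultimately show ?thesis by linarith
qed

lemma ell_le_real:
  assumes "1 \<le> k" "k \<le> x"
  shows "real (ell k) \<le> 2 * sqrt (real x) * (1 / sqrt (real k))"
proof -
  have k: "real k > 0" using assms by simp
  have "(ell k - 1) * (ell k - 1) * k < x" using ell_ge1[OF assms(1)] by (intro ell_least) simp
  then have "real ((ell k - 1) * (ell k - 1) * k) < real x" by (rule of_nat_less_iff[THEN iffD2])
  then have "real (ell k - 1) ^ 2 < (sqrt (real x / real k)) ^ 2"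
    using k by (simp add: power2_eq_square field_simps)
  then have "real (ell k - 1) < sqrt (real x / real k)" by (rule power_less_imp_less_base) simp
  moreover have "1 \<le> sqrt (real x / real k)" using assms k by (simp add: field_simps)
  moreover have "real (ell k - 1) = real (ell k) - 1" using ell_ge1[OF assms(1)] by simp
  ultimately have "real (ell k) \<le> 2 * sqrt (real x / real k)" by linarith
  then show ?thesis by (simp add: real_sqrt_divide)
qed

lemma T_le_real: "real T \<le> 2049 * y ^ 2"
proof -
  have "real c0 * real c0 \<le> (2 * y) * (2 * y)" using c0_le_real by (intro mult_mono) auto
  then have "real T \<le> 2048 * y ^ 2 + 1" by (simp add: T_def power2_eq_square)
  then show ?thesis using y_ge1 y_pow2_le by simp
qed

text \<open>The buffers sum to O(sqrt x * sqrt \<open>c0\<close>), and the exponents 1/2 + 1/6 make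
  2/3.\<close>

lemma bas_le_real: "real (bas c0) \<le> 2065 * y ^ 2"
proof -
  have "real (\<Sum>j=1..<c0. ell j) \<le> (\<Sum>k=1..<c0. 2 * sqrt (real x) * (1 / sqrt (real k)))"
    unfolding of_nat_sum using c0_le by (intro sum_mono ell_le_real) auto
  also have "\<dots> = 2 * sqrt (real x) * (\<Sum>k=1..<c0. 1 / sqrt (real k))" by (simp add: sum_distrib_left)
  also have "\<dots> \<le> 2 * sqrt (real x) * (2 * sqrt (real c0))" by (intro mult_left_mono order_trans[OF sum_mono2 sum_inverse_sqrt_le[of c0]]) auto
  also have "\<dots> = 4 * sqrt (real x * real c0)" by (simp add: real_sqrt_mult)
  also have "sqrt (real x * real c0) \<le> 2 * y ^ 2"
  proof (rule real_le_lsqrt)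
    have "real x * real c0 \<le> y ^ 3 * (2 * y)" unfolding y_pow3 using c0_le_real by (intro mult_left_mono) auto
    also have "\<dots> = 2 * y ^ 4" by (simp add: power_numeral_reduce)
    also have "\<dots> \<le> 4 * y ^ 4" by simp
    also have "\<dots> = (2 * y\<^sup>2)\<^sup>2" by (simp add: power_mult_distrib power_mult[symmetric])
    finally show "real x * real c0 \<le> (2 * y\<^sup>2)\<^sup>2" .
  qed simp
  finally have "real (\<Sum>j=1..<c0. ell j) \<le> 8 * y ^ 2" by simp
  then show ?thesis using T_le_real by (simp add: bas_def)
qed

lemma L_le_real: "real L \<le> 2075 * y ^ 2"
  using bas_le_real R_le_real sqrt_x_le c0_le_real y_pow2_le y_ge1 by (simp add: L_def)

text \<open>Only O(sqrt x) cells hold words, so even with the factor log x they stay below x^(2/3)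
  bits.\<close>

lemma Lw_le_real: "real Lw \<le> 10 * sqrt (real x)"
proof -
  have "1 \<le> sqrt (real x)" using x0 by simp
  moreover have "real Lw = real R + real c0 + 5" by (simp add: Lw_def)
  ultimately show ?thesis using R_le_real c0_le_real y_le_sqrt by linarith
qed

lemma U_le_real: "real U \<le> 60000 * real x"
  using L_le_real y_pow2_le x0 by (simp add: U_def)

lemma floorlog_wmax_le: "real (floorlog 2 wmax) \<le> 512 * log 2 (60000 * real x) + 1"
proof -
  have w: "wmax > 0" using one_le_wmax by simp
  have "real (floorlog 2 wmax) \<le> log 2 (real wmax) + 1"
    using w one_le_wmax by (simp add: floorlog_def)
  also have "log 2 (real wmax) = 512 * log 2 (real U)"
    using U_ge2 by (simp add: wmax_def log_nat_power)
  also have "log 2 (real U) \<le> log 2 (60000 * real x)"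
    using U_le_real U_ge2 by (subst log_le_cancel_iff) auto
  finally show ?thesis by simp
qed

lemma table_time_le_real: "real table_time \<le> 2049 * real x * (3 + ln (2049 * real x))"
proof -
  have Tx: "real T \<le> 2049 * real x" using T_le_real y_pow2_le by linarith
  have T0: "T > 0" by (simp add: T_def)
  have "real table_time \<le> (\<Sum>i=2..<T. real T * inverse (real i) + 2)"
    unfolding table_time_def of_nat_sum
  proof (intro sum_mono)
    fix i
    have "real (T div i) \<le> real T / real i" by (rule of_nat_div_le_of_nat)
    then show "real (T div i + 2) \<le> real T * inverse (real i) + 2" by (simp add: divide_inverse)
  qed
  also have "\<dots> \<le> (\<Sum>i=1..T. real T * inverse (real i) + 2)"
    by (intro sum_mono2) auto
  also have "\<dots> = real T * harm T + 2 * real T"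
    by (simp add: sum.distrib sum_distrib_left harm_def)
  also have "\<dots> \<le> real T * (1 + ln (real T)) + 2 * real T"
    using harm_le_ln[OF T0] by (intro add_right_mono mult_left_mono) auto
  also have "\<dots> = real T * (3 + ln (real T))" by (simp add: algebra_simps)
  also have "\<dots> \<le> 2049 * real x * (3 + ln (2049 * real x))"
    using Tx T0 by (intro mult_mono) (auto intro!: ln_ge_zero add_nonneg_nonneg)
  finally show ?thesis .
qed

text \<open>The harmonic sum over the window lengths is what brings the factor log x into the
  scanning time.\<close>

lemma sum_lim_le_real: "real (\<Sum>k\<in>{1..R}. lim k) \<le> 512 * real x * (1 + ln (3 * real x)) + 3 * real x"
proof -
  have sx: "sqrt (real x) \<le> real x" using sqrt_x_le y_pow2_le by linarith
  have Rx: "real R \<le> 3 * real x" using R_le_real sx by linarith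
  have R0: "R > 0" using R_ge2 by simp
  have "real (\<Sum>k\<in>{1..R}. lim k) \<le> (\<Sum>k\<in>{1..R}. 512 * real x * inverse (real k) + 1)"
    unfolding of_nat_sum
  proof (intro sum_mono)
    fix k
    have "real (512 * x div k) \<le> real (512 * x) / real k" by (rule of_nat_div_le_of_nat)
    then show "real (lim k) \<le> 512 * real x * inverse (real k) + 1" by (simp add: lim_def divide_inverse)
  qed
  also have "\<dots> = 512 * real x * harm R + real R"
    by (simp add: sum.distrib sum_distrib_left harm_def)
  also have "\<dots> \<le> 512 * real x * (1 + ln (real R)) + 3 * real x"
    using harm_le_ln[OF R0] Rx by (intro add_mono mult_left_mono) auto
  also have "\<dots> \<le> 512 * real x * (1 + ln (3 * real x)) + 3 * real x"
    using Rx R0 by (intro add_right_mono mult_left_mono add_left_mono) auto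
  finally show ?thesis .
qed

text \<open>Linear in the range scanned, because the wheel reduces the strike-outs below
  \<open>lim k + ell k\<close> to a constant per number.\<close>

lemma rcm_le_real:
  assumes "1 \<le> k"
  shows "real (rcm k) \<le> (5000 + 60 * (4 * (7 + 2 * ln 13))) * (real (lim k) + (if k < c0 then real (ell k) else 0))"
proof (cases "k < c0 \<and> T < lim k + ell k")
  case True
  define X where "X = lim k + ell k"
  have D: "0 \<le> ln (13::real)" by simp
  \<comment> \<open>Refills occur only beyond \<open>T\<close>, which exceeds the square of
    \<open>c0\<close>; this is the hypothesis that lets a period of the wheel fit.\<close>
  have TX: "c0 ^ 2 \<le> X" using True unfolding X_def T_def power2_eq_square by simp
  have "X \<le> 514 * x" using lim_le[of k] ell_le[OF assms] x0 unfolding X_def by linarith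
  \<comment> \<open>514 is below 2^10, which fixes \<open>b = 10\<close>.\<close>
  also have "\<dots> \<le> 2 ^ 10 * c0 ^ 3" using x_le_c0 by (simp add: power3_eq_cube)
  finally have X2: "X \<le> 2 ^ 10 * c0 ^ 3" .
  let ?S = "{(p, m). prime p \<and> p * p < X \<and> rough w m \<and> p * m < X}"
  have finS: "finite ?S"
  proof (rule finite_subset)
    show "?S \<subseteq> {..X} \<times> {..X}"
    proof (clarsimp)
      fix p m assume a: "prime p" "p * p < X" "p * m < X"
      have "p \<le> p * p" "m \<le> p * m" using prime_ge_1_nat[OF a(1)] by auto
      then show "p \<le> X \<and> m \<le> X" using a by linarith
    qed
  qed simp
  have "card (SK k X) \<le> card ?S" using finS by (intro card_mono) (auto simp: SK_def X_def)
  then have "real (card (SK k X)) \<le> real (card ?S)" by (rule of_nat_mono)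
  also have "\<dots> \<le> 4 * (7 + 2 * ln (real (10 + 3))) * real X"
    using card_sieve_strikes_le[OF w_ge1 _ _ TX X2] W_le c0_less_fact by (simp add: W_def)
  finally have c: "real (card (SK k X)) \<le> 4 * (7 + 2 * ln 13) * real X" by simp
  have "real (rcm k) = 5000 * real (X - T) + 60 * real (card (SK k X))"
    using True by (simp add: rcm_def rc_def X_def)
  also have "\<dots> \<le> 5000 * real X + 60 * (4 * (7 + 2 * ln 13) * real X)"
    using c by (intro add_mono mult_left_mono) auto
  also have "\<dots> = (5000 + 60 * (4 * (7 + 2 * ln 13))) * real X" by (simp add: algebra_simps)
  finally show ?thesis using True by (simp add: X_def)
next
  case False
  then show ?thesis by (auto simp: rcm_def)
qed

lemma sum_rcm_le_real:
  "real (\<Sum>k\<in>{1..R}. rcm k) \<le> (5000 + 60 * (4 * (7 + 2 * ln 13))) * (real (\<Sum>k\<in>{1..R}. lim k) + 2065 * real x)"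
proof -
  let ?D = "5000 + 60 * (4 * (7 + 2 * ln 13)) :: real"
  have "(\<Sum>k\<in>{1..R}. if k < c0 then real (ell k) else 0) = (\<Sum>k\<in>{1..R} \<inter> {..<c0}. real (ell k))"
    by (simp add: sum.inter_restrict lessThan_def)
  also have "\<dots> \<le> (\<Sum>k=1..<c0. real (ell k))" by (intro sum_mono2) auto
  also have "\<dots> = real (\<Sum>k=1..<c0. ell k)" by simp
  also have "\<dots> \<le> real (bas c0)" unfolding bas_def by (intro of_nat_mono) simp
  also have "\<dots> \<le> 2065 * real x" using bas_le_real y_pow2_le by linarith
  finally have e: "(\<Sum>k\<in>{1..R}. if k < c0 then real (ell k) else 0) \<le> 2065 * real x" .
  have "real (\<Sum>k\<in>{1..R}. rcm k) \<le> (\<Sum>k\<in>{1..R}. ?D * (real (lim k) + (if k < c0 then real (ell k) else 0)))"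
    unfolding of_nat_sum by (intro sum_mono rcm_le_real) auto
  also have "\<dots> = ?D * (real (\<Sum>k\<in>{1..R}. lim k) + (\<Sum>k\<in>{1..R}. if k < c0 then real (ell k) else 0))"
    by (simp only: sum_distrib_left[symmetric] sum.distrib of_nat_sum)
  also have "\<dots> \<le> ?D * (real (\<Sum>k\<in>{1..R}. lim k) + 2065 * real x)"
    using e by (intro mult_left_mono add_left_mono) (auto intro!: add_nonneg_nonneg)
  finally show ?thesis .
qed

lemma total_time_le_real:
  "real total_time \<le> time_bound (real x)"
proof -
  have sx: "sqrt (real x) \<le> real x" using sqrt_x_le y_pow2_le by linarith
  have Rx: "real R \<le> 3 * real x" using R_le_real sx by linarith
  have cx: "real c0 \<le> real x" "real W \<le> real x" using c0_le W_le by auto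
  have "real ((w + 1) * (W + 1)) \<le> real ((c0 + 1) * (c0 + 1))"
    using w_le W_le by (intro of_nat_mono mult_le_mono) auto
  also have "\<dots> = (real c0 + 1) * (real c0 + 1)" by (simp add: algebra_simps)
  also have "\<dots> \<le> (3 * y) * (3 * y)" using c0_le_real y_ge1 by (intro mult_mono) auto
  also have "\<dots> \<le> 9 * real x" using y_pow2_le by (simp add: power2_eq_square)
  finally have ww: "real ((w + 1) * (W + 1)) \<le> 9 * real x" .
  have bx: "real (bas c0) \<le> 2065 * real x" using bas_le_real y_pow2_le by linarith
  let ?D = "5000 + 60 * (4 * (7 + 2 * ln 13)) :: real"
  have "?D * (real (\<Sum>k\<in>{1..R}. lim k) + 2065 * real x) \<le>
      ?D * ((512 * real x * (1 + ln (3 * real x)) + 3 * real x) + 2065 * real x)"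
    using sum_lim_le_real by (intro mult_left_mono add_right_mono) (auto intro!: add_nonneg_nonneg)
  then have rc: "real (\<Sum>k\<in>{1..R}. rcm k) \<le> ?D * ((512 * real x * (1 + ln (3 * real x)) + 3 * real x) + 2065 * real x)"
    using sum_rcm_le_real by linarith
  have "real total_time = 2000 * (real x + real R + real c0 + real table_time + real ((w + 1) * (W + 1)) + real W +
     real (bas c0) + real (\<Sum>k\<in>{1..R}. lim k) + real (\<Sum>k\<in>{1..R}. rcm k) + 1)"
    unfolding total_time_def by (simp only: of_nat_mult of_nat_add sum.distrib of_nat_numeral of_nat_1 add.assoc)
  also have "\<dots> \<le> time_bound (real x)" unfolding time_bound_def
    by (intro mult_left_mono add_mono Rx cx ww bx rc table_time_le_real sum_lim_le_real order_refl) simp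
  finally show ?thesis .
qed

end

lemma bigo_of_le:
  fixes f :: "nat \<Rightarrow> nat"
  assumes "\<And>n. n > 0 \<Longrightarrow> real (f n) \<le> g n"
  shows "(\<lambda>n. real (f n)) \<in> O(g)"
proof (rule landau_o.big_mono, rule eventually_mono[OF eventually_gt_at_top[of 0]])
  fix n :: nat assume "0 < n"
  then have "real (f n) \<le> g n" by (rule assms)
  then show "norm (real (f n)) \<le> norm (g n)" by simp
qed

theorem theorem1:
  "\<exists>P :: program.
     (\<forall>x>0. terminates P x \<and> outputs (final_mem P x) (histogram x)) \<and>
     (\<lambda>x::nat. real (word_bits P x)) \<in> O(\<lambda>x. ln (real x)) \<and>
     (\<lambda>x::nat. real (run_time P x)) \<in> O(\<lambda>x. real x * ln (real x)) \<and>
     (\<lambda>x::nat. real (space_bits P x)) \<in> O(\<lambda>x. real x powr (2/3))"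
proof -
  \<comment> \<open>One program for all inputs: it computes the parameters itself, and the locale
    enters only the analysis.\<close>
  define P where "P = comp 0 puzzle_com @ emit (clen puzzle_com)"
  have main: "terminates P x \<and> outputs (final_mem P x) (histogram x) \<and>
      real (word_bits P x) \<le> 512 * log 2 (60000 * real x) + 1 \<and>
      real (run_time P x) \<le> time_bound (real x) +
       80 * sqrt (real x) + 8 \<and>
      real (space_bits P x) \<le> (80 + 160 * sqrt (real x)) * (512 * log 2 (60000 * real x) + 1) +
         (80 + 33200 * real x powr (2/3))"
    if x: "x > 0" for x
  proof -
    interpret puzzle x by unfold_locales (rule x)
    have lits: "\<forall>k\<in>lits puzzle_com. k \<le> U" using lits_puzzle_com by (auto simp: U_def)
    have xU: "x \<le> U" by (simp add: U_def)
    note spec = program_spec[OF puzzle_spec wf_puzzle_com lits xU, folded P_def]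
    have 1: "real (word_bits P x) \<le> 512 * log 2 (60000 * real x) + 1"
      using spec(4) floorlog_wmax_le by linarith
    have "real (run_time P x) \<le> real (total_time + 8 * Lw + 8)" using spec(3) by (rule of_nat_mono)
    then have 2: "real (run_time P x) \<le> real total_time + 80 * sqrt (real x) + 8"
      using Lw_le_real by simp
    have "real (space_bits P x) \<le> real ((80 + 16 * Lw) * floorlog 2 wmax + (80 + 16 * L))"
      using spec(5) by (rule of_nat_mono)
    also have "\<dots> = (80 + 16 * real Lw) * real (floorlog 2 wmax) + (80 + 16 * real L)" by simp
    also have "\<dots> \<le> (80 + 160 * sqrt (real x)) * (512 * log 2 (60000 * real x) + 1) + (80 + 33200 * real x powr (2/3))"
    proof -
      have A: "80 + 16 * real Lw \<le> 80 + 160 * sqrt (real x)" using Lw_le_real by linarith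
      have B: "80 + 16 * real L \<le> 80 + 33200 * real x powr (2/3)" using L_le_real y_pow2 by linarith
      show ?thesis by (rule add_mono[OF mult_mono[OF A floorlog_wmax_le] B]) auto
    qed
    finally show ?thesis using spec(1,2) 1 2 total_time_le_real by auto
  qed
  have "(\<lambda>x::nat. real (word_bits P x)) \<in> O(\<lambda>x. 512 * log 2 (60000 * real x) + 1)"
    by (rule bigo_of_le) (use main in blast)
  also have "(\<lambda>x::nat. 512 * log 2 (60000 * real x) + 1) \<in> O(\<lambda>x. ln (real x))"
    by real_asymp
  finally have w: "(\<lambda>x::nat. real (word_bits P x)) \<in> O(\<lambda>x. ln (real x))" .
  let ?t = "\<lambda>x::nat. time_bound (real x) +
       80 * sqrt (real x) + 8"
  have "(\<lambda>x::nat. real (run_time P x)) \<in> O(?t)"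
    by (rule bigo_of_le) (use main in blast)
  also have "?t \<in> O(\<lambda>x. real x * ln (real x))"
    unfolding time_bound_def by real_asymp
  finally have t: "(\<lambda>x::nat. real (run_time P x)) \<in> O(\<lambda>x. real x * ln (real x))" .
  \<comment> \<open>The first product is the cost of the word cells, of order sqrt x * log x; the
    bit cells dominate it.\<close>
  let ?s = "\<lambda>x::nat. (80 + 160 * sqrt (real x)) * (512 * log 2 (60000 * real x) + 1) + (80 + 33200 * real x powr (2/3))"
  have "(\<lambda>x::nat. real (space_bits P x)) \<in> O(?s)"
    by (rule bigo_of_le) (use main in blast)
  also have "?s \<in> O(\<lambda>x. real x powr (2/3))"
    by real_asymp
  finally have s: "(\<lambda>x::nat. real (space_bits P x)) \<in> O(\<lambda>x. real x powr (2/3))" .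
  show ?thesis
  proof (intro exI[of _ P] conjI allI impI w t s)
    fix x :: nat assume "0 < x"
    then show "terminates P x" "outputs (final_mem P x) (histogram x)" using main by blast+
  qed
qed

end
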